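(* Let $0<b\le+\infty$ and let $w,r\in L^1_{\mathrm{loc}}[0,b)$ be positive a.e. on $(0,b)$. Let $m$ be the Neumann $m$-function associated with $-\big(\frac1r y'\big)'=\lambda w y$ on $(0,b)$. Then the inequality $$\Big(\int_0^b\frac{1}{r}|f'|^2dx\Big)^2\le K^2\int_0^b|f|^2\,w\,dx\,\int_0^b\frac1w\Big|\Big(\frac1r f'\Big)'\Big|^2dx,\qquad f\in\mathrm{dom}(A_+),$$ is valid if and only if $$\sup_{y>0}\frac{\mathrm{Re}\, m(\mathrm{i}y)}{\mathrm{Im}\, m(\mathrm{i}y)}<\infty .$$
   Context: The inequality is said to be valid if there is $K>0$ such that it holds for all $f\in\mathrm{dom}(A_+)$. Put $R(x)=\int_0^x r\,dt$. The endpoint $b$ is in the limit point case if $w\notin L^1(0,b)$ or $R\notin L^2_w(0,b)$, and otherwise in the limit circle case (this includes a regular endpoint). $$\mathrm{dom}(A_+)=\{f\in L^2_w(0,b):\ f,\ r^{-1}f'\in AC_{\mathrm{loc}}[0,b),\ w^{-1}(r^{-1}f')'\in L^2_w(0,b)\};$$ in the limit circle case at $b$, functions in $\mathrm{dom}(A_+)$ are additionally required to satisfy $\lim_{x\uparrow b}(r^{-1}f')(x)=0$. For $\lambda\in\mathbb{C}\setminus\mathbb{R}$ let $c(x,\lambda),s(x,\lambda)$ be the solutions of $-(\frac1r y')'=\lambda w y$ with $c(0,\lambda)=(\frac1r s')(0,\lambda)=1$ and $(\frac1r c')(0,\lambda)=s(0,\lambda)=0$. The Neumann $m$-function $m(\lambda)$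 is the unique complex number such that $\psi=s-m(\lambda)c$ satisfies: $\psi\in L^2_w(0,b)$ in the limit point case at $b$; $\lim_{x\to b}(\frac1r\psi')(x,\lambda)=0$ in the limit circle case at $b$. *)

theory Defs
  imports "HOL-Analysis.Analysis"
begin

text \<open>
  Functions on \<open>[0,b)\<close>, with \<open>b\<close> possibly infinite, are functions on \<^typ>\<open>real\<close>; their
  values outside \<open>[0,b)\<close> are never used. The open interval \<open>(0,b)\<close> is \<^term>\<open>einterval 0 b\<close>.
  Solutions and elements of the operator domain are complex-valued.
\<close>

definition L1_loc :: "ereal \<Rightarrow> (real \<Rightarrow> real) \<Rightarrow> bool" where
  "L1_loc b g \<longleftrightarrow> (\<forall>c\<ge>0. ereal c < b \<longrightarrow> set_integrable lebesgue {0..c} g)"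

definition L2w :: "ereal \<Rightarrow> (real \<Rightarrow> real) \<Rightarrow> (real \<Rightarrow> 'a::real_normed_vector) \<Rightarrow> bool" where
  "L2w b w f \<longleftrightarrow>
     set_borel_measurable lebesgue (einterval 0 b) f \<and>
     set_integrable lebesgue (einterval 0 b) (\<lambda>x. (norm (f x))\<^sup>2 * w x)"

text \<open>
  Absolute continuity of functions. (The library's \<^const>\<open>absolutely_continuous\<close> is about
  measures.) The families \<open>D\<close> are exactly the finite families of non-overlapping compact
  intervals \<open>k = [Inf k, Sup k]\<close> contained in \<open>S\<close>.
\<close>

definition AC_on :: "real set \<Rightarrow> (real \<Rightarrow> complex) \<Rightarrow> bool" where
  "AC_on S f \<longleftrightarrow>
     (\<forall>\<epsilon>>0. \<exists>\<delta>>0. \<forall>D. D division_of \<Union>D \<and> \<Union>D \<subseteq> S \<and> (\<Sum>k\<in>D. Sup k - Inf k) < \<delta>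
        \<longrightarrow> (\<Sum>k\<in>D. cmod (f (Sup k) - f (Inf k))) < \<epsilon>)"

definition AC_loc :: "ereal \<Rightarrow> (real \<Rightarrow> complex) \<Rightarrow> bool" where
  "AC_loc b f \<longleftrightarrow> (\<forall>c\<ge>0. ereal c < b \<longrightarrow> AC_on {0..c} f)"

text \<open>
  The derivative \<open>f'\<close> of an absolutely continuous function exists only almost everywhere, so
  \<open>r\<^sup>-\<^sup>1 f' \<in> AC_loc[0,b)\<close> means that \<open>r\<^sup>-\<^sup>1 f'\<close> agrees almost everywhere with a locally
  absolutely continuous function \<open>g\<close> on \<open>[0,b)\<close>. By continuity \<open>g\<close> is unique on \<open>[0,b)\<close>; pointwise
  values (at \<open>0\<close>), limits (at \<open>b\<close>) and the derivative of \<open>r\<^sup>-\<^sup>1 f'\<close> refer to this \<open>g\<close>.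
\<close>

definition is_quasi_deriv :: "ereal \<Rightarrow> (real \<Rightarrow> real) \<Rightarrow> (real \<Rightarrow> complex) \<Rightarrow> (real \<Rightarrow> complex) \<Rightarrow> bool"
  where "is_quasi_deriv b r f g \<longleftrightarrow> AC_loc b g \<and>
     (AE x in lebesgue. x \<in> einterval 0 b \<longrightarrow>
        (f has_vector_derivative of_real (r x) * g x) (at x))"

definition quasi_deriv :: "ereal \<Rightarrow> (real \<Rightarrow> real) \<Rightarrow> (real \<Rightarrow> complex) \<Rightarrow> real \<Rightarrow> complex" where
  "quasi_deriv b r f = (SOME g. is_quasi_deriv b r f g)"

definition AC_quasi :: "ereal \<Rightarrow> (real \<Rightarrow> real) \<Rightarrow> (real \<Rightarrow> complex) \<Rightarrow> bool" where
  "AC_quasi b r f \<longleftrightarrow> AC_loc b f \<and> (\<exists>g. is_quasi_deriv b r f g)"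

definition limit_point :: "ereal \<Rightarrow> (real \<Rightarrow> real) \<Rightarrow> (real \<Rightarrow> real) \<Rightarrow> bool" where
  "limit_point b w r \<longleftrightarrow>
     \<not> set_integrable lebesgue (einterval 0 b) w \<or>
     \<not> L2w b w (\<lambda>x. LINT t:{0..x}|lebesgue. r t)"

abbreviation limit_circle :: "ereal \<Rightarrow> (real \<Rightarrow> real) \<Rightarrow> (real \<Rightarrow> real) \<Rightarrow> bool" where
  "limit_circle b w r \<equiv> \<not> limit_point b w r"

definition neumann_at_b :: "ereal \<Rightarrow> (real \<Rightarrow> real) \<Rightarrow> (real \<Rightarrow> complex) \<Rightarrow> bool" where
  "neumann_at_b b r f \<longleftrightarrow> ((quasi_deriv b r f \<circ> real_of_ereal) \<longlongrightarrow> 0) (at_left b)"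

definition dom_A_plus :: "ereal \<Rightarrow> (real \<Rightarrow> real) \<Rightarrow> (real \<Rightarrow> real) \<Rightarrow> (real \<Rightarrow> complex) set" where
  "dom_A_plus b w r = {f. L2w b w f \<and> AC_quasi b r f \<and>
     (\<exists>h. L2w b w h \<and>
        (AE x in lebesgue. x \<in> einterval 0 b \<longrightarrow>
           (quasi_deriv b r f has_vector_derivative of_real (w x) * h x) (at x))) \<and>
     (limit_circle b w r \<longrightarrow> neumann_at_b b r f)}"

definition is_solution ::
    "ereal \<Rightarrow> (real \<Rightarrow> real) \<Rightarrow> (real \<Rightarrow> real) \<Rightarrow> complex \<Rightarrow> (real \<Rightarrow> complex) \<Rightarrow> bool" where
  "is_solution b w r z y \<longleftrightarrow> AC_quasi b r y \<and>
     (AE x in lebesgue. x \<in> einterval 0 b \<longrightarrow>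
        (quasi_deriv b r y has_vector_derivative - (z * of_real (w x) * y x)) (at x))"

definition ivp_solution ::
    "ereal \<Rightarrow> (real \<Rightarrow> real) \<Rightarrow> (real \<Rightarrow> real) \<Rightarrow> complex \<Rightarrow> complex \<Rightarrow> complex \<Rightarrow> real \<Rightarrow> complex" where
  "ivp_solution b w r z \<alpha> \<beta> =
     (SOME y. is_solution b w r z y \<and> y 0 = \<alpha> \<and> quasi_deriv b r y 0 = \<beta>)"

definition sol_c :: "ereal \<Rightarrow> (real \<Rightarrow> real) \<Rightarrow> (real \<Rightarrow> real) \<Rightarrow> complex \<Rightarrow> real \<Rightarrow> complex" where
  "sol_c b w r z = ivp_solution b w r z 1 0"

definition sol_s :: "ereal \<Rightarrow> (real \<Rightarrow> real) \<Rightarrow> (real \<Rightarrow> real) \<Rightarrow> complex \<Rightarrow> real \<Rightarrow> complex" where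
  "sol_s b w r z = ivp_solution b w r z 0 1"

text \<open>The spectral parameter \<open>z\<close> is written \<open>\<lambda>\<close> in the literature and is nonreal in the definition of \<open>m\<close>.\<close>

definition neumann_m :: "ereal \<Rightarrow> (real \<Rightarrow> real) \<Rightarrow> (real \<Rightarrow> real) \<Rightarrow> complex \<Rightarrow> complex" where
  "neumann_m b w r z = (THE m.
     let \<psi> = (\<lambda>x. sol_s b w r z x - m * sol_c b w r z x) in
     if limit_point b w r then L2w b w \<psi> else neumann_at_b b r \<psi>)"

end

theory Submission
  imports Defs
begin

text \<open>
  Write \<open>g = r\<^sup>-\<^sup>1 f'\<close>, \<open>h = w\<^sup>-\<^sup>1 g'\<close> and
  \<open>D(f) = \<integral> r |g|\<^sup>2\<close>, \<open>N(f) = \<integral> w |f|\<^sup>2\<close>, \<open>H(f) = \<integral> w |h|\<^sup>2\<close>; the inequality is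
  \<open>D(f)\<^sup>2 \<le> K\<^sup>2 N(f) H(f)\<close>.
  
  The analytic core is that \<open>cnj f * g\<close> tends to \<open>0\<close> at \<open>b\<close> for every \<open>f\<close> in the domain, with \<open>D(f)\<close>
  finite, in the limit point and in the limit circle case alike (\<open>dirichlet_limit_real\<close>). Integrating
  \<open>(cnj f * g)'\<close> then gives Green's identity without a boundary term at \<open>b\<close> (\<open>green_real\<close>,
  \<open>green_complex\<close>):
  \<open>D(f) + \<integral> w cnj f h = - cnj (f 0) * g 0\<close>.
  
  Put \<open>m = m(\<i>y)\<close>. The Weyl solution \<open>\<psi> = s - m c\<close> has \<open>\<psi> 0 = - m\<close>, quasi-derivative \<open>1\<close> at \<open>0\<close> and
  \<open>h = - \<i> y \<psi>\<close>, so Green's identity reads \<open>Re m = D(\<psi>)\<close>, \<open>Im m = y N(\<psi>) > 0\<close>, while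
  \<open>H(\<psi>) = y\<^sup>2 N(\<psi>)\<close>. Hence the inequality for \<open>\<psi>\<close> says exactly that \<open>Re m / Im m \<le> K\<close>, which is one
  direction (\<open>ratio_le_of_inequality\<close>).
  
  Conversely, let \<open>Re m(\<i>y) \<le> M Im m(\<i>y)\<close> for all \<open>y > 0\<close>, and let \<open>f\<close> be in the domain. The function
  \<open>f\<^sub>0 = f - g(0) \<psi>\<close> has vanishing quasi-derivative at \<open>0\<close>, so it belongs to the domain of a nonnegative
  self-adjoint operator, and \<open>h\<^sub>0 + \<i> y f\<^sub>0 = h + \<i> y f\<close>. Therefore
  \<open>H(f\<^sub>0) + y\<^sup>2 N(f\<^sub>0) = \<integral> w |h + \<i> y f|\<^sup>2 \<le> 2 H(f) + 2 y\<^sup>2 N(f)\<close>, and this quantity also bounds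
  \<open>2 y D(f\<^sub>0)\<close>. As \<open>D(\<psi>) \<le> M y N(\<psi>)\<close>, both parts of \<open>f = f\<^sub>0 + g(0) \<psi>\<close> are controlled, which yields
  \<open>D(f) \<le> C (H(f) / y + y N(f))\<close> with \<open>C = 2 + 12 M\<close> (\<open>dirichlet_bound\<close>). Optimising over \<open>y\<close>
  (\<open>square_le_of_scaled_bound\<close>) gives the inequality with \<open>K = 2 C\<close>.
  
  Before this, three things have to be provided for merely integrable coefficients: that indefinite
  integrals are absolutely continuous with the integrand as derivative almost everywhere, and that an
  absolutely continuous function is recovered from its almost everywhere derivative; that the initial
  value problems are solvable (\<open>linear_system_solution_exists\<close>); and that \<open>m\<close> exists and is unique
  (\<open>Weyl_solution_exists\<close>, \<open>Weyl_solution_unique\<close>).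
\<close>

section \<open>Differentiation of indefinite integrals\<close>

text \<open>
  The points at which arbitrarily short intervals have an average of \<open>f\<close> differing from the value of \<open>f\<close>
  by at least \<open>e\<close>. Such intervals, taken fine for a Henstock gauge and thinned out by Vitali's covering
  lemma, form a tagged partial division on which Henstock's lemma bounds their total length.
\<close>

lemma negligible_slow_diff:
  fixes f :: "real \<Rightarrow> 'a::euclidean_space"
  assumes f: "f integrable_on {a..b}" and e: "e > 0"
  defines "E \<equiv> {x\<in>{a..b}. \<forall>d>0. \<exists>u v. u < v \<and> v - u < d \<and> x \<in> {u..v} \<and> {u..v} \<subseteq> {a..b} \<and>
              e * (v - u) \<le> norm (integral {u..v} f - (v - u) *\<^sub>R f x)}"
  shows "negligible E"
  unfolding negligible_outer_le
proof (intro allI impI)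
  fix \<epsilon> :: real assume \<epsilon>: "\<epsilon> > 0"
  have "e * \<epsilon> / 5 > 0" using e \<epsilon> by simp
  from f have "f integrable_on cbox a b" by simp
  then obtain \<gamma> where g: "gauge \<gamma>"
    and H: "\<And>p. \<lbrakk>p tagged_partial_division_of (cbox a b); \<gamma> fine p\<rbrakk> \<Longrightarrow>
             (\<Sum>(x,k)\<in>p. norm (measure lborel k *\<^sub>R f x - integral k f)) < e * \<epsilon> / 5"
    using \<open>e * \<epsilon> / 5 > 0\<close> by (rule Henstock_lemma) blast
  define K where "K = {(x,u,v). u < v \<and> v - u \<le> 1 \<and> x \<in> {u..v} \<and> {u..v} \<subseteq> {a..b} \<and> {u..v} \<subseteq> \<gamma> x \<and>
              e * (v - u) \<le> norm (integral {u..v} f - (v - u) *\<^sub>R f x)}"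
  define cc where "cc = (\<lambda>(x::real,u::real,v::real). (u + v) / 2)"
  define rr where "rr = (\<lambda>(x::real,u::real,v::real). (v - u) / 2)"
  have cball_eq: "cball (cc (x,u,v)) (rr (x,u,v)) = {u..v}" for x u v
    by (auto simp: cc_def rr_def dist_real_def abs_if field_simps split: if_splits)
  have cover: "E \<subseteq> (\<Union>i\<in>K. cball (cc i) (rr i))"
  proof
    fix x assume x: "x \<in> E"
    obtain d where d: "d > 0" "ball x d \<subseteq> \<gamma> x"
      using g unfolding gauge_def by (meson open_contains_ball)
    obtain u v where uv: "u < v" "v - u < min d 1" "x \<in> {u..v}" "{u..v} \<subseteq> {a..b}"
      "e * (v - u) \<le> norm (integral {u..v} f - (v - u) *\<^sub>R f x)"
    proof -
      have "min d 1 > 0" using d(1) by simp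
      then show ?thesis using x that unfolding E_def by blast
    qed
    have "{u..v} \<subseteq> ball x d" using uv by (auto simp: dist_real_def)
    then have "(x,u,v) \<in> K" using uv d unfolding K_def by auto
    then show "x \<in> (\<Union>i\<in>K. cball (cc i) (rr i))" using cball_eq uv(3) by blast
  qed
  have rad: "0 < rr i \<and> rr i \<le> 1" if "i \<in> K" for i
    using that by (auto simp: K_def rr_def)
  obtain C where C: "countable C" "C \<subseteq> K"
     "pairwise (\<lambda>i j. disjnt (cball (cc i) (rr i)) (cball (cc j) (rr j))) C"
     "E \<subseteq> (\<Union>i\<in>C. cball (cc i) (5 * rr i))"
    by (rule Vitali_covering_lemma_cballs[OF cover rad])
  have bound: "measure lebesgue (\<Union>i\<in>I. cball (cc i) (5 * rr i)) \<le> \<epsilon>" if I: "I \<subseteq> C" "finite I" for I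
  proof -
    define q where "q = (\<lambda>(x::real,u::real,v::real). (x,{u..v}))"
    have q_cball: "snd (q i) = cball (cc i) (rr i)" for i
      by (cases i) (simp only: q_def cball_eq prod.case snd_conv)
    have disj: "disjnt (snd (q i)) (snd (q j))" if "i \<in> I" "j \<in> I" "i \<noteq> j" for i j
      using C(3) that I unfolding pairwise_def q_cball by blast
    have inj: "inj_on q I"
    proof (rule inj_onI)
      fix i j assume ij: "i \<in> I" "j \<in> I" "q i = q j"
      show "i = j"
      proof (rule ccontr)
        assume "i \<noteq> j"
        with disj ij have "snd (q i) = {}" by (metis disjnt_self_iff_empty)
        moreover have "i \<in> K" using ij I C by auto
        ultimately show False by (auto simp: q_def K_def split: prod.splits)
      qed
    qed
    have part: "q ` I tagged_partial_division_of (cbox a b)"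
      unfolding tagged_partial_division_of_def
    proof (intro conjI allI impI)
      show "finite (q ` I)" using I by simp
    next
      fix x k assume "(x,k) \<in> q ` I"
      then obtain i where "i \<in> I" "(x,k) = q i" by auto
      then have "i \<in> K" using I C by auto
      then show "x \<in> k" "k \<subseteq> cbox a b" "\<exists>a b. k = cbox a b" using \<open>(x,k) = q i\<close>
        by (auto simp: K_def q_def intro: exI split: prod.splits) 
    next
      fix x1 k1 x2 k2 assume A: "(x1,k1) \<in> q ` I \<and> (x2,k2) \<in> q ` I \<and> (x1,k1) \<noteq> (x2,k2)"
      then obtain i j where ij: "i \<in> I" "(x1,k1) = q i" "j \<in> I" "(x2,k2) = q j" by blast
      with A have "i \<noteq> j" by metis
      with disj ij have "disjnt k1 k2" by (metis snd_conv)
      then show "interior k1 \<inter> interior k2 = {}"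
        by (meson disjnt_def disjoint_iff interior_subset subsetD)
    qed
    have fine: "\<gamma> fine (q ` I)"
      unfolding fine_def using I C by (auto simp: q_def K_def)
    have "(\<Sum>i\<in>I. e * (2 * rr i)) \<le> (\<Sum>i\<in>I. (\<lambda>(x,k). norm (measure lborel k *\<^sub>R f x - integral k f)) (q i))"
    proof (rule sum_mono)
      fix i assume "i \<in> I"
      then have "i \<in> K" using I C by auto
      then obtain x u v where i: "i = (x,u,v)" "u < v" 
          "e * (v - u) \<le> norm (integral {u..v} f - (v - u) *\<^sub>R f x)"
        unfolding K_def by blast
      moreover have "2 * rr i = v - u" by (simp add: i(1) rr_def)
      ultimately show "e * (2 * rr i) \<le> (\<lambda>(x,k). norm (measure lborel k *\<^sub>R f x - integral k f)) (q i)"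
        by (simp add: q_def norm_minus_commute)
    qed
    also have "\<dots> = (\<Sum>(x,k)\<in>q ` I. norm (measure lborel k *\<^sub>R f x - integral k f))"
      by (simp add: sum.reindex[OF inj])
    also have "\<dots> < e * \<epsilon> / 5" by (rule H[OF part fine])
    finally have "e * (\<Sum>i\<in>I. 2 * rr i) < e * (\<epsilon> / 5)" by (simp add: sum_distrib_left)
    then have small: "(\<Sum>i\<in>I. 2 * rr i) < \<epsilon> / 5" using e by simp
    have "measure lebesgue (\<Union>i\<in>I. cball (cc i) (5 * rr i)) \<le> (\<Sum>i\<in>I. measure lebesgue (cball (cc i) (5 * rr i)))"
      by (rule measure_UNION_le) (use I in auto)
    also have "\<dots> = (\<Sum>i\<in>I. 5 * (2 * rr i))"
    proof (rule sum.cong)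
      fix i assume "i \<in> I"
      then have "0 < rr i" using rad I(1) C(2) by blast
      then show "measure lebesgue (cball (cc i) (5 * rr i)) = 5 * (2 * rr i)"
        by (simp add: cball_eq_atLeastAtMost)
    qed simp
    also have "\<dots> = 5 * (\<Sum>i\<in>I. 2 * rr i)" by (simp add: sum_distrib_left)
    also have "\<dots> \<le> \<epsilon>" using small by simp
    finally show ?thesis .
  qed
  have m: "cball (cc i) (5 * rr i) \<in> lmeasurable" for i by simp
  show "\<exists>T. E \<subseteq> T \<and> T \<in> lmeasurable \<and> measure lebesgue T \<le> \<epsilon>"
    using C(4) fmeasurable_UN_bound[OF C(1) m bound] measure_UN_bound[OF C(1) m bound] by blast
qed

theorem indefinite_integral_has_vector_derivative_ae:
  fixes f :: "real \<Rightarrow> 'a::euclidean_space"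
  assumes f: "f integrable_on {a..b}"
  obtains N where "negligible N"
    "\<And>x. x \<in> {a<..<b} - N \<Longrightarrow> ((\<lambda>x. integral {a..x} f) has_vector_derivative f x) (at x)"
proof -
  define E where "E e = {x\<in>{a..b}. \<forall>d>0. \<exists>u v. u < v \<and> v - u < d \<and> x \<in> {u..v} \<and> {u..v} \<subseteq> {a..b} \<and>
              e * (v - u) \<le> norm (integral {u..v} f - (v - u) *\<^sub>R f x)}" for e :: real
  define N where "N = (\<Union>n. E (inverse (real (Suc n))))"
  have "negligible N" unfolding N_def E_def
    by (intro negligible_countable_Union[of "range _"] countable_image)
       (use negligible_slow_diff[OF f] in \<open>auto simp del: of_nat_Suc\<close>)
  moreover have "((\<lambda>x. integral {a..x} f) has_vector_derivative f x) (at x)" if x: "x \<in> {a<..<b} - N" for x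
    unfolding has_vector_derivative_def has_derivative_at_alt
  proof (intro conjI allI impI)
    show "bounded_linear (\<lambda>h. h *\<^sub>R f x)" by (rule bounded_linear_scaleR_left)
    fix e :: real assume "e > 0"
    then obtain n where n: "inverse (real (Suc n)) < e" using reals_Archimedean by blast
    have "x \<notin> E (inverse (real (Suc n)))" using x by (auto simp: N_def)
    then obtain d where d: "d > 0" and D: "\<And>u v. u < v \<Longrightarrow> v - u < d \<Longrightarrow> x \<in> {u..v} \<Longrightarrow> {u..v} \<subseteq> {a..b} \<Longrightarrow>
      norm (integral {u..v} f - (v - u) *\<^sub>R f x) < inverse (real (Suc n)) * (v - u)"
    proof -
      have "\<exists>d>0. \<forall>u v. \<not> (u < v \<and> v - u < d \<and> x \<in> {u..v} \<and> {u..v} \<subseteq> {a..b} \<and>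
          inverse (real (Suc n)) * (v - u) \<le> norm (integral {u..v} f - (v - u) *\<^sub>R f x))"
        using \<open>x \<notin> E _\<close> x unfolding E_def by (auto simp del: of_nat_Suc)
      then obtain d where "d > 0" and d: "\<And>u v. \<not> (u < v \<and> v - u < d \<and> x \<in> {u..v} \<and> {u..v} \<subseteq> {a..b} \<and>
          inverse (real (Suc n)) * (v - u) \<le> norm (integral {u..v} f - (v - u) *\<^sub>R f x))" by blast
      show ?thesis
        by (rule that[OF \<open>d > 0\<close>]) (use d not_le in blast)
    qed
    show "\<exists>d>0. \<forall>y. norm (y - x) < d \<longrightarrow>
       norm (integral {a..y} f - integral {a..x} f - (y - x) *\<^sub>R f x) \<le> e * norm (y - x)"
    proof (intro exI[of _ "min d (min (x - a) (b - x))"] conjI allI impI)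
      show "0 < min d (min (x - a) (b - x))" using d x by auto
      fix y assume y: "norm (y - x) < min d (min (x - a) (b - x))"
      then have yab: "a < y" "y < b" by (auto simp: abs_if split: if_splits)
      consider "y = x" | "x < y" | "y < x" by linarith
      then show "norm (integral {a..y} f - integral {a..x} f - (y - x) *\<^sub>R f x) \<le> e * norm (y - x)"
      proof cases
        case 2
        have "f integrable_on {a..y}" using f yab by (rule_tac integrable_on_subinterval) auto
        then have "integral {a..y} f - integral {a..x} f = integral {x..y} f"
          using Henstock_Kurzweil_Integration.integral_combine[of a x y f] x 2 by (auto simp: algebra_simps)
        moreover have "norm (integral {x..y} f - (y - x) *\<^sub>R f x) < inverse (real (Suc n)) * (y - x)"
          by (rule D) (use 2 y x yab in auto)
        moreover have "inverse (real (Suc n)) * (y - x) \<le> e * (y - x)" using n 2 by (intro mult_right_mono) auto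
        ultimately show ?thesis using 2 by (metis abs_of_pos diff_gt_0_iff_gt less_le_trans less_imp_le real_norm_def)
      next
        case 3
        have "f integrable_on {a..x}" using f x by (rule_tac integrable_on_subinterval) auto
        then have eq: "integral {a..y} f - integral {a..x} f = - integral {y..x} f"
          using Henstock_Kurzweil_Integration.integral_combine[of a y x f] yab 3 by (auto simp: algebra_simps)
        have "norm (integral {y..x} f - (x - y) *\<^sub>R f x) < inverse (real (Suc n)) * (x - y)"
          by (rule D) (use 3 y x yab in auto)
        moreover have "inverse (real (Suc n)) * (x - y) \<le> e * (x - y)" using n 3 by (intro mult_right_mono) auto
        moreover have "- integral {y..x} f - (y - x) *\<^sub>R f x = - (integral {y..x} f - (x - y) *\<^sub>R f x)"
          by (simp add: algebra_simps)
        moreover have "norm (y - x) = x - y" using 3 by simp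
        ultimately show ?thesis unfolding eq by (metis norm_minus_cancel less_le_trans less_imp_le)
      qed simp
    qed
  qed
  ultimately show ?thesis using that by blast
qed

section \<open>Absolutely continuous functions\<close>

text \<open>
  The fundamental theorem of calculus for absolutely continuous functions. The gauge is chosen by
  differentiability off the exceptional null set \<open>M\<close>, and inside an open set of small measure on \<open>M\<close>, where
  absolute continuity controls the increments.
\<close>

theorem AC_on_has_integral:
  fixes f :: "real \<Rightarrow> complex"
  assumes ab: "a \<le> b" and AC: "AC_on {a..b} f" and N: "negligible N"
    and deriv: "\<And>x. x \<in> {a<..<b} - N \<Longrightarrow> (f has_vector_derivative \<phi> x) (at x)"
  shows "(\<phi> has_integral (f b - f a)) {a..b}"
proof -
  define M where "M = N \<union> {a,b}"
  have M: "negligible M" using N unfolding M_def by (auto intro: negligible_Un negligible_finite)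
  define \<psi> where "\<psi> x = (if x \<in> M then 0 else \<phi> x)" for x
  have "(\<psi> has_integral (f b - f a)) (cbox a b)"
    unfolding has_integral
  proof (intro allI impI)
    fix e :: real assume e: "e > 0"
    then have "e / 2 > 0" by simp
    from AC[unfolded AC_on_def, rule_format, OF this] obtain \<delta> where \<delta>: "\<delta> > 0" and ac: "\<And>D. D division_of \<Union>D \<Longrightarrow> \<Union>D \<subseteq> {a..b} \<Longrightarrow>
      (\<Sum>k\<in>D. Sup k - Inf k) < \<delta> \<Longrightarrow> (\<Sum>k\<in>D. cmod (f (Sup k) - f (Inf k))) < e / 2"
      by blast
    have Mset: "M \<in> sets lebesgue" and Mnull: "M \<in> null_sets lebesgue"
      using M negligible_imp_sets negligible_iff_null_sets by auto
    obtain U where U: "open U" "M \<subseteq> U" "(U - M) \<in> lmeasurable" "emeasure lebesgue (U - M) < ennreal \<delta>"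
      by (rule sets_lebesgue_outer_open[OF Mset \<delta>])
    have Uem: "emeasure lebesgue U < ennreal \<delta>"
      using U(4) emeasure_Diff_null_set[OF Mnull, of U] U(1) by simp
    then have Um: "U \<in> lmeasurable"
      using U(1) by (intro fmeasurableI) (auto simp: less_top intro: less_trans)
    have Ume: "measure lebesgue U < \<delta>"
      using Uem Um \<delta> by (simp add: emeasure_eq_measure2 ennreal_less_iff)
    define e' where "e' = e / 2 / (b - a + 1)"
    have e': "e' > 0" "e' * (b - a) < e / 2"
      using e ab by (auto simp: e'_def field_simps)
    have "\<exists>d>0. x \<in> {a..b} - M \<longrightarrow> (\<forall>y. norm (y - x) < d \<longrightarrow> norm (f y - f x - (y - x) *\<^sub>R \<phi> x) \<le> e' * norm (y - x))" for x
    proof (cases "x \<in> {a..b} - M")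
      case True
      then have "(f has_vector_derivative \<phi> x) (at x)" by (intro deriv) (auto simp: M_def)
      then show ?thesis using e'(1) unfolding has_vector_derivative_def has_derivative_at_alt by blast
    next
      case False then show ?thesis by (intro exI[of _ 1]) auto
    qed
    then obtain d where d: "\<And>x. d x > 0" and der: "\<And>x y. x \<in> {a..b} - M \<Longrightarrow> norm (y - x) < d x \<Longrightarrow>
        norm (f y - f x - (y - x) *\<^sub>R \<phi> x) \<le> e' * norm (y - x)" by metis
    define \<gamma> where "\<gamma> x = (if x \<in> M then U else ball x (d x))" for x
    have gauge: "gauge \<gamma>" using U d by (auto simp: gauge_def \<gamma>_def)
    show "\<exists>\<gamma>. gauge \<gamma> \<and> (\<forall>p. p tagged_division_of cbox a b \<and> \<gamma> fine p \<longrightarrow>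
        norm ((\<Sum>(x,k)\<in>p. measure lborel k *\<^sub>R \<psi> x) - (f b - f a)) < e)"
    proof (intro exI[of _ \<gamma>] conjI gauge allI impI, elim conjE)
      fix p assume p: "p tagged_division_of cbox a b" and fine: "\<gamma> fine p"
      have p_ab: "p tagged_division_of {a..b}" using p by simp
      have finp: "finite p" using p by blast
      define pM where "pM = {xk\<in>p. fst xk \<in> M}"
      have pM: "pM \<subseteq> p" "finite pM" using finp by (auto simp: pM_def)
      have interval: "\<exists>u v. k = {u..v} \<and> u \<le> v \<and> x \<in> {u..v} \<and> {u..v} \<subseteq> {a..b} \<and> {u..v} \<subseteq> \<gamma> x" if "(x,k) \<in> p" for x k
      proof -
        from p that have "x \<in> k" "k \<subseteq> cbox a b" "\<exists>u v. k = cbox u v"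
          by (auto simp: tagged_division_of_def tagged_partial_division_of_def)
        moreover have "k \<subseteq> \<gamma> x" using fine that by (auto simp: fine_def)
        ultimately obtain u v where "k = {u..v}" "x \<in> {u..v}" "{u..v} \<subseteq> {a..b}" "{u..v} \<subseteq> \<gamma> x"
          by auto
        then show ?thesis by (intro exI[of _ u] exI[of _ v]) auto
      qed
      have tele: "(\<Sum>(x,k)\<in>p. f (Sup k) - f (Inf k)) = f b - f a"
        by (rule additive_tagged_division_1[OF ab p_ab])
      have telen: "(\<Sum>(x,k)\<in>p. Sup k - Inf k) = b - a"
        by (rule additive_tagged_division_1[OF ab p_ab])
      have "norm ((\<Sum>(x,k)\<in>p. measure lborel k *\<^sub>R \<psi> x) - (f b - f a))
          = norm (\<Sum>(x,k)\<in>p. measure lborel k *\<^sub>R \<psi> x - (f (Sup k) - f (Inf k)))"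
        by (simp add: tele[symmetric] sum_subtractf[symmetric] case_prod_unfold)
      also have "\<dots> \<le> (\<Sum>(x,k)\<in>p. norm (measure lborel k *\<^sub>R \<psi> x - (f (Sup k) - f (Inf k))))"
        by (simp add: case_prod_unfold norm_sum)
      also have "\<dots> \<le> (\<Sum>xk\<in>p. e' * (Sup (snd xk) - Inf (snd xk)) +
            (if xk \<in> pM then norm (f (Sup (snd xk)) - f (Inf (snd xk))) else 0))"
      proof (rule sum_mono, clarify)
        fix x k assume xk: "(x,k) \<in> p"
        then obtain u v where k: "k = {u..v}" "u \<le> v" "x \<in> {u..v}" "{u..v} \<subseteq> {a..b}" "{u..v} \<subseteq> \<gamma> x"
          using interval by blast
        show "norm (measure lborel k *\<^sub>R \<psi> x - (f (Sup k) - f (Inf k))) \<le> e' * (Sup (snd (x,k)) - Inf (snd (x,k))) +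
            (if (x,k) \<in> pM then norm (f (Sup (snd (x,k))) - f (Inf (snd (x,k)))) else 0)"
        proof (cases "x \<in> M")
          case True
          then have "\<psi> x = 0" "(x,k) \<in> pM" using xk by (auto simp: \<psi>_def pM_def)
          moreover have "e' * (v - u) \<ge> 0" using k e' by simp
          ultimately show ?thesis using k by (simp add: norm_minus_commute)
        next
          case False
          then have "\<psi> x = \<phi> x" "(x,k) \<notin> pM" by (auto simp: \<psi>_def pM_def)
          have x: "x \<in> {a..b} - M" using k False by auto
          have "u \<in> {u..v}" "v \<in> {u..v}" "{u..v} \<subseteq> ball x (d x)" using k False by (auto simp: \<gamma>_def)
          then have "u \<in> ball x (d x)" "v \<in> ball x (d x)" by blast+
          then have 1: "norm (f u - f x - (u - x) *\<^sub>R \<phi> x) \<le> e' * norm (u - x)"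
            "norm (f v - f x - (v - x) *\<^sub>R \<phi> x) \<le> e' * norm (v - x)"
            using der[OF x] by (auto simp: dist_norm norm_minus_commute)
          have eq: "(v - u) *\<^sub>R \<phi> x - (f v - f u) = (f u - f x - (u - x) *\<^sub>R \<phi> x) - (f v - f x - (v - x) *\<^sub>R \<phi> x)"
            by (simp add: algebra_simps)
          have "norm ((v - u) *\<^sub>R \<phi> x - (f v - f u)) \<le> e' * norm (u - x) + e' * norm (v - x)"
            unfolding eq by (rule order_trans[OF norm_triangle_ineq4 add_mono[OF 1]])
          also have "\<dots> = e' * (v - u)" using k by (simp add: algebra_simps)
          finally show ?thesis using k \<open>\<psi> x = \<phi> x\<close> \<open>(x,k) \<notin> pM\<close> by simp
        qed
      qed
      also have "\<dots> = e' * (b - a) + (\<Sum>xk\<in>pM. norm (f (Sup (snd xk)) - f (Inf (snd xk))))"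
        using finp pM by (simp add: sum.distrib sum_distrib_left[symmetric] telen[symmetric] case_prod_unfold
            sum.inter_restrict[symmetric] Int_absorb1)
      also have "\<dots> < e"
      proof -
        have tp: "pM tagged_partial_division_of {a..b}"
          by (rule tagged_partial_division_subset[OF p_ab[unfolded tagged_division_of_def, THEN conjunct1] pM(1)])
        then have tp': "pM tagged_division_of \<Union>(snd ` pM)" by (rule tagged_partial_division_of_Union_self)
        have div: "snd ` pM division_of \<Union>(snd ` pM)" by (rule division_of_tagged_division[OF tp'])
        \<comment> \<open>Totalised at the empty interval, for which \<open>Sup\<close> and \<open>Inf\<close> are unspecified.\<close>
        define G where "G k = (if k = {} then 0 else cmod (f (Sup k) - f (Inf k)))" for k
        have degen: "G (cbox u v) = 0" if "box u v = {}" for u v :: real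
        proof -
          have "v \<le> u" using that by auto
          then consider "v < u" | "u = v" by linarith
          then show ?thesis by cases (auto simp: G_def)
        qed
        have Geq: "cmod (f (Sup (snd xk)) - f (Inf (snd xk))) = G (snd xk)" if "xk \<in> pM" for xk
          using that interval[of "fst xk" "snd xk"] by (auto simp: pM_def G_def)
        have inU: "\<Union>(snd ` pM) \<subseteq> U \<inter> {a..b}"
        proof
          fix y assume "y \<in> \<Union>(snd ` pM)"
          then obtain x k where "(x,k) \<in> p" "x \<in> M" "y \<in> k" by (auto simp: pM_def)
          moreover from interval[OF this(1)] have "k \<subseteq> {a..b}" "k \<subseteq> \<gamma> x" by auto
          ultimately show "y \<in> U \<inter> {a..b}" by (auto simp: \<gamma>_def)
        qed
        have "(\<Sum>k\<in>snd ` pM. Sup k - Inf k) = (\<Sum>k\<in>snd ` pM. measure lebesgue k)"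
        proof (rule sum.cong)
          fix k assume "k \<in> snd ` pM"
          then obtain x where "(x,k) \<in> p" by (auto simp: pM_def)
          with interval obtain u v where "k = {u..v}" "u \<le> v" by blast
          then show "Sup k - Inf k = measure lebesgue k" by simp
        qed simp
        also have "\<dots> = measure lebesgue (\<Union>(snd ` pM))" by (rule content_division[OF div])
        also have "\<dots> \<le> measure lebesgue U"
          by (rule measure_mono_fmeasurable) (use inU Um lmeasurable_division[OF div] in auto)
        also have "\<dots> < \<delta>" by (rule Ume)
        finally have "(\<Sum>k\<in>snd ` pM. cmod (f (Sup k) - f (Inf k))) < e / 2"
          by (intro ac div) (use inU in auto)
        moreover have "(\<Sum>xk\<in>pM. norm (f (Sup (snd xk)) - f (Inf (snd xk)))) = (\<Sum>k\<in>snd ` pM. cmod (f (Sup k) - f (Inf k)))"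
        proof -
          have "(\<Sum>xk\<in>pM. norm (f (Sup (snd xk)) - f (Inf (snd xk)))) = (\<Sum>(x,k)\<in>pM. G k)"
            by (simp add: Geq case_prod_unfold cong: sum.cong)
          also have "\<dots> = (\<Sum>k\<in>snd ` pM. G k)"
            by (rule sum.over_tagged_division_lemma[OF tp']) (rule degen)
          also have "\<dots> = (\<Sum>k\<in>snd ` pM. cmod (f (Sup k) - f (Inf k)))"
            by (rule sum.cong) (use Geq in fastforce)+
          finally show ?thesis .
        qed
        ultimately show ?thesis using e'(2) by simp
      qed
      finally show "norm ((\<Sum>(x,k)\<in>p. measure lborel k *\<^sub>R \<psi> x) - (f b - f a)) < e" .
    qed
  qed
  then have "(\<psi> has_integral (f b - f a)) {a..b}" by simp
  then show ?thesis
    by (rule has_integral_spike[OF M, rotated]) (auto simp: \<psi>_def)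
qed

theorem AC_on_indefinite_integral:
  fixes F :: "real \<Rightarrow> complex"
  assumes \<phi>: "\<phi> absolutely_integrable_on {a..b}"
    and F: "\<And>x. x \<in> {a..b} \<Longrightarrow> F x = F a + integral {a..x} \<phi>"
  shows "AC_on {a..b} F"
  unfolding AC_on_def
proof (intro allI impI)
  fix e :: real assume e: "e > 0"
  \<comment> \<open>Truncation at height \<open>n\<close>: the excess \<open>\<psi> n\<close> has small integral, the rest is bounded by \<open>n\<close>.\<close>
  define \<psi> where "\<psi> n x = max 0 (norm (\<phi> x) - real n)" for n x
  have nint: "(\<lambda>x. norm (\<phi> x)) absolutely_integrable_on {a..b}"
    using \<phi> by (rule set_integrable_norm)
  have \<phi>ab: "\<phi> integrable_on {a..b}" by (rule set_lebesgue_integral_eq_integral(1)[OF \<phi>])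
  have nab: "(\<lambda>x. norm (\<phi> x)) integrable_on {a..b}" by (rule set_lebesgue_integral_eq_integral(1)[OF nint])
  have \<psi>int: "\<psi> n absolutely_integrable_on {a..b}" for n
    unfolding \<psi>_def using nint
    by (intro absolutely_integrable_max_1 absolutely_integrable_on_const set_integral_diff) auto
  have "(\<lambda>n. integral {a..b} (\<psi> n)) \<longlonglongrightarrow> integral {a..b} (\<lambda>x. 0)"
  proof (rule dominated_convergence(2))
    show "\<psi> n integrable_on {a..b}" for n using \<psi>int set_lebesgue_integral_eq_integral(1) by blast
    show "(\<lambda>x. norm (\<phi> x)) integrable_on {a..b}" using nint set_lebesgue_integral_eq_integral(1) by blast
    show "norm (\<psi> n x) \<le> norm (\<phi> x)" for n x by (auto simp: \<psi>_def)
    show "(\<lambda>n. \<psi> n x) \<longlonglongrightarrow> 0" if "x \<in> {a..b}" for x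
    proof (rule tendsto_eventually)
      obtain n0 where "norm (\<phi> x) \<le> real n0" using real_arch_simple by blast
      then show "\<forall>\<^sub>F n in sequentially. \<psi> n x = 0"
        unfolding eventually_sequentially \<psi>_def by (intro exI[of _ n0]) auto
    qed
  qed
  then have "\<forall>\<^sub>F n in sequentially. integral {a..b} (\<psi> n) < e / 2"
    using e by (intro order_tendstoD(2)) auto
  then obtain n where n: "integral {a..b} (\<psi> n) < e / 2" using eventually_sequentially by auto
  define \<delta> where "\<delta> = e / 2 / (real n + 1)"
  show "\<exists>\<delta>>0. \<forall>D. D division_of \<Union>D \<and> \<Union>D \<subseteq> {a..b} \<and> (\<Sum>k\<in>D. Sup k - Inf k) < \<delta> \<longrightarrow>
      (\<Sum>k\<in>D. cmod (F (Sup k) - F (Inf k))) < e"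
  proof (intro exI[of _ \<delta>] conjI allI impI; (elim conjE)?)
    show "\<delta> > 0" using e by (simp add: \<delta>_def)
    fix D assume D: "D division_of \<Union>D" and sub: "\<Union>D \<subseteq> {a..b}" and small: "(\<Sum>k\<in>D. Sup k - Inf k) < \<delta>"
    have \<psi>i: "\<psi> n integrable_on {a..b}" using \<psi>int set_lebesgue_integral_eq_integral(1) by blast
    have \<psi>D: "\<psi> n integrable_on \<Union>D" 
      by (rule integrable_on_subdivision[OF D]) (use \<psi>i sub in auto)
    have "(\<Sum>k\<in>D. cmod (F (Sup k) - F (Inf k))) \<le> (\<Sum>k\<in>D. real n * (Sup k - Inf k) + integral k (\<psi> n))"
    proof (rule sum_mono)
      fix k assume "k \<in> D"
      with D obtain u v where k: "k = {u..v}" "u \<le> v" 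
        using division_ofD(3,4)[OF D \<open>k \<in> D\<close>] by fastforce
      have kab: "{u..v} \<subseteq> {a..b}" using k(1) sub \<open>k \<in> D\<close> by blast
      then have kab: "{u..v} \<subseteq> {a..b}" "a \<le> u" "v \<le> b" using k(2) by auto
      have \<phi>i: "\<phi> integrable_on {a..v}"
        by (rule integrable_on_subinterval[OF \<phi>ab]) (use kab in auto)
      have nuv: "(\<lambda>x. norm (\<phi> x)) integrable_on {u..v}"
        by (rule integrable_on_subinterval[OF nab kab(1)])
      have \<psi>uv: "\<psi> n integrable_on {u..v}"
        by (rule integrable_on_subinterval[OF \<psi>i kab(1)])
      have "F v - F u = integral {u..v} \<phi>"
        using F[of u] F[of v] Henstock_Kurzweil_Integration.integral_combine[OF kab(2) k(2) \<phi>i] k kab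
        by (simp add: algebra_simps)
      also have "norm \<dots> \<le> integral {u..v} (\<lambda>x. norm (\<phi> x))"
        by (intro integral_norm_bound_integral nuv integrable_on_subinterval[OF \<phi>ab kab(1)]) auto
      also have "\<dots> \<le> integral {u..v} (\<lambda>x. real n + \<psi> n x)"
        by (intro integral_le nuv integrable_add \<psi>uv) (auto simp: \<psi>_def)
      also have "\<dots> = real n * (v - u) + integral {u..v} (\<psi> n)"
        using \<psi>uv k by (subst integral_add) auto
      finally show "cmod (F (Sup k) - F (Inf k)) \<le> real n * (Sup k - Inf k) + integral k (\<psi> n)"
        using k by simp
    qed
    also have "\<dots> = real n * (\<Sum>k\<in>D. Sup k - Inf k) + integral (\<Union>D) (\<psi> n)"
      by (simp add: sum.distrib sum_distrib_left integral_combine_division_topdown[OF \<psi>D D])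
    also have "real n * (\<Sum>k\<in>D. Sup k - Inf k) \<le> (real n + 1) * \<delta>"
    proof -
      have "real n * (\<Sum>k\<in>D. Sup k - Inf k) \<le> real n * \<delta>" using small by (intro mult_left_mono) auto
      then show ?thesis using \<open>\<delta> > 0\<close> by (simp add: algebra_simps)
    qed
    also have "(real n + 1) * \<delta> = e / 2"
      using nonzero_mult_div_cancel_left[of "real n + 1" "e / 2"] by (simp add: \<delta>_def)
    also have "integral (\<Union>D) (\<psi> n) \<le> integral {a..b} (\<psi> n)"
      by (rule integral_subset_le[OF sub \<psi>D \<psi>i]) (auto simp: \<psi>_def)
    finally show "(\<Sum>k\<in>D. cmod (F (Sup k) - F (Inf k))) < e" using n by simp
  qed
qed

lemma AC_on_mult:
  assumes f: "AC_on S f" and g: "AC_on S g"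
    and B: "\<And>x. x \<in> S \<Longrightarrow> cmod (f x) \<le> B" "\<And>x. x \<in> S \<Longrightarrow> cmod (g x) \<le> B"
  shows "AC_on S (\<lambda>x. f x * g x)"
  unfolding AC_on_def
proof (intro allI impI)
  fix e :: real assume "e > 0"
  define C where "C = max B 1"
  have C: "C > 0" "\<And>x. x \<in> S \<Longrightarrow> cmod (f x) \<le> C" "\<And>x. x \<in> S \<Longrightarrow> cmod (g x) \<le> C"
    using B by (force simp: C_def)+
  have "e / (2 * C) > 0" using \<open>e > 0\<close> C by simp
  from f[unfolded AC_on_def, rule_format, OF this] obtain d1 where d1: "d1 > 0"
    "\<And>D. D division_of \<Union>D \<and> \<Union>D \<subseteq> S \<and> (\<Sum>k\<in>D. Sup k - Inf k) < d1 \<Longrightarrow>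
       (\<Sum>k\<in>D. cmod (f (Sup k) - f (Inf k))) < e / (2 * C)" by blast
  from g[unfolded AC_on_def, rule_format, OF \<open>e / (2 * C) > 0\<close>] obtain d2 where d2: "d2 > 0"
    "\<And>D. D division_of \<Union>D \<and> \<Union>D \<subseteq> S \<and> (\<Sum>k\<in>D. Sup k - Inf k) < d2 \<Longrightarrow>
       (\<Sum>k\<in>D. cmod (g (Sup k) - g (Inf k))) < e / (2 * C)" by blast
  show "\<exists>\<delta>>0. \<forall>D. D division_of \<Union>D \<and> \<Union>D \<subseteq> S \<and> (\<Sum>k\<in>D. Sup k - Inf k) < \<delta> \<longrightarrow>
      (\<Sum>k\<in>D. cmod (f (Sup k) * g (Sup k) - f (Inf k) * g (Inf k))) < e"
  proof (intro exI[of _ "min d1 d2"] conjI allI impI; (elim conjE)?)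
    show "min d1 d2 > 0" using d1 d2 by simp
    fix D assume D: "D division_of \<Union>D" "\<Union>D \<subseteq> S" "(\<Sum>k\<in>D. Sup k - Inf k) < min d1 d2"
    have "(\<Sum>k\<in>D. cmod (f (Sup k) * g (Sup k) - f (Inf k) * g (Inf k)))
        \<le> (\<Sum>k\<in>D. C * cmod (f (Sup k) - f (Inf k)) + C * cmod (g (Sup k) - g (Inf k)))"
    proof (rule sum_mono)
      fix k assume "k \<in> D"
      then obtain u v where "k = cbox u v" "k \<noteq> {}" using division_ofD(3,4)[OF D(1)] by blast
      then have k: "k = {u..v}" "u \<le> v" by auto
      then have "{u..v} \<subseteq> S" using \<open>k \<in> D\<close> D(2) by blast
      then have uv: "u \<in> S" "v \<in> S" using k by auto
      have "f v * g v - f u * g u = (f v - f u) * g v + f u * (g v - g u)" by (simp add: algebra_simps)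
      also have "cmod \<dots> \<le> cmod ((f v - f u) * g v) + cmod (f u * (g v - g u))" by (rule norm_triangle_ineq)
      also have "\<dots> = cmod (g v) * cmod (f v - f u) + cmod (f u) * cmod (g v - g u)" by (simp add: norm_mult)
      also have "\<dots> \<le> C * cmod (f v - f u) + C * cmod (g v - g u)"
        using uv C by (intro add_mono mult_right_mono) auto
      finally show "cmod (f (Sup k) * g (Sup k) - f (Inf k) * g (Inf k))
        \<le> C * cmod (f (Sup k) - f (Inf k)) + C * cmod (g (Sup k) - g (Inf k))" using k by simp
    qed
    also have "\<dots> = C * ((\<Sum>k\<in>D. cmod (f (Sup k) - f (Inf k))) + (\<Sum>k\<in>D. cmod (g (Sup k) - g (Inf k))))"
      by (simp add: sum.distrib sum_distrib_left distrib_left)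
    also have "\<dots> < C * (e / (2 * C) + e / (2 * C))"
      using D C(1) d1(2)[of D] d2(2)[of D] by (intro mult_strict_left_mono add_strict_mono) auto
    also have "\<dots> = e" using C(1) by (simp add: field_simps)
    finally show "(\<Sum>k\<in>D. cmod (f (Sup k) * g (Sup k) - f (Inf k) * g (Inf k))) < e" .
  qed
qed

section \<open>Primitives of locally integrable functions\<close>

text \<open>
  \<open>F\<close> is an indefinite integral of the locally integrable \<open>\<phi>\<close> on \<open>[0,b)\<close>. For complex functions this is
  equivalent to local absolute continuity together with \<open>F' = \<phi>\<close> almost everywhere.
\<close>

definition primitive :: "ereal \<Rightarrow> (real \<Rightarrow> 'a::euclidean_space) \<Rightarrow> (real \<Rightarrow> 'a) \<Rightarrow> bool" where
  "primitive b F \<phi> \<longleftrightarrow> (\<forall>x\<ge>0. ereal x < b \<longrightarrow> \<phi> absolutely_integrable_on {0..x} \<and> F x = F 0 + integral {0..x} \<phi>)"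

lemma primitive_abs_int:
  assumes "primitive b F \<phi>" "0 \<le> x" "ereal y < b"
  shows "\<phi> absolutely_integrable_on {x..y}"
proof (cases "x \<le> y")
  case True
  then have "\<phi> absolutely_integrable_on {0..y}" using assms unfolding primitive_def by auto
  then show ?thesis by (rule absolutely_integrable_on_subinterval) (use assms in auto)
qed (simp add: absolutely_integrable_on_def)

lemma primitive_integrable:
  assumes "primitive b F \<phi>" "0 \<le> x" "ereal y < b"
  shows "\<phi> integrable_on {x..y}"
  by (rule set_lebesgue_integral_eq_integral(1)[OF primitive_abs_int[OF assms]])

lemma primitive_diff_eq:
  assumes "primitive b F \<phi>" "0 \<le> x" "x \<le> y" "ereal y < b"
  shows "F y - F x = integral {x..y} \<phi>"
proof -
  have "ereal x < b" using assms(3,4) by (meson ereal_less_eq(3) le_less_trans)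
  then have "F x = F 0 + integral {0..x} \<phi>" "F y = F 0 + integral {0..y} \<phi>"
    using assms unfolding primitive_def by auto
  moreover have "integral {0..x} \<phi> + integral {x..y} \<phi> = integral {0..y} \<phi>"
    using assms(2,3) by (intro Henstock_Kurzweil_Integration.integral_combine primitive_integrable[OF assms(1)] assms(4)) auto
  ultimately show ?thesis by (simp add: algebra_simps)
qed

lemma primitive_continuous:
  assumes "primitive b F \<phi>" "0 \<le> x" "ereal y < b"
  shows "continuous_on {x..y} F"
proof (cases "x \<le> y")
  case True
  have "continuous_on {x..y} (\<lambda>t. F x + integral {x..t} \<phi>)"
    by (intro continuous_intros indefinite_integral_continuous_1 primitive_integrable[OF assms])
  moreover have "F x + integral {x..t} \<phi> = F t" if "t \<in> {x..y}" for t
  proof -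
    have "ereal t < b" using that assms(3) by (auto intro: le_less_trans[of "ereal t" "ereal y"])
    then show ?thesis using primitive_diff_eq[OF assms(1,2), of t] that by (simp add: algebra_simps)
  qed
  ultimately show ?thesis by (rule continuous_on_eq)
qed simp

lemma primitive_bounded_linear:
  assumes p: "primitive b F \<phi>" and h: "bounded_linear h"
  shows "primitive b (\<lambda>x. h (F x)) (\<lambda>x. h (\<phi> x))"
  unfolding primitive_def
proof (intro allI impI conjI)
  fix x :: real assume x: "0 \<le> x" "ereal x < b"
  show "(\<lambda>x. h (\<phi> x)) absolutely_integrable_on {0..x}"
    using absolutely_integrable_linear[OF primitive_abs_int[OF p order_refl x(2)] h] by (simp add: o_def)
  have "h (integral {0..x} \<phi>) = integral {0..x} (\<lambda>x. h (\<phi> x))"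
    using integral_linear[OF primitive_integrable[OF p order_refl x(2)] h] by (simp add: o_def)
  moreover have "F x = F 0 + integral {0..x} \<phi>" using p x unfolding primitive_def by auto
  ultimately show "h (F x) = h (F 0) + integral {0..x} (\<lambda>x. h (\<phi> x))"
    by (metis h linear_simps(1))
qed

lemma primitive_add:
  assumes p: "primitive b F \<phi>" and q: "primitive b G \<gamma>"
  shows "primitive b (\<lambda>x. F x + G x) (\<lambda>x. \<phi> x + \<gamma> x)"
  unfolding primitive_def
proof (intro allI impI conjI)
  fix x :: real assume x: "0 \<le> x" "ereal x < b"
  note a = primitive_abs_int[OF p order_refl x(2)] primitive_abs_int[OF q order_refl x(2)]
  show "(\<lambda>x. \<phi> x + \<gamma> x) absolutely_integrable_on {0..x}" by (intro set_integral_add a)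
  have "F x = F 0 + integral {0..x} \<phi>" "G x = G 0 + integral {0..x} \<gamma>" 
    using p q x unfolding primitive_def by auto
  then show "F x + G x = F 0 + G 0 + integral {0..x} (\<lambda>x. \<phi> x + \<gamma> x)"
    by (simp add: integral_add set_lebesgue_integral_eq_integral(1)[OF a(1)] set_lebesgue_integral_eq_integral(1)[OF a(2)])
qed

lemma primitive_AC_loc:
  fixes F :: "real \<Rightarrow> complex"
  assumes "primitive b F \<phi>" shows "AC_loc b F"
  unfolding AC_loc_def
proof (intro allI impI)
  fix c :: real assume c: "0 \<le> c" "ereal c < b"
  show "AC_on {0..c} F"
  proof (rule AC_on_indefinite_integral)
    show "\<phi> absolutely_integrable_on {0..c}" by (rule primitive_abs_int[OF assms order_refl c(2)])
    fix x assume "x \<in> {0..c}"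
    then have "0 \<le> x" "ereal x < b" using c(2) by (auto intro: le_less_trans[of "ereal x" "ereal c"])
    then show "F x = F 0 + integral {0..x} \<phi>" using assms unfolding primitive_def by auto
  qed
qed

lemma einterval_rational:
  assumes "x \<in> einterval 0 b"
  obtains c where "c \<in> \<rat>" "0 < x" "x < c" "ereal c < b"
proof -
  have x: "0 < x" "ereal x < b" using assms by (auto simp: einterval_def)
  obtain y where y: "ereal x < ereal y" "ereal y < b" using ereal_dense2[OF x(2)] by auto
  then obtain c where "c \<in> \<rat>" "x < c" "c < y" using Rats_dense_in_real[of x y] by auto
  then show thesis using that x y by (meson ereal_less_eq(3) le_less_trans less_imp_le)
qed

lemma primitive_has_vector_derivative_ae:
  fixes F :: "real \<Rightarrow> 'a::euclidean_space"
  assumes p: "primitive b F \<phi>"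
  shows "AE x in lebesgue. x \<in> einterval 0 b \<longrightarrow> (F has_vector_derivative \<phi> x) (at x)"
proof -
  define Q where "Q = {c\<in>\<rat>. ereal c < b}"
  have "countable Q" unfolding Q_def using countable_rat by (rule countable_subset[rotated]) auto
  have "AE x in lebesgue. \<forall>c\<in>Q. x \<in> {0<..<c} \<longrightarrow> (F has_vector_derivative \<phi> x) (at x)"
  proof (subst AE_ball_countable[OF \<open>countable Q\<close>], rule ballI)
    fix c assume "c \<in> Q"
    then have c: "ereal c < b" by (simp add: Q_def)
    obtain N where N: "negligible N"
      "\<And>x. x \<in> {0<..<c} - N \<Longrightarrow> ((\<lambda>x. integral {0..x} \<phi>) has_vector_derivative \<phi> x) (at x)"
      using indefinite_integral_has_vector_derivative_ae[OF primitive_integrable[OF p order_refl c]] by blast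
    have "(F has_vector_derivative \<phi> x) (at x)" if x: "x \<in> {0<..<c} - N" for x
    proof (rule has_vector_derivative_transform_within_open[where S = "{0<..<c}"])
      show "((\<lambda>x. F 0 + integral {0..x} \<phi>) has_vector_derivative \<phi> x) (at x)"
        using has_vector_derivative_add[OF has_vector_derivative_const N(2)[OF x]] by simp
      fix y assume "y \<in> {0<..<c}"
      then have "0 \<le> y" "ereal y < b" using c by (auto intro: less_trans[of "ereal y" "ereal c"])
      then show "F 0 + integral {0..y} \<phi> = F y" using p unfolding primitive_def by auto
    qed (use x in auto)
    then show "AE x in lebesgue. x \<in> {0<..<c} \<longrightarrow> (F has_vector_derivative \<phi> x) (at x)"
      unfolding eventually_ae_filter_negligible using N(1) by blast
  qed
  then show ?thesis
  proof (rule AE_mp, intro AE_I2 impI)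
    fix x assume A: "\<forall>c\<in>Q. x \<in> {0<..<c} \<longrightarrow> (F has_vector_derivative \<phi> x) (at x)" and x: "x \<in> einterval 0 b"
    obtain c where "c \<in> \<rat>" "0 < x" "x < c" "ereal c < b" by (rule einterval_rational[OF x])
    then show "(F has_vector_derivative \<phi> x) (at x)" using A by (auto simp: Q_def)
  qed
qed

lemma primitiveI_AC_loc:
  fixes F :: "real \<Rightarrow> complex"
  assumes AC: "AC_loc b F"
    and d: "AE x in lebesgue. x \<in> einterval 0 b \<longrightarrow> (F has_vector_derivative \<phi> x) (at x)"
    and i: "\<And>c. 0 \<le> c \<Longrightarrow> ereal c < b \<Longrightarrow> \<phi> absolutely_integrable_on {0..c}"
  shows "primitive b F \<phi>"
  unfolding primitive_def
proof (intro allI impI conjI)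
  fix x :: real assume x: "0 \<le> x" "ereal x < b"
  show "\<phi> absolutely_integrable_on {0..x}" by (rule i[OF x])
  obtain N where N: "negligible N" "{x. \<not> (x \<in> einterval 0 b \<longrightarrow> (F has_vector_derivative \<phi> x) (at x))} \<subseteq> N"
    using d unfolding eventually_ae_filter_negligible by blast
  have "(\<phi> has_integral (F x - F 0)) {0..x}"
  proof (rule AC_on_has_integral[OF x(1) _ N(1)])
    show "AC_on {0..x} F" using AC x unfolding AC_loc_def by auto
    fix y assume y: "y \<in> {0<..<x} - N"
    then have "y \<in> einterval 0 b" using x by (auto simp: einterval_def intro: less_trans[of "ereal y" "ereal x"])
    then show "(F has_vector_derivative \<phi> y) (at y)" using N(2) y by blast
  qed
  then show "F x = F 0 + integral {0..x} \<phi>" by (simp add: integral_unique)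
qed

lemma absolutely_integrable_mult_continuous:
  fixes f :: "real \<Rightarrow> 'a::{euclidean_space,real_normed_algebra}"
  assumes f: "continuous_on {a..b} f" and g: "g absolutely_integrable_on {a..b}"
  shows "(\<lambda>x. f x * g x) absolutely_integrable_on {a..b}"
proof (rule absolutely_integrable_bounded_measurable_product[where h = "(*)"])
  show "bilinear ((*) :: 'a \<Rightarrow> 'a \<Rightarrow> 'a)" by (simp add: bilinear_conv_bounded_bilinear bounded_bilinear_mult)
  show "f \<in> borel_measurable (lebesgue_on {a..b})"
    by (rule continuous_imp_measurable_on_sets_lebesgue[OF f]) simp
  show "bounded (f ` {a..b})" by (intro compact_imp_bounded compact_continuous_image f) simp
qed (use g in auto)

lemma primitive_mult:
  fixes F G :: "real \<Rightarrow> complex"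
  assumes p: "primitive b F \<phi>" and q: "primitive b G \<gamma>"
  shows "primitive b (\<lambda>x. F x * G x) (\<lambda>x. \<phi> x * G x + F x * \<gamma> x)"
proof (rule primitiveI_AC_loc)
  show "AC_loc b (\<lambda>x. F x * G x)"
    unfolding AC_loc_def
  proof (intro allI impI)
    fix c :: real assume c: "0 \<le> c" "ereal c < b"
    obtain B1 where B1: "\<And>x. x \<in> {0..c} \<Longrightarrow> cmod (F x) \<le> B1"
      using compact_imp_bounded[OF compact_continuous_image[OF primitive_continuous[OF p order_refl c(2)]]]
      unfolding bounded_iff image_iff by blast
    obtain B2 where B2: "\<And>x. x \<in> {0..c} \<Longrightarrow> cmod (G x) \<le> B2"
      using compact_imp_bounded[OF compact_continuous_image[OF primitive_continuous[OF q order_refl c(2)]]]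
      unfolding bounded_iff image_iff by blast
    have "AC_on {0..c} F" "AC_on {0..c} G"
      using primitive_AC_loc[OF p] primitive_AC_loc[OF q] c unfolding AC_loc_def by auto
    then show "AC_on {0..c} (\<lambda>x. F x * G x)"
      by (rule AC_on_mult[where B = "max B1 B2"]) (use B1 B2 in \<open>auto simp: le_max_iff_disj\<close>)
  qed
  show "AE x in lebesgue. x \<in> einterval 0 b \<longrightarrow>
      ((\<lambda>x. F x * G x) has_vector_derivative \<phi> x * G x + F x * \<gamma> x) (at x)"
    using primitive_has_vector_derivative_ae[OF p] primitive_has_vector_derivative_ae[OF q]
  proof eventually_elim
    case (elim x)
    then show ?case using has_vector_derivative_mult[of F "\<phi> x" x UNIV G "\<gamma> x"] by (auto simp: add.commute)
  qed
  fix c :: real assume c: "0 \<le> c" "ereal c < b"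
  have "(\<lambda>x. G x * \<phi> x) absolutely_integrable_on {0..c}" "(\<lambda>x. F x * \<gamma> x) absolutely_integrable_on {0..c}"
    by (intro absolutely_integrable_mult_continuous primitive_continuous[OF q] primitive_continuous[OF p] 
        primitive_abs_int[OF p] primitive_abs_int[OF q] order_refl c)+
  from set_integral_add(1)[OF this] show "(\<lambda>x. \<phi> x * G x + F x * \<gamma> x) absolutely_integrable_on {0..c}"
    by (simp add: mult.commute)
qed

lemma primitive_mult_real:
  fixes F G :: "real \<Rightarrow> real"
  assumes p: "primitive b F \<phi>" and q: "primitive b G \<gamma>"
  shows "primitive b (\<lambda>x. F x * G x) (\<lambda>x. \<phi> x * G x + F x * \<gamma> x)"
  using primitive_bounded_linear[OF primitive_mult[OF primitive_bounded_linear[OF p bounded_linear_of_real]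
      primitive_bounded_linear[OF q bounded_linear_of_real]] bounded_linear_Re]
  by simp

lemma primitive_power_real:
  fixes F :: "real \<Rightarrow> real"
  assumes p: "primitive b F \<phi>"
  shows "primitive b (\<lambda>x. F x ^ Suc n) (\<lambda>x. real (Suc n) * F x ^ n * \<phi> x)"
proof (induction n)
  case 0 then show ?case using p by simp
next
  case (Suc n)
  from primitive_mult_real[OF p Suc] show ?case
    by (simp add: algebra_simps)
qed

lemma primitive_integral:
  assumes "\<And>c. 0 \<le> c \<Longrightarrow> ereal c < b \<Longrightarrow> \<phi> absolutely_integrable_on {0..c}"
  shows "primitive b (\<lambda>x. C + integral {0..x} \<phi>) \<phi>"
  unfolding primitive_def using assms by simp

section \<open>Linear systems with locally integrable coefficients\<close>

text \<open>
  The \<open>n\<close>-th term of the Picard series for the system \<open>u' = R v\<close>, \<open>v' = W u\<close> with initial values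
  \<open>\<alpha>\<close>, \<open>\<beta>\<close>.
\<close>

fun picard :: "(real \<Rightarrow> complex) \<Rightarrow> (real \<Rightarrow> complex) \<Rightarrow> complex \<Rightarrow> complex \<Rightarrow> nat \<Rightarrow>
    (real \<Rightarrow> complex) \<times> (real \<Rightarrow> complex)" where
  "picard R W \<alpha> \<beta> 0 = (\<lambda>_. \<alpha>, \<lambda>_. \<beta>)"
| "picard R W \<alpha> \<beta> (Suc n) =
    (\<lambda>x. integral {0..x} (\<lambda>t. R t * snd (picard R W \<alpha> \<beta> n) t),
     \<lambda>x. integral {0..x} (\<lambda>t. W t * fst (picard R W \<alpha> \<beta> n) t))"

lemma integral_mult_series:
  fixes R :: "real \<Rightarrow> complex" and g :: "nat \<Rightarrow> real \<Rightarrow> complex"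
  assumes R: "R absolutely_integrable_on {0..x}"
    and g: "\<And>n. continuous_on {0..x} (g n)"
    and bd: "\<And>n t. t \<in> {0..x} \<Longrightarrow> cmod (g n t) \<le> c n" and c: "summable c"
  shows "(\<lambda>t. R t * (\<Sum>n. g n t)) absolutely_integrable_on {0..x}"
    and "(\<lambda>n. integral {0..x} (\<lambda>t. R t * g n t)) sums integral {0..x} (\<lambda>t. R t * (\<Sum>n. g n t))"
proof -
  define h where "h n t = indicator {0..x} t *\<^sub>R (R t * g n t)" for n t
  have Rg: "(\<lambda>t. R t * g n t) absolutely_integrable_on {0..x}" for n
    using absolutely_integrable_mult_continuous[OF g R] by (simp add: mult.commute)
  then have hint: "integrable lebesgue (h n)" for n by (simp add: set_integrable_def h_def[abs_def])
  have Rn: "integrable lebesgue (\<lambda>t. indicator {0..x} t * cmod (R t))"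
    using set_integrable_norm[OF R] by (simp add: set_integrable_def)
  have sg: "summable (\<lambda>n. cmod (g n t))" if "t \<in> {0..x}" for t
    by (rule summable_comparison_test'[OF c, of 0]) (use bd that in auto)
  have s1: "AE t in lebesgue. summable (\<lambda>n. norm (h n t))"
  proof (rule AE_I2)
    fix t show "summable (\<lambda>n. norm (h n t))"
    proof (cases "t \<in> {0..x}")
      case True
      then show ?thesis using summable_mult[OF sg[OF True], of "cmod (R t)"] by (simp add: h_def norm_mult)
    qed (simp add: h_def)
  qed
  have s2: "summable (\<lambda>n. \<integral>t. norm (h n t) \<partial>lebesgue)"
  proof (rule summable_comparison_test'[of _ 0])
    show "summable (\<lambda>n. c n * (\<integral>t. indicator {0..x} t * cmod (R t) \<partial>lebesgue))"
      by (rule summable_mult2[OF c])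
    fix n
    have "(\<integral>t. norm (h n t) \<partial>lebesgue) \<le> (\<integral>t. c n * (indicator {0..x} t * cmod (R t)) \<partial>lebesgue)"
    proof (rule integral_mono)
      show "integrable lebesgue (\<lambda>t. norm (h n t))" by (intro integrable_norm hint)
      show "integrable lebesgue (\<lambda>t. c n * (indicator {0..x} t * cmod (R t)))" by (intro integrable_mult_right Rn)
      fix t show "norm (h n t) \<le> c n * (indicator {0..x} t * cmod (R t))"
        using bd[of t n] mult_right_mono[of "cmod (g n t)" "c n" "cmod (R t)"]
        by (auto simp: h_def norm_mult indicator_def mult.commute)
    qed
    then show "norm (\<integral>t. norm (h n t) \<partial>lebesgue) \<le> c n * (\<integral>t. indicator {0..x} t * cmod (R t) \<partial>lebesgue)"
      by simp
  qed
  have eq: "(\<Sum>n. h n t) = indicator {0..x} t *\<^sub>R (R t * (\<Sum>n. g n t))" for t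
  proof (cases "t \<in> {0..x}")
    case True
    then show ?thesis using suminf_mult[OF summable_norm_cancel[OF sg[OF True]], of "R t"] by (simp add: h_def)
  qed (simp add: h_def)
  from integrable_suminf[OF hint s1 s2] show A: "(\<lambda>t. R t * (\<Sum>n. g n t)) absolutely_integrable_on {0..x}"
    by (simp add: eq set_integrable_def)
  have "(\<lambda>n. integral\<^sup>L lebesgue (h n)) sums (\<integral>t. (\<Sum>n. h n t) \<partial>lebesgue)"
    by (rule sums_integral[OF hint s1 s2])
  moreover have "integral\<^sup>L lebesgue (h n) = integral {0..x} (\<lambda>t. R t * g n t)" for n
    using set_lebesgue_integral_eq_integral(2)[OF Rg[of n]] by (simp add: set_lebesgue_integral_def h_def[abs_def])
  moreover have "(\<integral>t. (\<Sum>n. h n t) \<partial>lebesgue) = integral {0..x} (\<lambda>t. R t * (\<Sum>n. g n t))"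
    using set_lebesgue_integral_eq_integral(2)[OF A] by (simp add: set_lebesgue_integral_def eq)
  ultimately show "(\<lambda>n. integral {0..x} (\<lambda>t. R t * g n t)) sums integral {0..x} (\<lambda>t. R t * (\<Sum>n. g n t))"
    by simp
qed

text \<open>
  The \<open>n\<close>-th Picard term is bounded by \<open>B P(x)\<^sup>n / n!\<close> with \<open>P\<close> the primitive of \<open>|R| + |W|\<close>, so the
  series converges on all of \<open>[0,b)\<close> at once and no continuation of local solutions is needed.
\<close>

theorem linear_system_solution_exists:
  fixes R W :: "real \<Rightarrow> complex"
  assumes R: "\<And>c. 0 \<le> c \<Longrightarrow> ereal c < b \<Longrightarrow> R absolutely_integrable_on {0..c}"
    and W: "\<And>c. 0 \<le> c \<Longrightarrow> ereal c < b \<Longrightarrow> W absolutely_integrable_on {0..c}"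
  obtains f g where "primitive b f (\<lambda>x. R x * g x)" "primitive b g (\<lambda>x. W x * f x)" "f 0 = \<alpha>" "g 0 = \<beta>"
proof -
  define u where "u n = fst (picard R W \<alpha> \<beta> n)" for n
  define v where "v n = snd (picard R W \<alpha> \<beta> n)" for n
  have u0: "u 0 = (\<lambda>_. \<alpha>)" "v 0 = (\<lambda>_. \<beta>)" by (auto simp: u_def v_def)
  have uS: "u (Suc n) x = integral {0..x} (\<lambda>t. R t * v n t)" 
           "v (Suc n) x = integral {0..x} (\<lambda>t. W t * u n t)" for n x
    by (auto simp: u_def v_def)
  define a where "a x = cmod (R x) + cmod (W x)" for x
  have a_int: "a absolutely_integrable_on {0..c}" if "0 \<le> c" "ereal c < b" for c
    unfolding a_def by (intro set_integral_add set_integrable_norm R W that)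
  define P where "P x = integral {0..x} a" for x
  have P: "primitive b P a" using primitive_integral[where C=0, OF a_int] by (simp add: P_def[abs_def])
  have Pmono: "P x \<le> P y" if "0 \<le> x" "x \<le> y" "ereal y < b" for x y
    using primitive_diff_eq[OF P that] integral_nonneg[OF primitive_integrable[OF P that(1,3)]]
    by (simp add: a_def)
  have P0: "P 0 = 0" by (simp add: P_def)
  define B where "B = max (cmod \<alpha>) (cmod \<beta>)"
  have B: "B \<ge> 0" by (simp add: B_def le_max_iff_disj)
  have cont: "continuous_on {0..c} (u n) \<and> continuous_on {0..c} (v n)" if "0 \<le> c" "ereal c < b" for c n
  proof (induction n)
    case 0 then show ?case by (simp add: u0)
  next
    case (Suc k)
    then have "(\<lambda>t. R t * v k t) absolutely_integrable_on {0..c}" "(\<lambda>t. W t * u k t) absolutely_integrable_on {0..c}"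
      using absolutely_integrable_mult_continuous[OF _ R[OF that], of "v k"]
        absolutely_integrable_mult_continuous[OF _ W[OF that], of "u k"] by (simp_all add: mult.commute)
    then show ?case unfolding uS[abs_def]
      by (intro conjI indefinite_integral_continuous_1 set_lebesgue_integral_eq_integral(1))
  qed
  have prod_int: "(\<lambda>t. R t * v n t) absolutely_integrable_on {0..c}" "(\<lambda>t. W t * u n t) absolutely_integrable_on {0..c}"
    if "0 \<le> c" "ereal c < b" for c n
    using absolutely_integrable_mult_continuous[OF _ R[OF that], of "v n"]
      absolutely_integrable_mult_continuous[OF _ W[OF that], of "u n"] cont[OF that, of n] by (simp_all add: mult.commute)
  have bound: "cmod (u n x) \<le> B * P x ^ n / fact n \<and> cmod (v n x) \<le> B * P x ^ n / fact n"
    if "0 \<le> x" "ereal x < b" for n x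
    using that
  proof (induction n arbitrary: x)
    case 0 then show ?case by (simp add: u0 B_def)
  next
    case (Suc n)
    note x = Suc.prems
    have lt: "ereal t < b" if "t \<in> {0..x}" for t using that x by (auto intro: le_less_trans[of "ereal t" "ereal x"])
    have pw: "primitive b (\<lambda>x. P x ^ Suc n) (\<lambda>x. real (Suc n) * P x ^ n * a x)" by (rule primitive_power_real[OF P])
    have "primitive b (\<lambda>x. B / fact (Suc n) * P x ^ Suc n) (\<lambda>x. B / fact (Suc n) * (real (Suc n) * P x ^ n * a x))"
      by (rule primitive_bounded_linear[OF pw bounded_linear_mult_right])
    moreover have "B / fact (Suc n) * (real (Suc n) * P x ^ n * a x) = B * P x ^ n / fact n * a x" for x
      by (simp add: divide_simps del: of_nat_Suc)
    ultimately have pw: "primitive b (\<lambda>x. B / fact (Suc n) * P x ^ Suc n) (\<lambda>x. B * P x ^ n / fact n * a x)"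
      by (simp only:)
    have I: "integral {0..x} (\<lambda>x. B * P x ^ n / fact n * a x) = B * P x ^ Suc n / fact (Suc n)"
      using primitive_diff_eq[OF pw order_refl x] by (simp add: P0)
    have step: "cmod (integral {0..x} (\<lambda>t. S t * z t)) \<le> B * P x ^ Suc n / fact (Suc n)"
      if S: "\<And>t. cmod (S t) \<le> a t" and Sz: "(\<lambda>t. S t * z t) absolutely_integrable_on {0..x}"
        and z: "\<And>t. t \<in> {0..x} \<Longrightarrow> cmod (z t) \<le> B * P t ^ n / fact n" for S z
      unfolding I[symmetric]
    proof (rule integral_norm_bound_integral)
      fix t assume t: "t \<in> {0..x}"
      have "cmod (z t) * cmod (S t) \<le> (B * P t ^ n / fact n) * a t"
        by (rule mult_mono[OF z[OF t] S]) (use order_trans[OF norm_ge_zero z[OF t]] in simp_all)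
      then show "cmod (S t * z t) \<le> B * P t ^ n / fact n * a t" by (simp add: norm_mult mult.commute)
    qed (use primitive_integrable[OF pw order_refl x(2)] set_lebesgue_integral_eq_integral(1)[OF Sz] in auto)
    have "cmod (u n t) \<le> B * P t ^ n / fact n" "cmod (v n t) \<le> B * P t ^ n / fact n" if "t \<in> {0..x}" for t
      using Suc.IH[of t] that lt by auto
    then show ?case unfolding uS by (intro conjI step prod_int[OF x]) (auto simp: a_def)
  qed
  define f where "f x = (\<Sum>n. u n x)" for x
  define g where "g x = (\<Sum>n. v n x)" for x
  have sumc: "summable (\<lambda>n. B * P x ^ n / fact n)" for x
    using summable_mult[OF summable_exp[of "P x"], of B] by (simp add: field_simps)
  have bd: "cmod (u n t) \<le> B * P x ^ n / fact n" "cmod (v n t) \<le> B * P x ^ n / fact n"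
    if "t \<in> {0..x}" "ereal x < b" for n t x
  proof -
    have t: "0 \<le> t" "ereal t < b" using that by (auto intro: le_less_trans[of "ereal t" "ereal x"])
    have "P t \<ge> 0" using Pmono[of 0 t] t P0 by simp
    then have "B * P t ^ n / fact n \<le> B * P x ^ n / fact n"
      using B Pmono[of t x] that by (intro divide_right_mono mult_left_mono power_mono) auto
    then show "cmod (u n t) \<le> B * P x ^ n / fact n" "cmod (v n t) \<le> B * P x ^ n / fact n"
      using bound[OF t, of n] by linarith+
  qed
  have su: "summable (\<lambda>n. u n x)" "summable (\<lambda>n. v n x)" if "0 \<le> x" "ereal x < b" for x
    by (rule summable_comparison_test'[OF sumc[of x], of 0], use bd[of x x] that in simp)+
  have at0: "u n 0 = (if n = 0 then \<alpha> else 0)" "v n 0 = (if n = 0 then \<beta> else 0)" for n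
    by (cases n; simp add: u0 uS)+
  have f0: "f 0 = \<alpha>" and g0: "g 0 = \<beta>"
    using sums_If_finite[of "\<lambda>n. n = 0" "\<lambda>n. \<alpha>"] sums_If_finite[of "\<lambda>n. n = 0" "\<lambda>n. \<beta>"]
    by (auto simp: f_def g_def at0 sums_iff)
  have f: "primitive b f (\<lambda>x. R x * g x)"
    unfolding primitive_def
  proof (intro allI impI conjI)
    fix x :: real assume x: "0 \<le> x" "ereal x < b"
    have cnt: "continuous_on {0..x} (v n)" for n using cont[OF x] by blast
    have bdx: "cmod (v n t) \<le> B * P x ^ n / fact n" if "t \<in> {0..x}" for n t by (rule bd(2)[OF that x(2)])
    note S = integral_mult_series[where g = v, OF R[OF x] cnt bdx sumc, folded g_def]
    show "(\<lambda>x. R x * g x) absolutely_integrable_on {0..x}" by (rule S(1))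
    have "(\<lambda>n. u (Suc n) x) sums integral {0..x} (\<lambda>x. R x * g x)"
      unfolding uS by (rule S(2))
    moreover have "f x = u 0 x + (\<Sum>n. u (Suc n) x)" unfolding f_def
      using suminf_split_head[OF su(1)[OF x]] by simp
    ultimately show "f x = f 0 + integral {0..x} (\<lambda>x. R x * g x)" by (simp add: u0 sums_iff f0)
  qed
  have g: "primitive b g (\<lambda>x. W x * f x)"
    unfolding primitive_def
  proof (intro allI impI conjI)
    fix x :: real assume x: "0 \<le> x" "ereal x < b"
    have cnt: "continuous_on {0..x} (u n)" for n using cont[OF x] by blast
    have bdx: "cmod (u n t) \<le> B * P x ^ n / fact n" if "t \<in> {0..x}" for n t by (rule bd(1)[OF that x(2)])
    note S = integral_mult_series[where g = u, OF W[OF x] cnt bdx sumc, folded f_def]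
    show "(\<lambda>x. W x * f x) absolutely_integrable_on {0..x}" by (rule S(1))
    have "(\<lambda>n. v (Suc n) x) sums integral {0..x} (\<lambda>x. W x * f x)"
      unfolding uS by (rule S(2))
    moreover have "g x = v 0 x + (\<Sum>n. v (Suc n) x)" unfolding g_def
      using suminf_split_head[OF su(2)[OF x]] by simp
    ultimately show "g x = g 0 + integral {0..x} (\<lambda>x. W x * f x)" by (simp add: u0 sums_iff g0)
  qed
  show thesis by (rule that[OF f g f0 g0])
qed

section \<open>Integrals over the half-open interval and limits at its right end\<close>

text \<open>
  The filter of reals increasing to \<open>b\<close>, which may be infinite.
\<close>

definition up_to :: "ereal \<Rightarrow> real filter" where
  "up_to b = filtermap real_of_ereal (at_left b)"

lemma eventually_up_to:
  assumes "0 < b"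
  shows "eventually P (up_to b) \<longleftrightarrow> (\<exists>c\<ge>0. ereal c < b \<and> (\<forall>x. c < x \<longrightarrow> ereal x < b \<longrightarrow> P x))"
proof -
  have "eventually P (up_to b) \<longleftrightarrow> (\<exists>c<b. \<forall>y>c. y < b \<longrightarrow> P (real_of_ereal y))"
    unfolding up_to_def eventually_filtermap by (rule eventually_at_left[OF assms])
  also have "\<dots> \<longleftrightarrow> (\<exists>c\<ge>0. ereal c < b \<and> (\<forall>x. c < x \<longrightarrow> ereal x < b \<longrightarrow> P x))"
  proof
    assume "\<exists>c<b. \<forall>y>c. y < b \<longrightarrow> P (real_of_ereal y)"
    then obtain c where c: "c < b" "\<And>y. c < y \<Longrightarrow> y < b \<Longrightarrow> P (real_of_ereal y)" by blast
    have "max 0 c < b" using assms c by simp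
    moreover have "0 \<le> max 0 c" by simp
    ultimately obtain d where d: "max 0 c = ereal d" by (cases "max 0 c") auto
    with \<open>0 \<le> max 0 c\<close> have "d \<ge> 0" by simp
    have "P x" if "d < x" "ereal x < b" for x
    proof -
      have "c < ereal x" using that(1) d by (metis max_less_iff_conj ereal_less_ereal_Ex less_ereal.simps(1) max.strict_coboundedI2 not_less max_def le_less_trans)
      then show ?thesis using c(2)[OF _ that(2)] by simp
    qed
    then show "\<exists>c\<ge>0. ereal c < b \<and> (\<forall>x. c < x \<longrightarrow> ereal x < b \<longrightarrow> P x)"
      using \<open>d \<ge> 0\<close> \<open>max 0 c < b\<close> d by auto
  next
    assume "\<exists>c\<ge>0. ereal c < b \<and> (\<forall>x. c < x \<longrightarrow> ereal x < b \<longrightarrow> P x)"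
    then obtain c where c: "0 \<le> c" "ereal c < b" "\<And>x. c < x \<Longrightarrow> ereal x < b \<Longrightarrow> P x" by blast
    show "\<exists>c<b. \<forall>y>c. y < b \<longrightarrow> P (real_of_ereal y)"
    proof (intro exI[of _ "ereal c"] conjI allI impI c(2))
      fix y assume y: "ereal c < y" "y < b"
      then obtain x where "y = ereal x" by (cases y) auto
      then show "P (real_of_ereal y)" using y c(3) by simp
    qed
  qed
  finally show ?thesis .
qed

lemma up_to_neq_bot: "0 < b \<Longrightarrow> up_to b \<noteq> bot"
proof -
  assume "0 < b"
  have "\<not> eventually (\<lambda>_. False) (up_to b)"
    unfolding eventually_up_to[OF \<open>0 < b\<close>]
  proof clarsimp
    fix c :: real assume c: "0 \<le> c" "ereal c < b"
    then show "\<exists>x>c. ereal x < b" using ereal_dense2[OF c(2)] by auto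
  qed
  then show ?thesis using trivial_limit_def by blast
qed

lemma tendsto_up_to_iff: "((f \<circ> real_of_ereal) \<longlongrightarrow> l) (at_left b) \<longleftrightarrow> (f \<longlongrightarrow> l) (up_to b)"
  unfolding up_to_def filterlim_filtermap o_def ..

lemma eventually_up_to_gt: "0 < b \<Longrightarrow> ereal c < b \<Longrightarrow> eventually (\<lambda>x. c < x \<and> 0 < x \<and> ereal x < b) (up_to b)"
  unfolding eventually_up_to by (intro exI[of _ "max 0 c"]) (auto simp: max_def zero_ereal_def)

lemma set_integrable_einterval_imp_Icc:
  fixes \<phi> :: "real \<Rightarrow> 'a::euclidean_space"
  assumes "set_integrable lebesgue (einterval 0 b) \<phi>" "ereal c < b"
  shows "\<phi> absolutely_integrable_on {0..c}"
proof -
  have "\<phi> absolutely_integrable_on {0<..c}"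
    by (rule set_integrable_subset[OF assms(1)]) (use assms(2) in \<open>auto simp: einterval_def intro: le_less_trans[of _ "ereal c"]\<close>)
  then show ?thesis
    by (rule absolutely_integrable_spike_set) (auto intro: negligible_subset[of "{0}"])
qed

lemma set_integral_Icc_indicator:
  fixes \<phi> :: "real \<Rightarrow> 'a::euclidean_space"
  assumes "\<phi> absolutely_integrable_on {0..c}" "ereal c < b"
  shows "integral {0..c} \<phi> = (\<integral>x. indicator {0..c} x *\<^sub>R (indicator (einterval 0 b) x *\<^sub>R \<phi> x) \<partial>lebesgue)"
proof -
  have a: "\<phi> absolutely_integrable_on {0<..c}" by (rule set_integrable_subset[OF assms(1)]) auto
  have "integral {0..c} \<phi> = integral {0<..c} \<phi>"
    by (rule integral_spike_set) (auto intro: negligible_subset[of "{0}"])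
  also have "\<dots> = (\<integral>x. indicator {0<..c} x *\<^sub>R \<phi> x \<partial>lebesgue)"
    using set_lebesgue_integral_eq_integral(2)[OF a] by (simp add: set_lebesgue_integral_def)
  also have "\<dots> = (\<integral>x. indicator {0..c} x *\<^sub>R (indicator (einterval 0 b) x *\<^sub>R \<phi> x) \<partial>lebesgue)"
    using assms(2) by (intro Bochner_Integration.integral_cong refl)
      (auto simp: indicator_def einterval_def intro: le_less_trans[of _ "ereal c"])
  finally show ?thesis .
qed

lemma tendsto_integral_up_to:
  fixes \<phi> :: "real \<Rightarrow> 'a::euclidean_space"
  assumes b: "0 < b" and \<phi>: "set_integrable lebesgue (einterval 0 b) \<phi>"
  shows "((\<lambda>x. integral {0..x} \<phi>) \<longlongrightarrow> (LINT x:einterval 0 b|lebesgue. \<phi> x)) (up_to b)"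
  unfolding tendsto_up_to_iff[symmetric]
proof (rule tendsto_at_left_sequentially[OF b])
  fix S :: "nat \<Rightarrow> ereal" assume S: "\<And>n. S n < b" "\<And>n. 0 < S n" "incseq S" "S \<longlonglongrightarrow> b"
  define s where "s n = real_of_ereal (S n)" for n
  have s: "ereal (s n) = S n" "0 < s n" for n
    using S(1,2)[of n] by (cases "S n"; auto simp: s_def)+
  have "(\<lambda>n. \<integral>x. indicator {0..s n} x *\<^sub>R (indicator (einterval 0 b) x *\<^sub>R \<phi> x) \<partial>lebesgue)
     \<longlonglongrightarrow> (\<integral>x. indicator (einterval 0 b) x *\<^sub>R \<phi> x \<partial>lebesgue)"
  proof (rule integral_dominated_convergence)
    show "integrable lebesgue (\<lambda>x. norm (indicator (einterval 0 b) x *\<^sub>R \<phi> x))"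
      using \<phi> unfolding set_integrable_def by (rule integrable_norm)
    show m: "(\<lambda>x. indicator (einterval 0 b) x *\<^sub>R \<phi> x) \<in> borel_measurable lebesgue"
      using \<phi> unfolding set_integrable_def by (rule borel_measurable_integrable)
    show "(\<lambda>x. indicator {0..s n} x *\<^sub>R (indicator (einterval 0 b) x *\<^sub>R \<phi> x)) \<in> borel_measurable lebesgue" for n
      by (rule borel_measurable_scaleR[OF borel_measurable_indicator m]) auto
    show "AE x in lebesgue. (\<lambda>n. indicator {0..s n} x *\<^sub>R (indicator (einterval 0 b) x *\<^sub>R \<phi> x))
        \<longlonglongrightarrow> indicator (einterval 0 b) x *\<^sub>R \<phi> x"
    proof (rule AE_I2)
      fix x show "(\<lambda>n. indicator {0..s n} x *\<^sub>R (indicator (einterval 0 b) x *\<^sub>R \<phi> x))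
        \<longlonglongrightarrow> indicator (einterval 0 b) x *\<^sub>R \<phi> x"
      proof (cases "x \<in> einterval 0 b")
        case True
        then have "0 < x" "ereal x < b" by (auto simp: einterval_def)
        from order_tendstoD(1)[OF S(4) this(2)] have "\<forall>\<^sub>F n in sequentially. x < s n"
          by (simp add: s(1)[symmetric])
        then have "\<forall>\<^sub>F n in sequentially. indicator {0..s n} x *\<^sub>R (indicator (einterval 0 b) x *\<^sub>R \<phi> x)
          = indicator (einterval 0 b) x *\<^sub>R \<phi> x"
          by eventually_elim (use \<open>0 < x\<close> in auto)
        then show ?thesis by (rule tendsto_eventually)
      qed simp
    qed
    show "AE x in lebesgue. norm (indicator {0..s n} x *\<^sub>R (indicator (einterval 0 b) x *\<^sub>R \<phi> x))
        \<le> norm (indicator (einterval 0 b) x *\<^sub>R \<phi> x)" for n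
      by (intro AE_I2) (auto simp: indicator_def)
  qed
  moreover have "integral {0..s n} \<phi> = (\<integral>x. indicator {0..s n} x *\<^sub>R (indicator (einterval 0 b) x *\<^sub>R \<phi> x) \<partial>lebesgue)" for n
    by (intro set_integral_Icc_indicator set_integrable_einterval_imp_Icc[OF \<phi>]) (use S(1) s in auto)
  ultimately show "(\<lambda>n. ((\<lambda>x. integral {0..x} \<phi>) \<circ> real_of_ereal) (S n)) \<longlonglongrightarrow> (LINT x:einterval 0 b|lebesgue. \<phi> x)"
    by (simp add: set_lebesgue_integral_def s_def)
qed

lemma einterval_exhaust:
  assumes "0 < b"
  obtains s :: "nat \<Rightarrow> real" where "incseq s" "\<And>n. 0 < s n" "\<And>n. ereal (s n) < b"
    "\<And>x. ereal x < b \<Longrightarrow> \<forall>\<^sub>F n in sequentially. x < s n"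
proof -
  obtain s :: "nat \<Rightarrow> real" where s: "incseq s" "\<And>n. 0 < ereal (s n)" "\<And>n. ereal (s n) < b" "s \<longlonglongrightarrow> b"
    using ereal_incseq_approx[OF assms] by blast
  show thesis
  proof (rule that[of s])
    fix x assume "ereal x < b"
    from order_tendstoD(1)[OF s(4) this] show "\<forall>\<^sub>F n in sequentially. x < s n" by simp
  qed (use s in auto)
qed

lemma set_borel_measurable_einterval:
  fixes \<phi> :: "real \<Rightarrow> 'a::euclidean_space"
  assumes "0 < b" and \<phi>: "\<And>c. 0 \<le> c \<Longrightarrow> ereal c < b \<Longrightarrow> \<phi> absolutely_integrable_on {0..c}"
  shows "set_borel_measurable lebesgue (einterval 0 b) \<phi>"
  unfolding set_borel_measurable_def
proof -
  obtain s :: "nat \<Rightarrow> real" where s: "incseq s" "\<And>n. 0 < s n" "\<And>n. ereal (s n) < b"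
    "\<And>x. ereal x < b \<Longrightarrow> \<forall>\<^sub>F n in sequentially. x < s n" using einterval_exhaust[OF assms(1)] by blast
  show "(\<lambda>x. indicator (einterval 0 b) x *\<^sub>R \<phi> x) \<in> borel_measurable lebesgue"
  proof (rule borel_measurable_LIMSEQ_metric)
    show "(\<lambda>x. indicator {0<..s n} x *\<^sub>R \<phi> x) \<in> borel_measurable lebesgue" for n
    proof -
      have "\<phi> absolutely_integrable_on {0<..s n}"
        by (rule set_integrable_subset[OF \<phi>[of "s n"]]) (use s(2,3)[of n] in auto)
      then show ?thesis unfolding set_integrable_def by (rule borel_measurable_integrable)
    qed
    fix x show "(\<lambda>n. indicator {0<..s n} x *\<^sub>R \<phi> x) \<longlonglongrightarrow> indicator (einterval 0 b) x *\<^sub>R \<phi> x"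
    proof (rule tendsto_eventually)
      show "\<forall>\<^sub>F n in sequentially. indicator {0<..s n} x *\<^sub>R \<phi> x = indicator (einterval 0 b) x *\<^sub>R \<phi> x"
      proof (cases "ereal x < b")
        case True
        from s(4)[OF this] show ?thesis
          by eventually_elim (use True in \<open>auto simp: indicator_def einterval_def\<close>)
      next
        case False
        then have "\<not> x \<le> s n" for n using s(3)[of n] by (auto intro: le_less_trans[of "ereal x" "ereal (s n)"])
        then show ?thesis using False by (auto simp: indicator_def einterval_def)
      qed
    qed
  qed
qed

text \<open>
  A nonnegative function with bounded integrals over all \<open>[0,c]\<close>, \<open>c < b\<close>, is integrable on \<open>(0,b)\<close>, by
  Fatou's lemma.
\<close>

lemma set_integrable_einterval_bounded:
  fixes \<phi> :: "real \<Rightarrow> real"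
  assumes b: "0 < b" and \<phi>: "\<And>c. 0 \<le> c \<Longrightarrow> ereal c < b \<Longrightarrow> \<phi> absolutely_integrable_on {0..c}"
    and nonneg: "AE x in lebesgue. x \<in> einterval 0 b \<longrightarrow> 0 \<le> \<phi> x"
    and bd: "\<And>c. 0 \<le> c \<Longrightarrow> ereal c < b \<Longrightarrow> integral {0..c} \<phi> \<le> C"
  shows "set_integrable lebesgue (einterval 0 b) \<phi>"
proof -
  obtain s :: "nat \<Rightarrow> real" where s: "incseq s" "\<And>n. 0 < s n" "\<And>n. ereal (s n) < b"
    "\<And>x. ereal x < b \<Longrightarrow> \<forall>\<^sub>F n in sequentially. x < s n" using einterval_exhaust[OF b] by blast
  have meas: "(\<lambda>x. indicator (einterval 0 b) x * \<phi> x) \<in> borel_measurable lebesgue"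
    using set_borel_measurable_einterval[OF b \<phi>] by (simp add: set_borel_measurable_def)
  define h where "h n x = indicator {0..s n} x *\<^sub>R (indicator (einterval 0 b) x *\<^sub>R \<phi> x)" for n x
  have hm: "h n \<in> borel_measurable lebesgue" for n unfolding h_def
    by (rule borel_measurable_scaleR[OF borel_measurable_indicator]) (use meas in auto)
  have nn: "AE x in lebesgue. \<forall>n. 0 \<le> h n x"
    using nonneg by eventually_elim (auto simp: h_def indicator_def)
  have hint: "integrable lebesgue (h n)" for n
  proof -
    have "\<phi> absolutely_integrable_on {0<..s n}"
      by (rule set_integrable_subset[OF \<phi>[of "s n"]]) (use s(2,3)[of n] in auto)
    moreover have "indicator {0<..s n} x *\<^sub>R \<phi> x = h n x" for x
      using s(3)[of n] by (auto simp: h_def indicator_def einterval_def intro: le_less_trans[of "ereal x" "ereal (s n)"])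
    ultimately show ?thesis by (simp add: set_integrable_def)
  qed
  have le: "(\<integral>\<^sup>+x. ennreal (h n x) \<partial>lebesgue) \<le> ennreal C" for n
  proof -
    have "(\<integral>\<^sup>+x. ennreal (h n x) \<partial>lebesgue) = ennreal (integral\<^sup>L lebesgue (h n))"
      by (rule nn_integral_eq_integral[OF hint]) (use nn in eventually_elim; simp)
    also have "integral\<^sup>L lebesgue (h n) = integral {0..s n} \<phi>"
      unfolding h_def[abs_def] using s(2,3)[of n] by (subst set_integral_Icc_indicator[where \<phi> = \<phi> and c = "s n" and b = b]) (auto intro: \<phi>)
    also have "ennreal \<dots> \<le> ennreal C" using bd[of "s n"] s(2,3)[of n] by (intro ennreal_leI) auto
    finally show ?thesis .
  qed
  have "(\<integral>\<^sup>+x. ennreal (indicator (einterval 0 b) x * \<phi> x) \<partial>lebesgue)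
      = (\<integral>\<^sup>+x. liminf (\<lambda>n. ennreal (h n x)) \<partial>lebesgue)"
  proof (rule nn_integral_cong)
    fix x
    have "\<forall>\<^sub>F n in sequentially. h n x = indicator (einterval 0 b) x * \<phi> x"
    proof (cases "ereal x < b")
      case True
      from s(4)[OF this] show ?thesis
        by eventually_elim (auto simp: h_def indicator_def einterval_def)
    next
      case False then show ?thesis by (auto simp: h_def indicator_def einterval_def)
    qed
    then have "(\<lambda>n. ennreal (h n x)) \<longlonglongrightarrow> ennreal (indicator (einterval 0 b) x * \<phi> x)"
      by (intro tendsto_eventually) (auto elim: eventually_mono)
    then show "ennreal (indicator (einterval 0 b) x * \<phi> x) = liminf (\<lambda>n. ennreal (h n x))"
      by (simp add: lim_imp_Liminf)
  qed
  also have "\<dots> \<le> liminf (\<lambda>n. \<integral>\<^sup>+x. ennreal (h n x) \<partial>lebesgue)"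
    by (rule nn_integral_liminf) (use hm in measurable)
  also have "\<dots> \<le> ennreal C"
    using Liminf_le[of sequentially "\<lambda>n. \<integral>\<^sup>+x. ennreal (h n x) \<partial>lebesgue" "ennreal C"] le by simp
  finally have fin: "(\<integral>\<^sup>+x. ennreal (indicator (einterval 0 b) x * \<phi> x) \<partial>lebesgue) < \<infinity>"
    by (simp add: le_less_trans)
  show ?thesis unfolding set_integrable_def real_scaleR_def
    by (rule integrableI_nonneg[OF meas _ fin]) (use nonneg in eventually_elim; simp add: indicator_def)
qed

section \<open>The weighted space and admissible triples\<close>

lemma AE_lebesgue_neq: "AE t::real in lebesgue. t \<noteq> a"
  unfolding eventually_ae_filter_negligible by (intro exI[of _ "{a}"]) auto

lemma primitive_le:
  fixes F G :: "real \<Rightarrow> real"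
  assumes F: "primitive b F \<phi>" and G: "primitive b G \<gamma>" and xy: "0 \<le> x" "x \<le> y" "ereal y < b"
    and le: "AE t in lebesgue. t \<in> einterval 0 b \<longrightarrow> x \<le> t \<longrightarrow> t \<le> y \<longrightarrow> \<phi> t \<le> \<gamma> t"
  shows "F y - F x \<le> G y - G x"
proof -
  note i = primitive_abs_int[OF F xy(1,3)] primitive_abs_int[OF G xy(1,3)]
  have "integral {x..y} \<phi> \<le> integral {x..y} \<gamma>"
    unfolding set_lebesgue_integral_eq_integral(2)[OF i(1), symmetric] set_lebesgue_integral_eq_integral(2)[OF i(2), symmetric]
  proof (rule set_integral_mono_AE[OF i])
    show "AE t\<in>{x..y} in lebesgue. \<phi> t \<le> \<gamma> t"
      using le AE_lebesgue_neq[of 0]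
    proof eventually_elim
      case (elim t)
      show ?case
      proof
        assume t: "t \<in> {x..y}"
        then have "0 < t" using elim(2) xy(1) by auto
        moreover have "ereal t < b" using t xy(3) by (auto intro: le_less_trans[of "ereal t" "ereal y"])
        ultimately show "\<phi> t \<le> \<gamma> t" using elim(1) t by (auto simp: einterval_def)
      qed
    qed
  qed
  then show ?thesis using primitive_diff_eq[OF F xy] primitive_diff_eq[OF G xy] by simp
qed

lemma primitive_const: "primitive b (\<lambda>_. c) (\<lambda>_. 0)"
  by (simp add: primitive_def)

lemma primitive_cmult:
  fixes F :: "real \<Rightarrow> real"
  shows "primitive b F \<phi> \<Longrightarrow> primitive b (\<lambda>x. c * F x) (\<lambda>x. c * \<phi> x)"
  by (rule primitive_bounded_linear[OF _ bounded_linear_mult_right])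

lemma primitive_einterval:
  fixes \<phi> :: "real \<Rightarrow> 'a::euclidean_space"
  assumes "set_integrable lebesgue (einterval 0 b) \<phi>"
  shows "primitive b (\<lambda>x. integral {0..x} \<phi>) \<phi>"
  using primitive_integral[where C=0, OF set_integrable_einterval_imp_Icc[OF assms]] by simp

lemma primitive_tendsto:
  fixes \<phi> :: "real \<Rightarrow> 'a::euclidean_space"
  assumes b: "0 < b" and F: "primitive b F \<phi>" and \<phi>: "set_integrable lebesgue (einterval 0 b) \<phi>"
  shows "(F \<longlongrightarrow> F 0 + (LINT x:einterval 0 b|lebesgue. \<phi> x)) (up_to b)"
proof -
  have "((\<lambda>x. F 0 + integral {0..x} \<phi>) \<longlongrightarrow> F 0 + (LINT x:einterval 0 b|lebesgue. \<phi> x)) (up_to b)"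
    by (intro tendsto_intros tendsto_integral_up_to b \<phi>)
  moreover have "\<forall>\<^sub>F x in up_to b. F 0 + integral {0..x} \<phi> = F x"
    using eventually_up_to_gt[OF b, of 0, unfolded zero_ereal_def[symmetric], OF b]
  proof eventually_elim
    case (elim x)
    then have "F x = F 0 + integral {0..x} \<phi>" using F unfolding primitive_def by simp
    then show ?case by (rule sym)
  qed
  ultimately show ?thesis by (rule Lim_transform_eventually)
qed

lemma primitive_set_borel_measurable:
  fixes F :: "real \<Rightarrow> 'a::euclidean_space"
  assumes "0 < b" "primitive b F \<phi>"
  shows "set_borel_measurable lebesgue (einterval 0 b) F"
  by (rule set_borel_measurable_einterval[OF assms(1)])
     (auto intro!: absolutely_integrable_continuous_real primitive_continuous[OF assms(2)])

lemma set_borel_measurable_times: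
  fixes f g :: "real \<Rightarrow> real"
  assumes "set_borel_measurable lebesgue A f" "set_borel_measurable lebesgue A g"
  shows "set_borel_measurable lebesgue A (\<lambda>x. f x * g x)"
proof -
  have "(\<lambda>x. (indicator A x *\<^sub>R f x) * (indicator A x *\<^sub>R g x)) \<in> borel_measurable lebesgue"
    using assms unfolding set_borel_measurable_def by (rule borel_measurable_times)
  also have "(\<lambda>x. (indicator A x *\<^sub>R f x) * (indicator A x *\<^sub>R g x)) = (\<lambda>x. indicator A x *\<^sub>R (f x * g x))"
    by (auto simp: indicator_def)
  finally show ?thesis unfolding set_borel_measurable_def .
qed

text \<open>
  The coefficients of \<open>- (r\<^sup>-\<^sup>1 y')' = \<lambda> w y\<close> on \<open>[0,b)\<close>.
\<close>

locale sturm_liouville =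
  fixes b :: ereal and w r :: "real \<Rightarrow> real"
  assumes b_pos: "0 < b"
    and w_loc: "L1_loc b w" and r_loc: "L1_loc b r"
    and w_pos: "AE x in lebesgue. x \<in> einterval 0 b \<longrightarrow> 0 < w x"
    and r_pos: "AE x in lebesgue. x \<in> einterval 0 b \<longrightarrow> 0 < r x"
begin

text \<open>
  Integrability over \<open>(0,b)\<close>, and the integral over \<open>(0,b)\<close>.
\<close>

abbreviation intE :: "(real \<Rightarrow> 'a::euclidean_space) \<Rightarrow> bool" where
  "intE \<phi> \<equiv> set_integrable lebesgue (einterval 0 b) \<phi>"

abbreviation IE :: "(real \<Rightarrow> 'a::euclidean_space) \<Rightarrow> 'a" where
  "IE \<phi> \<equiv> (LINT x:einterval 0 b|lebesgue. \<phi> x)"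

lemma w_abs: "0 \<le> c \<Longrightarrow> ereal c < b \<Longrightarrow> w absolutely_integrable_on {0..c}"
  using w_loc unfolding L1_loc_def by auto

lemma r_abs: "0 \<le> c \<Longrightarrow> ereal c < b \<Longrightarrow> r absolutely_integrable_on {0..c}"
  using r_loc unfolding L1_loc_def by auto

text \<open>
  \<open>Wp\<close> and \<open>Rp\<close> are the primitives of the coefficients \<open>w\<close> and \<open>r\<close> vanishing at \<open>0\<close>.
\<close>

definition Wp :: "real \<Rightarrow> real" where "Wp x = integral {0..x} w"
definition Rp :: "real \<Rightarrow> real" where "Rp x = integral {0..x} r"

lemma primitive_Wp: "primitive b Wp w"
  using primitive_integral[where C=0, OF w_abs] by (simp add: Wp_def[abs_def])
lemma primitive_Rp: "primitive b Rp r"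
  using primitive_integral[where C=0, OF r_abs] by (simp add: Rp_def[abs_def])

lemma w_meas: "set_borel_measurable lebesgue (einterval 0 b) w"
  by (rule set_borel_measurable_einterval[OF b_pos w_abs])

lemma integral_le_IE:
  fixes \<phi> :: "real \<Rightarrow> real"
  assumes \<phi>: "intE \<phi>" and nn: "AE x in lebesgue. x \<in> einterval 0 b \<longrightarrow> 0 \<le> \<phi> x"
    and c: "0 \<le> c" "ereal c < b"
  shows "integral {0..c} \<phi> \<le> IE \<phi>"
proof (rule tendsto_lowerbound[OF tendsto_integral_up_to[OF b_pos \<phi>] _ up_to_neq_bot[OF b_pos]])
  show "\<forall>\<^sub>F x in up_to b. integral {0..c} \<phi> \<le> integral {0..x} \<phi>"
    using eventually_up_to_gt[OF b_pos c(2)]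
  proof eventually_elim
    case (elim x)
    have "AE t in lebesgue. t \<in> einterval 0 b \<longrightarrow> c \<le> t \<longrightarrow> t \<le> x \<longrightarrow> 0 \<le> \<phi> t"
      using nn by eventually_elim auto
    from primitive_le[OF primitive_const[of b "0::real"] primitive_einterval[OF \<phi>] c(1) _ _ this] elim
    show ?case by auto
  qed
qed

lemma L2w_mult:
  fixes u v :: "real \<Rightarrow> real"
  assumes "L2w b w u" "L2w b w v"
  shows "intE (\<lambda>x. w x * (u x * v x))"
proof (rule set_integrable_bound)
  show "intE (\<lambda>x. (norm (u x))\<^sup>2 * w x + (norm (v x))\<^sup>2 * w x)"
    using assms unfolding L2w_def by (intro set_integral_add(1)) auto
  show "set_borel_measurable lebesgue (einterval 0 b) (\<lambda>x. w x * (u x * v x))"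
    using assms w_meas unfolding L2w_def by (intro set_borel_measurable_times) auto
  show "AE x in lebesgue. x \<in> einterval 0 b \<longrightarrow> norm (w x * (u x * v x)) \<le> norm ((norm (u x))\<^sup>2 * w x + (norm (v x))\<^sup>2 * w x)"
    using w_pos
  proof eventually_elim
    case (elim x)
    show ?case
    proof
      assume "x \<in> einterval 0 b"
      then have w: "0 < w x" using elim by simp
      have "0 \<le> (\<bar>u x\<bar> - \<bar>v x\<bar>)\<^sup>2" by simp
      then have "2 * (\<bar>u x\<bar> * \<bar>v x\<bar>) \<le> (u x)\<^sup>2 + (v x)\<^sup>2" by (simp add: power2_diff)
      moreover have "0 \<le> \<bar>u x\<bar> * \<bar>v x\<bar>" by simp
      ultimately have "\<bar>u x\<bar> * \<bar>v x\<bar> \<le> (u x)\<^sup>2 + (v x)\<^sup>2" by linarith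
      then have "w x * (\<bar>u x\<bar> * \<bar>v x\<bar>) \<le> w x * ((u x)\<^sup>2 + (v x)\<^sup>2)" using w by (intro mult_left_mono) auto
      then show "norm (w x * (u x * v x)) \<le> norm ((norm (u x))\<^sup>2 * w x + (norm (v x))\<^sup>2 * w x)"
        using w by (simp add: abs_mult algebra_simps)
    qed
  qed
qed

lemma L2w_bound:
  fixes f :: "real \<Rightarrow> 'a::euclidean_space"
  assumes m: "set_borel_measurable lebesgue (einterval 0 b) f" and G: "intE (\<lambda>x. G x * w x)"
    and le: "\<And>x. x \<in> einterval 0 b \<Longrightarrow> (norm (f x))\<^sup>2 \<le> G x"
  shows "L2w b w f"
  unfolding L2w_def
proof (intro conjI m set_integrable_bound[OF G])
  have "set_borel_measurable lebesgue (einterval 0 b) (\<lambda>x. norm (f x))"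
    using measurable_compose[OF m[unfolded set_borel_measurable_def] borel_measurable_norm]
    by (simp add: set_borel_measurable_def)
  then show "set_borel_measurable lebesgue (einterval 0 b) (\<lambda>x. (norm (f x))\<^sup>2 * w x)"
    unfolding power2_eq_square by (intro set_borel_measurable_times w_meas)
  show "AE x in lebesgue. x \<in> einterval 0 b \<longrightarrow> norm ((norm (f x))\<^sup>2 * w x) \<le> norm (G x * w x)"
    using w_pos
  proof eventually_elim
    case (elim x)
    show ?case
    proof
      assume x: "x \<in> einterval 0 b"
      then have "(norm (f x))\<^sup>2 * w x \<le> G x * w x" using elim by (intro mult_right_mono le) auto
      moreover have "0 \<le> (norm (f x))\<^sup>2 * w x" using elim x by simp
      ultimately show "norm ((norm (f x))\<^sup>2 * w x) \<le> norm (G x * w x)" by simp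
    qed
  qed
qed

lemma norm_square_L2w: "L2w b w f \<Longrightarrow> intE (\<lambda>x. (norm (f x))\<^sup>2 * w x)"
  unfolding L2w_def by auto

lemma intE_cmult:
  fixes \<phi> :: "real \<Rightarrow> real"
  shows "intE \<phi> \<Longrightarrow> intE (\<lambda>x. c * \<phi> x)"
  by (rule set_integrable_mult_right)

lemma L2w_bounded_linear:
  fixes u :: "real \<Rightarrow> 'a::euclidean_space" and h :: "'a \<Rightarrow> 'c::euclidean_space"
  assumes u: "L2w b w u" and h: "bounded_linear h"
  shows "L2w b w (\<lambda>x. h (u x))"
proof -
  obtain K where K: "\<And>x. norm (h x) \<le> norm x * K" using bounded_linear.bounded[OF h] by blast
  show ?thesis
  proof (rule L2w_bound)
    have "(\<lambda>x. h (indicator (einterval 0 b) x *\<^sub>R u x)) \<in> borel_measurable lebesgue"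
      using u unfolding L2w_def set_borel_measurable_def
      by (intro measurable_compose[OF _ borel_measurable_continuous_onI[OF bounded_linear.continuous_on[OF h]]] continuous_on_id) auto
    then show "set_borel_measurable lebesgue (einterval 0 b) (\<lambda>x. h (u x))"
      unfolding set_borel_measurable_def by (simp add: linear_scale[OF bounded_linear.linear[OF h]])
    show "intE (\<lambda>x. (norm (u x) * K)\<^sup>2 * w x)"
      using intE_cmult[OF norm_square_L2w[OF u], of "K\<^sup>2"] by (simp add: power_mult_distrib mult_ac)
    show "(norm (h (u x)))\<^sup>2 \<le> (norm (u x) * K)\<^sup>2" for x by (intro power_mono K) simp
  qed
qed

lemma norm_add_square_le: "(norm (a + c))\<^sup>2 \<le> 2 * (norm a)\<^sup>2 + 2 * (norm c)\<^sup>2"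
proof -
  have "(norm (a + c))\<^sup>2 \<le> (norm a + norm c)\<^sup>2" by (intro power_mono norm_triangle_ineq) simp
  also have "\<dots> \<le> 2 * (norm a)\<^sup>2 + 2 * (norm c)\<^sup>2"
    using sum_squares_bound[of "norm a" "norm c"] by (simp add: power2_sum)
  finally show ?thesis .
qed

lemma L2w_add:
  fixes u v :: "real \<Rightarrow> 'a::euclidean_space"
  assumes u: "L2w b w u" and v: "L2w b w v"
  shows "L2w b w (\<lambda>x. u x + v x)"
proof (rule L2w_bound[OF _ _ norm_add_square_le])
  show "set_borel_measurable lebesgue (einterval 0 b) (\<lambda>x. u x + v x)"
    using borel_measurable_add[of "\<lambda>x. indicator (einterval 0 b) x *\<^sub>R u x" lebesgue "\<lambda>x. indicator (einterval 0 b) x *\<^sub>R v x"] u v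
    unfolding set_borel_measurable_def L2w_def by (simp add: scaleR_add_right)
  show "intE (\<lambda>x. (2 * (norm (u x))\<^sup>2 + 2 * (norm (v x))\<^sup>2) * w x)"
    using set_integral_add(1)[OF intE_cmult[OF norm_square_L2w[OF u], of 2] intE_cmult[OF norm_square_L2w[OF v], of 2]]
    by (simp add: distrib_right mult.assoc)
qed

lemma L2w_mono:
  fixes f :: "real \<Rightarrow> 'a::euclidean_space" and g :: "real \<Rightarrow> real"
  assumes m: "set_borel_measurable lebesgue (einterval 0 b) f" and g: "L2w b w g"
    and le: "\<And>x. x \<in> einterval 0 b \<Longrightarrow> norm (f x) \<le> \<bar>g x\<bar>"
  shows "L2w b w f"
proof (rule L2w_bound[OF m norm_square_L2w[OF g]])
  show "(norm (f x))\<^sup>2 \<le> (norm (g x))\<^sup>2" if "x \<in> einterval 0 b" for x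
    using le[OF that] by (intro power_mono) auto
qed

text \<open>
  A function \<open>u\<close>, its quasi-derivative \<open>p\<close> and \<open>j = w\<^sup>-\<^sup>1 p'\<close>, subject to the conditions defining the
  operator domain. Carrying \<open>p\<close> and \<open>j\<close> explicitly avoids derivatives that exist only almost everywhere.
  The codomain is generic, so that real and imaginary parts of admissible triples are admissible.
\<close>

definition admissible :: "(real \<Rightarrow> 'a::euclidean_space) \<Rightarrow> (real \<Rightarrow> 'a) \<Rightarrow> (real \<Rightarrow> 'a) \<Rightarrow> bool" where
  "admissible u p j \<longleftrightarrow> primitive b u (\<lambda>x. r x *\<^sub>R p x) \<and> primitive b p (\<lambda>x. w x *\<^sub>R j x) \<and>
     L2w b w u \<and> L2w b w j \<and> (limit_circle b w r \<longrightarrow> (p \<longlongrightarrow> 0) (up_to b))"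

lemma admissible_bounded_linear:
  fixes u :: "real \<Rightarrow> 'a::euclidean_space" and h :: "'a \<Rightarrow> 'c::euclidean_space"
  assumes a: "admissible u p j" and h: "bounded_linear h"
  shows "admissible (\<lambda>x. h (u x)) (\<lambda>x. h (p x)) (\<lambda>x. h (j x))"
proof -
  have "((\<lambda>x. h (p x)) \<longlongrightarrow> 0) (up_to b)" if "limit_circle b w r"
    using bounded_linear.tendsto[OF h, of p 0] a that linear_0[OF bounded_linear.linear[OF h]] unfolding admissible_def by auto
  then show ?thesis
    using a primitive_bounded_linear[OF _ h, of b u "\<lambda>x. r x *\<^sub>R p x"]
      primitive_bounded_linear[OF _ h, of b p "\<lambda>x. w x *\<^sub>R j x"] L2w_bounded_linear[OF _ h]
    unfolding admissible_def by (simp add: linear_scale[OF bounded_linear.linear[OF h]])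
qed

lemma admissible_add:
  fixes u u' :: "real \<Rightarrow> 'a::euclidean_space"
  assumes "admissible u p j" "admissible u' p' j'"
  shows "admissible (\<lambda>x. u x + u' x) (\<lambda>x. p x + p' x) (\<lambda>x. j x + j' x)"
proof -
  have "((\<lambda>x. p x + p' x) \<longlongrightarrow> 0) (up_to b)" if "limit_circle b w r"
    using tendsto_add[of p 0 "up_to b" p' 0] assms that unfolding admissible_def by auto
  then show ?thesis
    using assms primitive_add[of b u "\<lambda>x. r x *\<^sub>R p x" u' "\<lambda>x. r x *\<^sub>R p' x"]
      primitive_add[of b p "\<lambda>x. w x *\<^sub>R j x" p' "\<lambda>x. w x *\<^sub>R j' x"] L2w_add[of u u'] L2w_add[of j j']
    unfolding admissible_def by (simp add: scaleR_add_right)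
qed


section \<open>Boundary behaviour and Green's identity\<close>

lemma up_toE:
  assumes "eventually P (up_to b)"
  obtains c where "0 \<le> c" "ereal c < b" "\<And>x. c \<le> x \<Longrightarrow> ereal x < b \<Longrightarrow> P x"
proof -
  obtain c where c: "0 \<le> c" "ereal c < b" "\<And>x. c < x \<Longrightarrow> ereal x < b \<Longrightarrow> P x"
    using assms eventually_up_to[OF b_pos] by auto
  obtain d where d: "ereal c < ereal d" "ereal d < b" using ereal_dense2[OF c(2)] by blast
  show thesis by (rule that[of d]) (use c d in auto)
qed

lemma eventually_up_to_ge: "ereal c < b \<Longrightarrow> eventually (\<lambda>x. c \<le> x \<and> 0 \<le> x \<and> ereal x < b) (up_to b)"
  using eventually_up_to_gt[OF b_pos, of c] by (auto elim!: eventually_mono)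

lemma w_nonneg: "AE x in lebesgue. x \<in> einterval 0 b \<longrightarrow> 0 \<le> w x"
  using w_pos by eventually_elim auto

lemma r_nonneg: "AE x in lebesgue. x \<in> einterval 0 b \<longrightarrow> 0 \<le> r x"
  using r_pos by eventually_elim auto

lemma primitive_mono:
  fixes F :: "real \<Rightarrow> real"
  assumes F: "primitive b F \<phi>" and nn: "AE x in lebesgue. x \<in> einterval 0 b \<longrightarrow> 0 \<le> \<phi> x"
    and xy: "0 \<le> x" "x \<le> y" "ereal y < b"
  shows "F x \<le> F y"
proof -
  have "AE t in lebesgue. t \<in> einterval 0 b \<longrightarrow> x \<le> t \<longrightarrow> t \<le> y \<longrightarrow> 0 \<le> \<phi> t"
    using nn by eventually_elim auto
  from primitive_le[OF primitive_const[of b "0::real"] F xy this] show ?thesis by simp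
qed

lemma admissible_measurable:
  fixes u :: "real \<Rightarrow> 'a::euclidean_space"
  assumes "admissible u p j"
  shows "set_borel_measurable lebesgue (einterval 0 b) u" "set_borel_measurable lebesgue (einterval 0 b) p"
  using assms primitive_set_borel_measurable[OF b_pos] unfolding admissible_def by blast+

text \<open>
  If \<open>|u|\<close> stays away from \<open>0\<close> near \<open>b\<close>, integrability of \<open>w u\<^sup>2\<close> forces integrability of \<open>w\<close>.
\<close>

lemma w_integrable_of_lower_bound:
  fixes u :: "real \<Rightarrow> real"
  assumes u: "L2w b w u" and k: "0 < k" and x0: "0 \<le> x0" "ereal x0 < b"
    and lb: "\<And>x. x0 \<le> x \<Longrightarrow> ereal x < b \<Longrightarrow> k \<le> (u x)\<^sup>2"
  shows "intE w"
proof -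
  have N: "intE (\<lambda>x. w x * (u x * u x))" by (rule L2w_mult[OF u u])
  have Nnn: "AE x in lebesgue. x \<in> einterval 0 b \<longrightarrow> 0 \<le> w x * (u x * u x)"
    using w_pos by eventually_elim auto
  define I where "I = IE (\<lambda>x. w x * (u x * u x))"
  have I: "integral {0..c} (\<lambda>x. w x * (u x * u x)) \<le> I" if "0 \<le> c" "ereal c < b" for c
    unfolding I_def by (rule integral_le_IE[OF N Nnn that])
  have Nn0: "0 \<le> integral {0..x0} (\<lambda>x. w x * (u x * u x))"
    using primitive_mono[OF primitive_einterval[OF N] Nnn order_refl x0] by simp
  show ?thesis
  proof (rule set_integrable_einterval_bounded[OF b_pos w_abs])
    show "AE x in lebesgue. x \<in> einterval 0 b \<longrightarrow> 0 \<le> w x" using w_pos by eventually_elim auto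
    fix c :: real assume c: "0 \<le> c" "ereal c < b"
    have "Wp c \<le> Wp x0 + I / k"
    proof (cases "x0 \<le> c")
      case True
      have "k * Wp c - k * Wp x0 \<le> integral {0..c} (\<lambda>x. w x * (u x * u x)) - integral {0..x0} (\<lambda>x. w x * (u x * u x))"
      proof (rule primitive_le[OF primitive_cmult[OF primitive_Wp] primitive_einterval[OF N] x0(1) True c(2)])
        show "AE t in lebesgue. t \<in> einterval 0 b \<longrightarrow> x0 \<le> t \<longrightarrow> t \<le> c \<longrightarrow> k * w t \<le> w t * (u t * u t)"
          using w_pos
        proof eventually_elim
          case (elim t)
          show ?case
          proof (intro impI)
            assume t: "t \<in> einterval 0 b" "x0 \<le> t" "t \<le> c"
            then have "k \<le> u t * u t" using lb[of t] by (auto simp: einterval_def power2_eq_square)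
            then show "k * w t \<le> w t * (u t * u t)" using elim t by (simp add: mult.commute[of k] mult_left_mono)
          qed
        qed
      qed
      then have "k * (Wp c - Wp x0) \<le> I" using I[OF c] Nn0 by (simp add: algebra_simps)
      then show ?thesis using k by (simp add: field_simps)
    next
      case False
      have "0 \<le> I" using I[OF x0] Nn0 by linarith
      have "Wp c \<le> Wp x0"
        using primitive_mono[OF primitive_Wp w_nonneg c(1) _ x0(2)] False by simp
      then show ?thesis using \<open>0 \<le> I\<close> k by (simp add: add_increasing2)
    qed
    then show "integral {0..c} w \<le> Wp x0 + I / k" by (simp add: Wp_def)
  qed
qed

lemma L2w_one: "intE w \<Longrightarrow> L2w b w (\<lambda>_. 1::real)"
proof -
  have "einterval 0 b \<in> sets lebesgue"
    by (intro sets_completionI_sets) (simp add: borel_open open_einterval)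
  then show "intE w \<Longrightarrow> L2w b w (\<lambda>_. 1::real)"
    unfolding L2w_def set_borel_measurable_def by (auto intro!: borel_measurable_scaleR borel_measurable_indicator)
qed

lemma limit_circle_iff: "limit_circle b w r \<longleftrightarrow> intE w \<and> L2w b w Rp"
proof -
  have eq: "(LINT t:{0..x}|lebesgue. r t) = Rp x" if "x \<in> einterval 0 b" for x
    using set_lebesgue_integral_eq_integral(2)[OF r_abs[of x]] that by (simp add: einterval_def Rp_def)
  have 1: "set_borel_measurable lebesgue (einterval 0 b) (\<lambda>x. LINT t:{0..x}|lebesgue. r t) \<longleftrightarrow>
      set_borel_measurable lebesgue (einterval 0 b) Rp"
    unfolding set_borel_measurable_def by (intro arg_cong2[where f="(\<in>)"] ext refl) (auto simp: eq indicator_def)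
  have 2: "intE (\<lambda>x. (norm (LINT t:{0..x}|lebesgue. r t))\<^sup>2 * w x) \<longleftrightarrow> intE (\<lambda>x. (norm (Rp x))\<^sup>2 * w x)"
    by (rule set_integrable_cong) (auto simp: eq)
  show ?thesis using 1 2 unfolding limit_point_def L2w_def by auto
qed

text \<open>
  A positive limit of \<open>p\<close> makes \<open>u\<close> grow at least like a multiple of \<open>Rp\<close>, so that \<open>Rp\<close> is in the weighted
  space along with \<open>u\<close>.
\<close>

lemma admissible_p_tendsto_aux:
  fixes u p j :: "real \<Rightarrow> real"
  assumes a: "admissible u p j" and w: "intE w" and L: "0 < L" "(p \<longlongrightarrow> L) (up_to b)"
  shows "limit_circle b w r"
proof -
  define k where "k = L / 2"
  have k: "k > 0" using L by (simp add: k_def)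
  have "\<forall>\<^sub>F x in up_to b. k < p x" using order_tendstoD(1)[OF L(2), of k] L(1) by (simp add: k_def)
  then obtain c where c: "0 \<le> c" "ereal c < b" "\<And>x. c \<le> x \<Longrightarrow> ereal x < b \<Longrightarrow> k < p x" by (rule up_toE) blast
  have pu: "primitive b u (\<lambda>x. r x * p x)" and u: "L2w b w u" using a unfolding admissible_def by auto
  define D where "D = Rp c + \<bar>u c\<bar> / k"
  have Rmono: "Rp x \<le> Rp y" if "0 \<le> x" "x \<le> y" "ereal y < b" for x y
    by (rule primitive_mono[OF primitive_Rp r_nonneg that])
  have R0: "Rp 0 = 0" by (simp add: Rp_def)
  have bound: "\<bar>Rp y\<bar> \<le> D + \<bar>u y\<bar> / k" if y: "0 \<le> y" "ereal y < b" for y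
  proof -
    have "0 \<le> Rp y" using Rmono[of 0 y] y R0 by simp
    moreover have "Rp y \<le> D + \<bar>u y\<bar> / k"
    proof (cases "c \<le> y")
      case True
      have "k * Rp y - k * Rp c \<le> u y - u c"
      proof (rule primitive_le[OF primitive_cmult[OF primitive_Rp] pu c(1) True y(2)])
        show "AE t in lebesgue. t \<in> einterval 0 b \<longrightarrow> c \<le> t \<longrightarrow> t \<le> y \<longrightarrow> k * r t \<le> r t * p t"
          using r_pos
        proof eventually_elim
          case (elim t)
          show ?case
          proof (intro impI)
            assume t: "t \<in> einterval 0 b" "c \<le> t" "t \<le> y"
            then have "k \<le> p t" using c(3)[of t] by (auto simp: einterval_def)
            then show "k * r t \<le> r t * p t" using elim t by (simp add: mult.commute[of k] mult_left_mono)
          qed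
        qed
      qed
      then have "k * Rp y \<le> k * Rp c + \<bar>u c\<bar> + \<bar>u y\<bar>" by linarith
      then show ?thesis using k by (simp add: D_def field_simps)
    next
      case False
      have "Rp y \<le> Rp c" using Rmono[of y c] y c False by simp
      then show ?thesis using k by (simp add: D_def add_increasing2)
    qed
    ultimately show ?thesis by simp
  qed
  have "L2w b w Rp"
  proof (rule L2w_mono)
    show "set_borel_measurable lebesgue (einterval 0 b) Rp"
      by (rule primitive_set_borel_measurable[OF b_pos primitive_Rp])
    have "L2w b w (\<lambda>x. \<bar>u x\<bar>)"
      by (rule L2w_bound[OF _ norm_square_L2w[OF u]])
        (use u in \<open>auto simp: L2w_def set_borel_measurable_def abs_mult dest: borel_measurable_abs\<close>)
    then show "L2w b w (\<lambda>x. D * 1 + 1 / k * \<bar>u x\<bar>)"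
      by (intro L2w_add L2w_bounded_linear[OF _ bounded_linear_mult_right] L2w_one w)
    show "norm (Rp x) \<le> \<bar>D * 1 + 1 / k * \<bar>u x\<bar>\<bar>" if "x \<in> einterval 0 b" for x
      using bound[of x] that by (auto simp: einterval_def)
  qed
  with w show ?thesis using limit_circle_iff by blast
qed

text \<open>
  For integrable \<open>w\<close> the Neumann condition at \<open>b\<close> is automatic in the limit point case.
\<close>

lemma admissible_p_tendsto:
  fixes u p j :: "real \<Rightarrow> real"
  assumes a: "admissible u p j" and w: "intE w"
  shows "(p \<longlongrightarrow> 0) (up_to b)"
proof (cases "limit_circle b w r")
  case True then show ?thesis using a unfolding admissible_def by auto
next
  case False
  have pp: "primitive b p (\<lambda>x. w x * j x)" and j: "L2w b w j" using a unfolding admissible_def by auto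
  have "intE (\<lambda>x. w x * j x)" using L2w_mult[OF L2w_one[OF w] j] by simp
  from primitive_tendsto[OF b_pos pp this] obtain L where L: "(p \<longlongrightarrow> L) (up_to b)" by blast
  have "\<not> 0 < L" using admissible_p_tendsto_aux[OF a w _ L] False by blast
  moreover have "\<not> 0 < - L"
    using admissible_p_tendsto_aux[OF admissible_bounded_linear[OF a bounded_linear_minus[OF bounded_linear_ident]] w _ tendsto_minus[OF L]]
      False by blast
  ultimately have "L = 0" by simp
  then show ?thesis using L by simp
qed

text \<open>
  With \<open>E = u p\<close> one has \<open>E' = r p\<^sup>2 + w u j\<close> and \<open>(u\<^sup>2)' = 2 r E\<close>. If \<open>E\<close> stayed above a positive
  constant near \<open>b\<close>, then \<open>u\<^sup>2\<close> would increase, \<open>w\<close> would be integrable and \<open>p\<close> would vanish at \<open>b\<close>, whence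
  \<open>E(x) \<le> |u(x)| \<integral>\<^sub>x\<^sup>b w |j| \<le> \<integral>\<^sub>x\<^sup>b w |u j|\<close>, which tends to \<open>0\<close>. So \<open>\<integral> r p\<^sup>2\<close> is finite and \<open>E\<close>
  has a limit \<open>L \<le> 0\<close>. If \<open>L < 0\<close>, then \<open>u\<^sup>2\<close> decreases near \<open>b\<close>; either \<open>w\<close> is integrable and \<open>p\<close>
  vanishes at \<open>b\<close>, so that \<open>E\<close> does as well, or \<open>u\<close> vanishes at \<open>b\<close> and \<open>\<integral>\<^sub>x\<^sup>b r p\<^sup>2\<close> stays above a positive constant.
\<close>

lemma dirichlet_limit_real:
  fixes u p j :: "real \<Rightarrow> real"
  assumes a: "admissible u p j"
  shows "intE (\<lambda>x. r x * (p x * p x))" "((\<lambda>x. u x * p x) \<longlongrightarrow> 0) (up_to b)"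
proof -
  have pu: "primitive b u (\<lambda>x. r x * p x)" and pp: "primitive b p (\<lambda>x. w x * j x)"
    and u: "L2w b w u" and j: "L2w b w j" using a unfolding admissible_def by auto
  define E where "E x = u x * p x" for x
  define A where "A x = integral {0..x} (\<lambda>x. r x * (p x * p x))" for x
  define J where "J x = integral {0..x} (\<lambda>x. w x * (u x * j x))" for x
  have pint: "(\<lambda>x. r x * (p x * p x)) absolutely_integrable_on {0..c}" if "0 \<le> c" "ereal c < b" for c
    using absolutely_integrable_mult_continuous[OF continuous_on_mult[OF primitive_continuous[OF pp order_refl that(2)] primitive_continuous[OF pp order_refl that(2)]] r_abs[OF that]]
    by (simp add: mult_ac)
  have primA: "primitive b A (\<lambda>x. r x * (p x * p x))"
    using primitive_integral[where C=0, OF pint] by (simp add: A_def[abs_def])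
  have wuj: "intE (\<lambda>x. w x * (u x * j x))" by (rule L2w_mult[OF u j])
  have primJ: "primitive b J (\<lambda>x. w x * (u x * j x))"
    using primitive_einterval[OF wuj] by (simp add: J_def[abs_def])
  have primE: "primitive b E (\<lambda>x. r x * (p x * p x) + w x * (u x * j x))"
    using primitive_mult_real[OF pu pp] by (simp add: E_def[abs_def] mult_ac)
  have E_eq: "E x = E 0 + A x + J x" if "0 \<le> x" "ereal x < b" for x
    using primitive_diff_eq[OF primE order_refl that] primitive_diff_eq[OF primitive_add[OF primA primJ] order_refl that]
    by (simp add: A_def J_def)
  have primU: "primitive b (\<lambda>x. u x * u x) (\<lambda>x. 2 * (r x * E x))"
    using primitive_mult_real[OF pu pu] by (simp add: E_def mult_ac)
  have square_deriv_nonneg: "AE t in lebesgue. t \<in> einterval 0 b \<longrightarrow> x \<le> t \<longrightarrow> t \<le> y \<longrightarrow> 0 \<le> 2 * (r t * E t)"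
    if "\<And>t. x \<le> t \<Longrightarrow> ereal t < b \<Longrightarrow> 0 \<le> E t" for x y
    using r_pos by eventually_elim (use that in \<open>auto simp: einterval_def\<close>)

  have no_pos: False if d: "d > 0" and x0: "0 \<le> x0" "ereal x0 < b" and Ed: "\<And>x. x0 \<le> x \<Longrightarrow> ereal x < b \<Longrightarrow> d \<le> E x" for d x0
  proof -
    have mono: "u x * u x \<le> u y * u y" if "x0 \<le> x" "x \<le> y" "ereal y < b" for x y
    proof -
      have "0 \<le> x" "0 \<le> E t" if "x \<le> t" "ereal t < b" for t using Ed[of t] d x0 \<open>x0 \<le> x\<close> that by auto
      from primitive_le[OF primitive_const[of b "0::real"] primU _ that(2,3) square_deriv_nonneg[OF this(2)]] x0 that show ?thesis by auto
    qed
    have "u x0 \<noteq> 0" using Ed[OF order_refl x0(2)] d by (auto simp: E_def)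
    then have w: "intE w"
      by (intro w_integrable_of_lower_bound[OF u _ x0, of "u x0 * u x0"])
        (use mono[OF order_refl] in \<open>auto simp: power2_eq_square zero_less_mult_iff\<close>)
    have p0: "(p \<longlongrightarrow> 0) (up_to b)" by (rule admissible_p_tendsto[OF a w])
    have G: "intE (\<lambda>x. \<bar>w x * (u x * j x)\<bar>)" using set_integrable_abs[OF wuj] by simp
    define G1 where "G1 x = integral {0..x} (\<lambda>x. \<bar>w x * (u x * j x)\<bar>)" for x
    have primG: "primitive b G1 (\<lambda>x. \<bar>w x * (u x * j x)\<bar>)"
      using primitive_einterval[OF G] by (simp add: G1_def[abs_def])
    define I where "I = IE (\<lambda>x. \<bar>w x * (u x * j x)\<bar>)"
    have Glim: "(G1 \<longlongrightarrow> I) (up_to b)" unfolding G1_def I_def by (rule tendsto_integral_up_to[OF b_pos G])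
    have le: "E x \<le> I - G1 x" if x: "x0 \<le> x" "ereal x < b" for x
    proof -
      have 1: "u x * p x - u x * p y \<le> G1 y - G1 x" if y: "x \<le> y" "ereal y < b" for y
      proof -
        have "(- u x) * p y - (- u x) * p x \<le> G1 y - G1 x"
        proof (rule primitive_le[OF primitive_cmult[OF pp] primG _ y])
          show "0 \<le> x" using x x0 by simp
          show "AE t in lebesgue. t \<in> einterval 0 b \<longrightarrow> x \<le> t \<longrightarrow> t \<le> y \<longrightarrow> - u x * (w t * j t) \<le> \<bar>w t * (u t * j t)\<bar>"
            using w_pos
          proof eventually_elim
            case (elim t)
            show ?case
            proof (intro impI)
              assume t: "t \<in> einterval 0 b" "x \<le> t" "t \<le> y"
              have "u x * u x \<le> u t * u t" using mono[OF x(1) t(2)] t(1) by (auto simp: einterval_def)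
              then have "\<bar>u x\<bar> \<le> \<bar>u t\<bar>" by (simp add: abs_le_square_iff power2_eq_square)
              then have "\<bar>u x\<bar> * \<bar>w t * j t\<bar> \<le> \<bar>u t\<bar> * \<bar>w t * j t\<bar>" by (rule mult_right_mono) simp
              moreover have "- u x * (w t * j t) \<le> \<bar>u x\<bar> * \<bar>w t * j t\<bar>"
                by (metis abs_ge_self abs_minus_cancel abs_mult mult_minus_left)
              ultimately show "- u x * (w t * j t) \<le> \<bar>w t * (u t * j t)\<bar>" by (simp add: abs_mult mult_ac)
            qed
          qed
        qed
        then show ?thesis by simp
      qed
      have l1: "((\<lambda>y. u x * p x - u x * p y) \<longlongrightarrow> u x * p x - u x * 0) (up_to b)" by (intro tendsto_intros p0)
      have l2: "((\<lambda>y. G1 y - G1 x) \<longlongrightarrow> I - G1 x) (up_to b)" by (intro tendsto_intros Glim)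
      have "\<forall>\<^sub>F y in up_to b. u x * p x - u x * p y \<le> G1 y - G1 x"
        using eventually_up_to_ge[OF x(2)] by eventually_elim (use 1 in auto)
      then have "u x * p x - u x * 0 \<le> I - G1 x" by (rule tendsto_le[OF up_to_neq_bot[OF b_pos] l2 l1])
      then show ?thesis by (simp add: E_def)
    qed
    have "((\<lambda>x. I - G1 x) \<longlongrightarrow> I - I) (up_to b)" by (intro tendsto_intros Glim)
    moreover have "\<forall>\<^sub>F x in up_to b. d \<le> I - G1 x"
      using eventually_up_to_ge[OF x0(2)] by eventually_elim (use le Ed order_trans in blast)
    ultimately have "d \<le> I - I" by (rule tendsto_lowerbound[OF _ _ up_to_neq_bot[OF b_pos]])
    then show False using d by simp
  qed

  have rnn: "AE x in lebesgue. x \<in> einterval 0 b \<longrightarrow> 0 \<le> r x * (p x * p x)"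
    using r_pos by eventually_elim auto
  have Amono: "A x \<le> A y" if "0 \<le> x" "x \<le> y" "ereal y < b" for x y
    by (rule primitive_mono[OF primA rnn that])
  have Jlim: "(J \<longlongrightarrow> IE (\<lambda>x. w x * (u x * j x))) (up_to b)"
    unfolding J_def by (rule tendsto_integral_up_to[OF b_pos wuj])
  show dir: "intE (\<lambda>x. r x * (p x * p x))"
  proof (rule ccontr)
    assume not: "\<not> ?thesis"
    have "\<forall>\<^sub>F x in up_to b. IE (\<lambda>x. w x * (u x * j x)) - 1 < J x" by (rule order_tendstoD(1)[OF Jlim]) simp
    then obtain c where c: "0 \<le> c" "ereal c < b" "\<And>x. c \<le> x \<Longrightarrow> ereal x < b \<Longrightarrow> IE (\<lambda>x. w x * (u x * j x)) - 1 < J x"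
      by (rule up_toE) blast
    obtain d where d: "0 \<le> d" "ereal d < b" "A d > 2 - E 0 - IE (\<lambda>x. w x * (u x * j x))"
      using set_integrable_einterval_bounded[OF b_pos pint rnn] not unfolding A_def by (meson not_le)
    show False
    proof (rule no_pos[of 1 "max c d"])
      fix x assume x: "max c d \<le> x" "ereal x < b"
      then have "0 \<le> x" using c by simp
      then show "1 \<le> E x" using E_eq[of x] x c(3)[of x] d(3) Amono[of d x] d(1) by simp
    qed (use c d in \<open>auto simp: max_def\<close>)
  qed
  define L where "L = E 0 + IE (\<lambda>x. r x * (p x * p x)) + IE (\<lambda>x. w x * (u x * j x))"
  have Alim: "(A \<longlongrightarrow> IE (\<lambda>x. r x * (p x * p x))) (up_to b)"
    unfolding A_def by (rule tendsto_integral_up_to[OF b_pos dir])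
  have Elim: "(E \<longlongrightarrow> L) (up_to b)"
  proof (rule Lim_transform_eventually)
    show "((\<lambda>x. E 0 + A x + J x) \<longlongrightarrow> L) (up_to b)" unfolding L_def by (intro tendsto_intros Alim Jlim)
    show "\<forall>\<^sub>F x in up_to b. E 0 + A x + J x = E x"
      using eventually_up_to_ge[OF b_pos[unfolded zero_ereal_def]] by eventually_elim (use E_eq in auto)
  qed
  have "\<not> 0 < L"
  proof
    assume L: "0 < L"
    then have "\<forall>\<^sub>F x in up_to b. L / 2 < E x" by (intro order_tendstoD(1)[OF Elim]) simp
    then obtain c where c: "0 \<le> c" "ereal c < b" "\<And>x. c \<le> x \<Longrightarrow> ereal x < b \<Longrightarrow> L / 2 < E x" by (rule up_toE) blast
    show False by (rule no_pos[of "L / 2" c]) (use L c in \<open>auto intro: less_imp_le\<close>)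
  qed
  moreover have "\<not> L < 0"
  proof
    assume L: "L < 0"
    define d where "d = - L / 2"
    have d: "d > 0" using L by (simp add: d_def)
    have "\<forall>\<^sub>F x in up_to b. E x < L / 2" using L by (intro order_tendstoD(2)[OF Elim]) simp
    then obtain x0 where x0: "0 \<le> x0" "ereal x0 < b" "\<And>x. x0 \<le> x \<Longrightarrow> ereal x < b \<Longrightarrow> E x < - d"
      by (rule up_toE) (auto simp: d_def)
    have mono: "u y * u y \<le> u x * u x" if "x0 \<le> x" "x \<le> y" "ereal y < b" for x y
    proof -
      have "AE t in lebesgue. t \<in> einterval 0 b \<longrightarrow> x \<le> t \<longrightarrow> t \<le> y \<longrightarrow> 2 * (r t * E t) \<le> 0"
        using r_pos
      proof eventually_elim
        case (elim t)
        show ?case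
        proof (intro impI)
          assume t: "t \<in> einterval 0 b" "x \<le> t" "t \<le> y"
          then have "E t \<le> 0" using x0(3)[of t] that(1) d by (auto simp: einterval_def)
          then show "2 * (r t * E t) \<le> 0" using elim t by (simp add: mult_nonneg_nonpos)
        qed
      qed
      from primitive_le[OF primU primitive_const[of b "0::real"] _ that(2,3) this] x0 that show ?thesis by auto
    qed
    have unz: "u x \<noteq> 0" if "x0 \<le> x" "ereal x < b" for x using x0(3)[OF that] d by (auto simp: E_def)
    show False
    proof (cases "intE w")
      case True
      have p0: "(p \<longlongrightarrow> 0) (up_to b)" by (rule admissible_p_tendsto[OF a True])
      have "(E \<longlongrightarrow> 0) (up_to b)"
      proof (rule Lim_null_comparison)
        show "((\<lambda>x. \<bar>u x0\<bar> * \<bar>p x\<bar>) \<longlongrightarrow> 0) (up_to b)"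
          using tendsto_mult_right_zero[OF tendsto_rabs_zero[OF p0]] by blast
        show "\<forall>\<^sub>F x in up_to b. norm (E x) \<le> \<bar>u x0\<bar> * \<bar>p x\<bar>"
          using eventually_up_to_ge[OF x0(2)]
        proof eventually_elim
          case (elim x)
          then have "\<bar>u x\<bar> \<le> \<bar>u x0\<bar>" using mono[of x0 x] by (simp add: abs_le_square_iff power2_eq_square)
          then show ?case by (simp add: E_def abs_mult mult_right_mono)
        qed
      qed
      then have "L = 0" using tendsto_unique[OF up_to_neq_bot[OF b_pos] Elim] by blast
      then show False using L by simp
    next
      case False
      have small: "\<exists>x\<ge>x0. ereal x < b \<and> (u x)\<^sup>2 < k" if "k > 0" for k
        using w_integrable_of_lower_bound[OF u that x0(1,2)] False by (meson not_le)
      have u0: "(u \<longlongrightarrow> 0) (up_to b)"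
        unfolding tendsto_iff dist_real_def
      proof (intro allI impI)
        fix e :: real assume e: "e > 0"
        then obtain x1 where x1: "x0 \<le> x1" "ereal x1 < b" "(u x1)\<^sup>2 < e\<^sup>2" using small[of "e\<^sup>2"] by auto
        show "\<forall>\<^sub>F x in up_to b. \<bar>u x - 0\<bar> < e"
          using eventually_up_to_ge[OF x1(2)]
        proof eventually_elim
          case (elim x)
          then have "(u x)\<^sup>2 < e\<^sup>2" using mono[OF x1(1), of x] x1(3) by (simp add: power2_eq_square)
          then have "\<bar>u x\<bar>\<^sup>2 < e\<^sup>2" by simp
          then show ?case using e power2_less_imp_less[of "\<bar>u x\<bar>" e] by simp
        qed
      qed
      define I where "I = IE (\<lambda>x. r x * (p x * p x))"
      have le: "d \<le> I - A x" if x: "x0 \<le> x" "ereal x < b" for x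
      proof -
        define s where "s = u x"
        have s: "s \<noteq> 0" using unz[OF x] by (simp add: s_def)
        \<comment> \<open>From \<open>|u t| \<le> |s|\<close> and \<open>u p \<le> - d\<close> follows \<open>p\<^sup>2 \<ge> (d / |s|) |p|\<close>, hence
          \<open>r p\<^sup>2\<close> dominates the derivative \<open>- (d / s) r p\<close> of \<open>- (d / s) u\<close>.\<close>
        have 1: "(- d / s) * u y - (- d / s) * u x \<le> A y - A x" if y: "x \<le> y" "ereal y < b" for y
        proof (rule primitive_le[OF primitive_cmult[OF pu] primA _ y])
          show "0 \<le> x" using x x0 by simp
          show "AE t in lebesgue. t \<in> einterval 0 b \<longrightarrow> x \<le> t \<longrightarrow> t \<le> y \<longrightarrow> - d / s * (r t * p t) \<le> r t * (p t * p t)"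
            using r_pos
          proof eventually_elim
            case (elim t)
            show ?case
            proof (intro impI)
              assume t: "t \<in> einterval 0 b" "x \<le> t" "t \<le> y"
              then have tb: "ereal t < b" by (auto simp: einterval_def)
              have "u t * u t \<le> s * s" using mono[OF x(1) t(2) tb] by (simp add: s_def)
              then have us: "\<bar>u t\<bar> \<le> \<bar>s\<bar>" by (simp add: abs_le_square_iff power2_eq_square)
              have "d \<le> \<bar>u t\<bar> * \<bar>p t\<bar>" using x0(3)[of t] x(1) t(2) tb unfolding E_def by (simp add: abs_mult[symmetric])
              also have "\<dots> \<le> \<bar>s\<bar> * \<bar>p t\<bar>" using us by (rule mult_right_mono) simp
              finally have "d / \<bar>s\<bar> \<le> \<bar>p t\<bar>" using s by (simp add: field_simps)
              then have "d / \<bar>s\<bar> * \<bar>p t\<bar> \<le> \<bar>p t\<bar> * \<bar>p t\<bar>" by (rule mult_right_mono) simp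
              moreover have "- d / s * p t \<le> d / \<bar>s\<bar> * \<bar>p t\<bar>"
                using abs_ge_self[of "- d / s * p t"] d by (simp add: abs_mult abs_divide)
              ultimately have "- d / s * p t \<le> p t * p t" by simp
              then have "r t * (- d / s * p t) \<le> r t * (p t * p t)" using elim t by (intro mult_left_mono) auto
              then show "- d / s * (r t * p t) \<le> r t * (p t * p t)" by (simp add: mult_ac)
            qed
          qed
        qed
        have l1: "((\<lambda>y. (- d / s) * u y - (- d / s) * u x) \<longlongrightarrow> (- d / s) * 0 - (- d / s) * u x) (up_to b)"
          by (intro tendsto_intros u0)
        have l2: "((\<lambda>y. A y - A x) \<longlongrightarrow> I - A x) (up_to b)" unfolding I_def by (intro tendsto_intros Alim)
        have "\<forall>\<^sub>F y in up_to b. (- d / s) * u y - (- d / s) * u x \<le> A y - A x"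
          using eventually_up_to_ge[OF x(2)] by eventually_elim (use 1 in auto)
        then have "(- d / s) * 0 - (- d / s) * u x \<le> I - A x"
          by (rule tendsto_le[OF up_to_neq_bot[OF b_pos] l2 l1])
        then show ?thesis using s by (simp add: s_def)
      qed
      have "((\<lambda>x. I - A x) \<longlongrightarrow> I - I) (up_to b)" unfolding I_def by (intro tendsto_intros Alim)
      moreover have "\<forall>\<^sub>F x in up_to b. d \<le> I - A x"
        using eventually_up_to_ge[OF x0(2)] by eventually_elim (use le in blast)
      ultimately have "d \<le> I - I" by (rule tendsto_lowerbound[OF _ _ up_to_neq_bot[OF b_pos]])
      then show False using d by simp
    qed
  qed
  ultimately have "L = 0" by simp
  then show "((\<lambda>x. u x * p x) \<longlongrightarrow> 0) (up_to b)" using Elim by (simp add: E_def[abs_def])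
qed

lemma dirichlet_integrable:
  fixes u p j v q k :: "real \<Rightarrow> real"
  assumes a: "admissible u p j" and a': "admissible v q k"
  shows "intE (\<lambda>x. r x * (p x * q x))"
proof (rule set_integrable_bound)
  show "intE (\<lambda>x. r x * (p x * p x) + r x * (q x * q x))"
    by (intro set_integral_add(1) dirichlet_limit_real(1)[OF a] dirichlet_limit_real(1)[OF a'])
  show "set_borel_measurable lebesgue (einterval 0 b) (\<lambda>x. r x * (p x * q x))"
    by (intro set_borel_measurable_times admissible_measurable[OF a] admissible_measurable[OF a']
        set_borel_measurable_einterval[OF b_pos r_abs])
  show "AE x in lebesgue. x \<in> einterval 0 b \<longrightarrow> norm (r x * (p x * q x)) \<le> norm (r x * (p x * p x) + r x * (q x * q x))"
    using r_pos
  proof eventually_elim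
    case (elim x)
    show ?case
    proof
      assume "x \<in> einterval 0 b"
      then have r: "0 < r x" using elim by simp
      have "2 * (\<bar>p x\<bar> * \<bar>q x\<bar>) \<le> p x * p x + q x * q x"
        using sum_squares_bound[of "\<bar>p x\<bar>" "\<bar>q x\<bar>"] by (simp add: power2_eq_square)
      moreover have "0 \<le> \<bar>p x\<bar> * \<bar>q x\<bar>" by simp
      ultimately have "\<bar>p x\<bar> * \<bar>q x\<bar> \<le> p x * p x + q x * q x" by linarith
      then have "r x * (\<bar>p x\<bar> * \<bar>q x\<bar>) \<le> r x * (p x * p x + q x * q x)" using r by (intro mult_left_mono) auto
      then show "norm (r x * (p x * q x)) \<le> norm (r x * (p x * p x) + r x * (q x * q x))"
        using r by (simp add: abs_mult distrib_left)
    qed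
  qed
qed

text \<open>
  Polarisation of \<open>u p \<longrightarrow> 0\<close> only gives \<open>u q + v p \<longrightarrow> 0\<close>. Both products have limits, and their product
  equals \<open>(u p) (v q)\<close>, which tends to \<open>0\<close>; so each limit is \<open>0\<close>.
\<close>

lemma green_real:
  fixes u p j v q k :: "real \<Rightarrow> real"
  assumes a: "admissible u p j" and a': "admissible v q k"
  shows "IE (\<lambda>x. r x * (p x * q x)) + IE (\<lambda>x. w x * (u x * k x)) = - (u 0 * q 0)"
proof -
  have lim: "((\<lambda>x. f x * h x) \<longlongrightarrow> f 0 * h 0 + (IE (\<lambda>x. r x * (g x * h x)) + IE (\<lambda>x. w x * (f x * l x)))) (up_to b)"
    if "admissible f g m" "admissible e h l" for f g m e h l :: "real \<Rightarrow> real"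
  proof -
    have pf: "primitive b f (\<lambda>x. r x * g x)" and f: "L2w b w f" and ph: "primitive b h (\<lambda>x. w x * l x)" and l: "L2w b w l"
      using that unfolding admissible_def by auto
    have P: "primitive b (\<lambda>x. f x * h x) (\<lambda>x. r x * (g x * h x) + w x * (f x * l x))"
      using primitive_mult_real[OF pf ph] by (simp add: mult_ac)
    note i = dirichlet_integrable[OF that] L2w_mult[OF f l]
    show ?thesis using primitive_tendsto[OF b_pos P set_integral_add(1)[OF i]] by (simp add: set_integral_add(2)[OF i])
  qed
  define M where "M = u 0 * q 0 + (IE (\<lambda>x. r x * (p x * q x)) + IE (\<lambda>x. w x * (u x * k x)))"
  have uq: "((\<lambda>x. u x * q x) \<longlongrightarrow> M) (up_to b)" unfolding M_def by (rule lim[OF a a'])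
  obtain M' where vp: "((\<lambda>x. v x * p x) \<longlongrightarrow> M') (up_to b)" using lim[OF a' a] by blast
  note up = dirichlet_limit_real(2)[OF a] and vq = dirichlet_limit_real(2)[OF a']
  note s = dirichlet_limit_real(2)[OF admissible_add[OF a a']]
  have "((\<lambda>x. u x * p x + v x * q x + u x * q x + v x * p x) \<longlongrightarrow> 0 + 0 + M + M') (up_to b)"
    by (intro tendsto_add up vq uq vp)
  moreover have "(\<lambda>x. (u x + v x) * (p x + q x)) = (\<lambda>x. u x * p x + v x * q x + u x * q x + v x * p x)"
    by (simp add: algebra_simps)
  ultimately have "((\<lambda>x. (u x + v x) * (p x + q x)) \<longlongrightarrow> 0 + 0 + M + M') (up_to b)" by (simp only:)
  from tendsto_unique[OF up_to_neq_bot[OF b_pos] this s] have "M' = - M" by simp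
  moreover have "M * M' = 0 * 0"
  proof (rule tendsto_unique[OF up_to_neq_bot[OF b_pos]])
    show "((\<lambda>x. (u x * q x) * (v x * p x)) \<longlongrightarrow> M * M') (up_to b)" by (rule tendsto_mult[OF uq vp])
    have "((\<lambda>x. (u x * p x) * (v x * q x)) \<longlongrightarrow> 0 * 0) (up_to b)" by (rule tendsto_mult[OF up vq])
    then show "((\<lambda>x. (u x * q x) * (v x * p x)) \<longlongrightarrow> 0 * 0) (up_to b)" by (simp add: mult_ac)
  qed
  ultimately have "M = 0" by simp
  then show ?thesis by (simp add: M_def)
qed

end

lemma primitive_norm_le:
  fixes F :: "real \<Rightarrow> 'a::euclidean_space" and G :: "real \<Rightarrow> real"
  assumes F: "primitive b F \<phi>" and G: "primitive b G \<gamma>" and xy: "0 \<le> x" "x \<le> y" "ereal y < b"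
    and le: "AE t in lebesgue. t \<in> einterval 0 b \<longrightarrow> x \<le> t \<longrightarrow> t \<le> y \<longrightarrow> norm (\<phi> t) \<le> \<gamma> t"
  shows "norm (F y - F x) \<le> G y - G x"
proof (cases "F y = F x")
  case True
  have "AE t in lebesgue. t \<in> einterval 0 b \<longrightarrow> x \<le> t \<longrightarrow> t \<le> y \<longrightarrow> 0 \<le> \<gamma> t"
    using le by eventually_elim (meson norm_ge_zero order_trans)
  from primitive_le[OF primitive_const[of b "0::real"] G xy this] True show ?thesis by simp
next
  case False
  define v where "v = F y - F x"
  have v: "norm v > 0" using False by (simp add: v_def)
  have "v \<bullet> F y - v \<bullet> F x \<le> norm v * G y - norm v * G x"
  proof (rule primitive_le[OF primitive_bounded_linear[OF F bounded_linear_inner_right] primitive_cmult[OF G] xy])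
    show "AE t in lebesgue. t \<in> einterval 0 b \<longrightarrow> x \<le> t \<longrightarrow> t \<le> y \<longrightarrow> v \<bullet> \<phi> t \<le> norm v * \<gamma> t"
      using le
    proof eventually_elim
      case (elim t)
      show ?case
      proof (intro impI)
        assume "t \<in> einterval 0 b" "x \<le> t" "t \<le> y"
        then have "norm v * norm (\<phi> t) \<le> norm v * \<gamma> t" using elim by (intro mult_left_mono) auto
        then show "v \<bullet> \<phi> t \<le> norm v * \<gamma> t" using norm_cauchy_schwarz[of v "\<phi> t"] by linarith
      qed
    qed
  qed
  then have "v \<bullet> v \<le> norm v * (G y - G x)" by (simp add: v_def inner_diff_right right_diff_distrib)
  then have "norm v * norm v \<le> norm v * (G y - G x)" by (simp add: dot_square_norm power2_eq_square)
  then show ?thesis using v by (simp add: v_def)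
qed

lemma integral_pos_ae:
  fixes \<phi> :: "real \<Rightarrow> real"
  assumes \<phi>: "\<phi> absolutely_integrable_on {x..y}" and xy: "x < y"
    and pos: "AE t in lebesgue. t \<in> {x<..<y} \<longrightarrow> 0 < \<phi> t"
  shows "0 < integral {x..y} \<phi>"
proof -
  have nn: "AE t in lebesgue. 0 \<le> indicator {x..y} t *\<^sub>R \<phi> t"
    using pos AE_lebesgue_neq[of x] AE_lebesgue_neq[of y]
    by eventually_elim (auto simp: indicator_def intro: less_imp_le)
  have I: "integrable lebesgue (\<lambda>t. indicator {x..y} t *\<^sub>R \<phi> t)" using \<phi> by (simp add: set_integrable_def)
  have eq: "integral {x..y} \<phi> = (\<integral>t. indicator {x..y} t *\<^sub>R \<phi> t \<partial>lebesgue)"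
    using set_lebesgue_integral_eq_integral(2)[OF \<phi>] by (simp add: set_lebesgue_integral_def)
  have "integral {x..y} \<phi> \<noteq> 0"
  proof
    assume "integral {x..y} \<phi> = 0"
    then have "AE t in lebesgue. indicator {x..y} t *\<^sub>R \<phi> t = 0"
      using integral_nonneg_eq_0_iff_AE[OF I nn] eq by simp
    then have "AE t in lebesgue. t \<notin> {x<..<y}"
      using pos by eventually_elim (auto simp: indicator_def)
    then obtain N where N: "negligible N" "{t. \<not> t \<notin> {x<..<y}} \<subseteq> N"
      unfolding eventually_ae_filter_negligible by blast
    have "{x<..<y} \<subseteq> N" using N(2) by auto
    with N(1) have "negligible {x<..<y}" by (rule negligible_subset)
    then show False using open_not_negligible[of "{x<..<y}"] xy by auto
  qed
  moreover have "0 \<le> integral {x..y} \<phi>" unfolding eq by (rule integral_nonneg_AE[OF nn])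
  ultimately show ?thesis by simp
qed

context sturm_liouville
begin

lemma primitive_strict_mono:
  fixes F :: "real \<Rightarrow> real"
  assumes F: "primitive b F \<phi>" and pos: "AE x in lebesgue. x \<in> einterval 0 b \<longrightarrow> 0 < \<phi> x"
    and xy: "0 \<le> x" "x < y" "ereal y < b"
  shows "F x < F y"
proof -
  have "0 < integral {x..y} \<phi>"
  proof (rule integral_pos_ae[OF primitive_abs_int[OF F xy(1,3)] xy(2)])
    show "AE t in lebesgue. t \<in> {x<..<y} \<longrightarrow> 0 < \<phi> t"
      using pos by eventually_elim (use xy in \<open>auto simp: einterval_def intro: less_trans[of _ "ereal y"]\<close>)
  qed
  then show ?thesis using primitive_diff_eq[OF F xy(1) _ xy(3)] xy(2) by simp
qed

lemma green_complex:
  fixes f g h :: "real \<Rightarrow> complex"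
  assumes a: "admissible f g h"
  shows "intE (\<lambda>x. r x * (cmod (g x))\<^sup>2)"
    and "intE (\<lambda>x. w x * Re (cnj (f x) * h x))" and "intE (\<lambda>x. w x * Im (cnj (f x) * h x))"
    and "IE (\<lambda>x. r x * (cmod (g x))\<^sup>2) + IE (\<lambda>x. w x * Re (cnj (f x) * h x)) = - Re (cnj (f 0) * g 0)"
    and "IE (\<lambda>x. w x * Im (cnj (f x) * h x)) = - Im (cnj (f 0) * g 0)"
proof -
  note R = admissible_bounded_linear[OF a bounded_linear_Re] and I = admissible_bounded_linear[OF a bounded_linear_Im]
  have L: "L2w b w (\<lambda>x. Re (f x))" "L2w b w (\<lambda>x. Im (f x))" "L2w b w (\<lambda>x. Re (h x))" "L2w b w (\<lambda>x. Im (h x))"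
    using R I unfolding admissible_def by auto
  have g2: "r x * (cmod (g x))\<^sup>2 = r x * (Re (g x) * Re (g x)) + r x * (Im (g x) * Im (g x))" for x
    unfolding cmod_power2 by (simp add: power2_eq_square distrib_left)
  have re: "w x * Re (cnj (f x) * h x) = w x * (Re (f x) * Re (h x)) + w x * (Im (f x) * Im (h x))" for x
    by (simp add: distrib_left)
  have im: "w x * Im (cnj (f x) * h x) = w x * (Re (f x) * Im (h x)) - w x * (Im (f x) * Re (h x))" for x
    by (simp add: right_diff_distrib)
  note d = dirichlet_integrable[OF R R] dirichlet_integrable[OF I I]
  note m = L2w_mult[OF L(1,3)] L2w_mult[OF L(2,4)] L2w_mult[OF L(1,4)] L2w_mult[OF L(2,3)]
  show "intE (\<lambda>x. r x * (cmod (g x))\<^sup>2)" unfolding g2 by (rule set_integral_add(1)[OF d])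
  show "intE (\<lambda>x. w x * Re (cnj (f x) * h x))" unfolding re by (rule set_integral_add(1)[OF m(1,2)])
  show "intE (\<lambda>x. w x * Im (cnj (f x) * h x))" unfolding im by (rule set_integral_diff(1)[OF m(3,4)])
  show "IE (\<lambda>x. r x * (cmod (g x))\<^sup>2) + IE (\<lambda>x. w x * Re (cnj (f x) * h x)) = - Re (cnj (f 0) * g 0)"
    unfolding g2 re set_integral_add(2)[OF d] set_integral_add(2)[OF m(1,2)]
    using green_real[OF R R] green_real[OF I I] by simp
  have "IE (\<lambda>x. r x * (Re (g x) * Im (g x))) = IE (\<lambda>x. r x * (Im (g x) * Re (g x)))" by (simp add: mult.commute)
  then show "IE (\<lambda>x. w x * Im (cnj (f x) * h x)) = - Im (cnj (f 0) * g 0)"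
    unfolding im set_integral_diff(2)[OF m(3,4)]
    using green_real[OF R I] green_real[OF I R] by simp
qed

section \<open>The Weyl solution on the imaginary axis\<close>

text \<open>
  \<open>f\<close> solves the differential equation for the spectral parameter \<open>\<i> y\<close>, with quasi-derivative \<open>g\<close>.
\<close>

definition eigen_system :: "real \<Rightarrow> (real \<Rightarrow> complex) \<Rightarrow> (real \<Rightarrow> complex) \<Rightarrow> bool" where
  "eigen_system y f g \<longleftrightarrow> primitive b f (\<lambda>x. r x *\<^sub>R g x) \<and> primitive b g (\<lambda>x. w x *\<^sub>R (- (\<i> * y) * f x))"

lemma eigen_system_diff_scale:
  assumes "eigen_system y f g" "eigen_system y f' g'"
  shows "eigen_system y (\<lambda>x. f x - m * f' x) (\<lambda>x. g x - m * g' x)"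
proof -
  have 1: "primitive b (\<lambda>x. f x + (- m) * f' x) (\<lambda>x. r x *\<^sub>R g x + (- m) * (r x *\<^sub>R g' x))"
    using assms unfolding eigen_system_def
    by (intro primitive_add primitive_bounded_linear[OF _ bounded_linear_mult_right]) auto
  have 2: "primitive b (\<lambda>x. g x + (- m) * g' x) (\<lambda>x. w x *\<^sub>R (- (\<i> * y) * f x) + (- m) * (w x *\<^sub>R (- (\<i> * y) * f' x)))"
    using assms unfolding eigen_system_def
    by (intro primitive_add primitive_bounded_linear[OF _ bounded_linear_mult_right]) auto
  have e1: "r x *\<^sub>R g x + (- m) * (r x *\<^sub>R g' x) = r x *\<^sub>R (g x - m * g' x)" for x
    by (simp add: scaleR_conv_of_real algebra_simps)
  have e2: "w x *\<^sub>R (- (\<i> * y) * f x) + (- m) * (w x *\<^sub>R (- (\<i> * y) * f' x)) = w x *\<^sub>R (- (\<i> * y) * (f x - m * f' x))" for x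
    by (simp add: scaleR_conv_of_real algebra_simps)
  show ?thesis using 1 2 unfolding e1 e2 eigen_system_def by simp
qed

text \<open>
  The squared norm of \<open>f\<close> in the weighted space on \<open>[0,x]\<close>.
\<close>

definition mass :: "(real \<Rightarrow> complex) \<Rightarrow> real \<Rightarrow> real" where
  "mass f x = integral {0..x} (\<lambda>t. (cmod (f t))\<^sup>2 * w t)"

lemma primitive_mass:
  assumes "eigen_system y f g"
  shows "primitive b (mass f) (\<lambda>t. (cmod (f t))\<^sup>2 * w t)"
proof -
  have f: "primitive b f (\<lambda>x. r x *\<^sub>R g x)" using assms unfolding eigen_system_def by auto
  have "(\<lambda>t. (cmod (f t))\<^sup>2 * w t) absolutely_integrable_on {0..c}" if "0 \<le> c" "ereal c < b" for c
    by (intro absolutely_integrable_mult_continuous w_abs that continuous_on_power continuous_on_norm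
        primitive_continuous[OF f order_refl that(2)])
  from primitive_integral[where C=0, OF this] show ?thesis by (simp add: mass_def[abs_def])
qed

lemma mass_mono:
  assumes "eigen_system y f g" "0 \<le> x" "x \<le> x'" "ereal x' < b"
  shows "mass f x \<le> mass f x'"
proof (rule primitive_mono[OF primitive_mass[OF assms(1)] _ assms(2-)])
  show "AE x in lebesgue. x \<in> einterval 0 b \<longrightarrow> 0 \<le> (cmod (f x))\<^sup>2 * w x"
    using w_nonneg by eventually_elim auto
qed

lemma mass_nonneg: "eigen_system y f g \<Longrightarrow> 0 \<le> x \<Longrightarrow> ereal x < b \<Longrightarrow> 0 \<le> mass f x"
  using mass_mono[of y f g 0 x] by (simp add: mass_def)

lemma eigen_identity:
  assumes e: "eigen_system y f g" and x: "0 \<le> x" "ereal x < b"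
  shows "Im (cnj (f x) * g x) = Im (cnj (f 0) * g 0) - y * mass f x"
proof -
  have f: "primitive b f (\<lambda>x. r x *\<^sub>R g x)" and g: "primitive b g (\<lambda>x. w x *\<^sub>R (- (\<i> * y) * f x))"
    using e unfolding eigen_system_def by auto
  have P: "primitive b (\<lambda>x. Im (cnj (f x) * g x)) (\<lambda>x. Im (cnj (r x *\<^sub>R g x) * g x + cnj (f x) * (w x *\<^sub>R (- (\<i> * y) * f x))))"
    by (rule primitive_bounded_linear[OF primitive_mult[OF primitive_bounded_linear[OF f bounded_linear_cnj] g] bounded_linear_Im])
  have eq: "Im (cnj (r x *\<^sub>R g x) * g x + cnj (f x) * (w x *\<^sub>R (- (\<i> * y) * f x))) = (- y) * ((cmod (f x))\<^sup>2 * w x)" for x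
    unfolding cmod_power2 by (simp add: power2_eq_square algebra_simps)
  have P: "primitive b (\<lambda>x. Im (cnj (f x) * g x)) (\<lambda>x. (- y) * ((cmod (f x))\<^sup>2 * w x))"
    using P unfolding eq .
  show ?thesis
    using primitive_diff_eq[OF P order_refl x] primitive_diff_eq[OF primitive_cmult[OF primitive_mass[OF e], of "- y"] order_refl x]
    by (simp add: mass_def)
qed

lemma mass_pos:
  assumes e: "eigen_system y f g" and x: "0 \<le> x0" "x0 < x" "ereal x < b" and nz: "f x0 \<noteq> 0"
  shows "0 < mass f x"
proof -
  have f: "primitive b f (\<lambda>x. r x *\<^sub>R g x)" using e unfolding eigen_system_def by auto
  have "continuous_on {x0..x} f" by (rule primitive_continuous[OF f x(1,3)])
  then have "continuous_on {x0..x} (\<lambda>t. cmod (f t))" by (intro continuous_intros)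
  moreover have "cmod (f x0) / 2 > 0" using nz by simp
  moreover have "x0 \<in> {x0..x}" using x by simp
  ultimately obtain d where d: "d > 0" "\<And>t. t \<in> {x0..x} \<Longrightarrow> dist t x0 < d \<Longrightarrow> dist (cmod (f t)) (cmod (f x0)) < cmod (f x0) / 2"
    unfolding continuous_on_iff by blast
  define x1 where "x1 = min x (x0 + d / 2)"
  have x1: "x0 < x1" "x1 \<le> x" using x d by (auto simp: x1_def)
  then have "ereal x1 < b" using x(3) by (intro le_less_trans[of "ereal x1" "ereal x"]) auto
  note x1 = x1 this
  define k where "k = (cmod (f x0) / 2)\<^sup>2"
  have k: "k > 0" using nz by (simp add: k_def)
  have "k * Wp x1 - k * Wp x0 \<le> mass f x1 - mass f x0"
  proof (rule primitive_le[OF primitive_cmult[OF primitive_Wp] primitive_mass[OF e] x(1) _ x1(3)])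
    show "x0 \<le> x1" using x1 by simp
    show "AE t in lebesgue. t \<in> einterval 0 b \<longrightarrow> x0 \<le> t \<longrightarrow> t \<le> x1 \<longrightarrow> k * w t \<le> (cmod (f t))\<^sup>2 * w t"
      using w_pos
    proof eventually_elim
      case (elim t)
      show ?case
      proof (intro impI)
        assume t: "t \<in> einterval 0 b" "x0 \<le> t" "t \<le> x1"
        then have "dist t x0 < d" using d(1) by (auto simp: x1_def dist_real_def)
        then have "dist (cmod (f t)) (cmod (f x0)) < cmod (f x0) / 2" using d(2)[of t] t x1 by auto
        then have "cmod (f x0) / 2 \<le> cmod (f t)" unfolding dist_real_def by linarith
        then have "k \<le> (cmod (f t))\<^sup>2" unfolding k_def by (rule power_mono) simp
        then show "k * w t \<le> (cmod (f t))\<^sup>2 * w t" using elim t by (intro mult_right_mono) auto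
      qed
    qed
  qed
  moreover have "Wp x0 < Wp x1" by (rule primitive_strict_mono[OF primitive_Wp w_pos x(1) x1(1,3)])
  then have "k * Wp x0 < k * Wp x1" using k by simp
  moreover have "0 \<le> mass f x0" by (rule mass_nonneg[OF e x(1)]) (use x in \<open>auto intro: less_trans[of "ereal x0" "ereal x"]\<close>)
  moreover have "mass f x1 \<le> mass f x" by (rule mass_mono[OF e _ x1(2) x(3)]) (use x x1 in auto)
  ultimately show ?thesis by linarith
qed

lemma norm_diff_square_le: "(norm (a - c))\<^sup>2 \<le> 2 * (norm a)\<^sup>2 + 2 * (norm c)\<^sup>2"
  using norm_add_square_le[of a "- c"] by simp

lemma mass_diff_le:
  assumes f: "eigen_system y f g" and f': "eigen_system y f' g'" and h: "eigen_system y h l"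
    and le: "\<And>t. (cmod (h t))\<^sup>2 \<le> \<alpha> * (cmod (f t))\<^sup>2 + \<beta> * (cmod (f' t))\<^sup>2" and x: "0 \<le> x" "ereal x < b"
  shows "mass h x \<le> \<alpha> * mass f x + \<beta> * mass f' x"
proof -
  have "mass h x - mass h 0 \<le> (\<alpha> * mass f x + \<beta> * mass f' x) - (\<alpha> * mass f 0 + \<beta> * mass f' 0)"
  proof (rule primitive_le[OF primitive_mass[OF h] primitive_add[OF primitive_cmult[OF primitive_mass[OF f]] primitive_cmult[OF primitive_mass[OF f']]] order_refl x])
    show "AE t in lebesgue. t \<in> einterval 0 b \<longrightarrow> 0 \<le> t \<longrightarrow> t \<le> x \<longrightarrow>
      (cmod (h t))\<^sup>2 * w t \<le> \<alpha> * ((cmod (f t))\<^sup>2 * w t) + \<beta> * ((cmod (f' t))\<^sup>2 * w t)"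
      using w_nonneg
    proof eventually_elim
      case (elim t)
      then show ?case using mult_right_mono[OF le[of t], of "w t"] by (auto simp: distrib_right mult.assoc)
    qed
  qed
  then show ?thesis by (simp add: mass_def)
qed

text \<open>
  The coefficient \<open>m\<close> for which \<open>s - m c\<close> satisfies the Neumann condition at \<open>X\<close> is bounded in \<open>X\<close>. Indeed
  \<open>Im m = y * mass (s - m c) X\<close>, and the right-hand side grows quadratically in \<open>m\<close> already on \<open>[0,X0]\<close>.
\<close>

lemma Weyl_coefficient_bounded:
  assumes y: "y > 0" and c: "eigen_system y c c1" "c 0 = 1" "c1 0 = 0"
    and s: "eigen_system y s s1" "s 0 = 0" "s1 0 = 1"
    and X0: "0 < X0" "ereal X0 < b"
  obtains B where "B > 0" "\<And>X. X0 \<le> X \<Longrightarrow> ereal X < b \<Longrightarrow> \<exists>m. cmod m \<le> B \<and> s1 X - m * c1 X = 0 \<and>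
     y * mass (\<lambda>x. s x - m * c x) X \<le> B"
proof -
  define C where "C = mass c X0"
  define S where "S = mass s X0"
  have C: "C > 0" unfolding C_def by (rule mass_pos[OF c(1) order_refl X0]) (simp add: c)
  have S: "S \<ge> 0" unfolding S_def using mass_nonneg[OF s(1) _ X0(2)] X0(1) by simp
  define B where "B = max 1 ((2 / y + 2 * S) / C)"
  have "\<exists>m. cmod m \<le> B \<and> s1 X - m * c1 X = 0 \<and> y * mass (\<lambda>x. s x - m * c x) X \<le> B" if X: "X0 \<le> X" "ereal X < b" for X
  proof -
    have "0 < X" using X X0 by simp
    have "Im (cnj (c X) * c1 X) < 0"
      using eigen_identity[OF c(1) less_imp_le[OF \<open>0 < X\<close>] X(2)] mass_pos[OF c(1) order_refl \<open>0 < X\<close> X(2)] y c by simp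
    then have nz: "c1 X \<noteq> 0" by auto
    define m where "m = s1 X / c1 X"
    have z: "s1 X - m * c1 X = 0" using nz by (simp add: m_def)
    note psi = eigen_system_diff_scale[OF s(1) c(1), of m]
    have Imm: "Im m = y * mass (\<lambda>x. s x - m * c x) X"
      using eigen_identity[OF psi less_imp_le[OF \<open>0 < X\<close>] X(2)] z c s by simp
    have "C * (cmod m)\<^sup>2 \<le> 2 * mass (\<lambda>x. s x - m * c x) X0 + 2 * S"
    proof -
      have mc: "eigen_system y (\<lambda>x. s x - (s x - m * c x)) (\<lambda>x. s1 x - (s1 x - m * c1 x))"
        using eigen_system_diff_scale[OF s(1) psi, of 1] by simp
      have "(cmod (s t - (s t - m * c t)))\<^sup>2 \<le> 2 * (cmod (s t))\<^sup>2 + 2 * (cmod (s t - m * c t))\<^sup>2" for t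
        by (rule norm_diff_square_le)
      from mass_diff_le[OF s(1) psi mc this _ X0(2)] X0(1)
      have "mass (\<lambda>x. m * c x) X0 \<le> 2 * S + 2 * mass (\<lambda>x. s x - m * c x) X0" by (simp add: S_def)
      moreover have "mass (\<lambda>x. m * c x) X0 = (cmod m)\<^sup>2 * C"
        unfolding mass_def C_def by (simp add: norm_mult power_mult_distrib mult.assoc)
      ultimately show ?thesis by (simp add: mult.commute)
    qed
    also have "mass (\<lambda>x. s x - m * c x) X0 \<le> mass (\<lambda>x. s x - m * c x) X" by (rule mass_mono[OF psi _ X]) (use X0 in simp)
    also have "mass (\<lambda>x. s x - m * c x) X \<le> cmod m / y"
      using abs_Im_le_cmod[of m] y by (simp add: Imm field_simps)
    finally have le: "C * (cmod m)\<^sup>2 \<le> 2 * (cmod m / y) + 2 * S" by simp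
    have mB: "cmod m \<le> B"
    proof (cases "cmod m \<le> 1")
      case True then show ?thesis by (simp add: B_def le_max_iff_disj)
    next
      case False
      then have "2 * S \<le> 2 * S * cmod m" using S mult_left_mono[of 1 "cmod m" "2 * S"] by simp
      with le have "(C * cmod m) * cmod m \<le> (2 / y + 2 * S) * cmod m" by (simp add: power2_eq_square algebra_simps)
      then have "C * cmod m \<le> 2 / y + 2 * S" using False by (auto simp: mult_le_cancel_right)
      then have "cmod m \<le> (2 / y + 2 * S) / C" using C by (simp add: field_simps)
      then show ?thesis by (simp add: B_def le_max_iff_disj)
    qed
    moreover have "y * mass (\<lambda>x. s x - m * c x) X \<le> B" using mB abs_Im_le_cmod[of m] Imm by linarith
    ultimately show ?thesis using z by blast
  qed
  moreover have "B > 0" by (simp add: B_def)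
  ultimately show thesis using that by blast
qed

text \<open>
  The coefficient is a limit point of the Neumann coefficients of the problems truncated at \<open>X n\<close>, where
  \<open>X n\<close> increases to \<open>b\<close>. Both the norm bound and, for integrable \<open>w\<close>, the smallness of the
  quasi-derivative near \<open>b\<close> survive the limit, so the limit point and limit circle cases need no separate
  treatment.
\<close>

lemma Weyl_solution_exists:
  assumes y: "y > 0" and c: "eigen_system y c c1" "c 0 = 1" "c1 0 = 0"
    and s: "eigen_system y s s1" "s 0 = 0" "s1 0 = 1"
  shows "\<exists>m. L2w b w (\<lambda>x. s x - m * c x) \<and> (intE w \<longrightarrow> ((\<lambda>x. s1 x - m * c1 x) \<longlongrightarrow> 0) (up_to b))"
proof -
  obtain X :: "nat \<Rightarrow> real" where X: "incseq X" "\<And>n. 0 < X n" "\<And>n. ereal (X n) < b"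
    "\<And>x. ereal x < b \<Longrightarrow> \<forall>\<^sub>F n in sequentially. x < X n" using einterval_exhaust[OF b_pos] by blast
  obtain B where B: "B > 0" "\<And>x. X 0 \<le> x \<Longrightarrow> ereal x < b \<Longrightarrow> \<exists>m. cmod m \<le> B \<and> s1 x - m * c1 x = 0 \<and>
     y * mass (\<lambda>x. s x - m * c x) x \<le> B"
    by (rule Weyl_coefficient_bounded[OF y c s X(2,3)[of 0]]) blast
  have "\<forall>n. \<exists>m. cmod m \<le> B \<and> s1 (X n) - m * c1 (X n) = 0 \<and> y * mass (\<lambda>x. s x - m * c x) (X n) \<le> B"
    using B(2) X(3) incseqD[OF X(1), of 0] by blast
  then obtain mm where mm: "\<And>n. cmod (mm n) \<le> B" "\<And>n. s1 (X n) - mm n * c1 (X n) = 0"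
    "\<And>n. y * mass (\<lambda>x. s x - mm n * c x) (X n) \<le> B" by metis
  have "seq_compact (cball (0::complex) B)" by (simp add: compact_imp_seq_compact)
  moreover have "\<forall>n. mm n \<in> cball 0 B" using mm(1) by simp
  ultimately obtain m \<rho> where m: "strict_mono (\<rho> :: nat \<Rightarrow> nat)" "(mm \<circ> \<rho>) \<longlonglongrightarrow> m"
    unfolding seq_compact_def by metis
  define a where "a n = mm (\<rho> n)" for n
  define Z where "Z n = X (\<rho> n)" for n
  have a: "a \<longlonglongrightarrow> m" using m(2) by (simp add: a_def[abs_def] o_def)
  have Zb: "ereal (Z n) < b" "0 < Z n" for n using X by (simp_all add: Z_def)
  have Z: "\<forall>\<^sub>F n in sequentially. x < Z n" if "ereal x < b" for x
    unfolding Z_def using eventually_subseq[OF m(1) X(4)[OF that]] .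
  have aB: "y * mass (\<lambda>x. s x - a n * c x) (Z n) \<le> B" and az: "s1 (Z n) - a n * c1 (Z n) = 0" for n
    using mm by (auto simp: a_def Z_def)
  note psin = eigen_system_diff_scale[OF s(1) c(1)]
  have Qle: "mass (\<lambda>x. s x - m * c x) x \<le> 2 * (B / y)" if x: "0 \<le> x" "ereal x < b" for x
  proof (rule tendsto_lowerbound)
    have "(\<lambda>n. 2 * (B / y) + 2 * (cmod (m - a n))\<^sup>2 * mass c x) \<longlonglongrightarrow> 2 * (B / y) + 2 * (cmod (m - m))\<^sup>2 * mass c x"
      by (intro tendsto_intros a)
    then show "(\<lambda>n. 2 * (B / y) + 2 * (cmod (m - a n))\<^sup>2 * mass c x) \<longlonglongrightarrow> 2 * (B / y)" by simp
    show "\<forall>\<^sub>F n in sequentially. mass (\<lambda>x. s x - m * c x) x \<le> 2 * (B / y) + 2 * (cmod (m - a n))\<^sup>2 * mass c x"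
      using Z[OF x(2)]
    proof eventually_elim
      case (elim n)
      have bd: "(cmod (s t - m * c t))\<^sup>2 \<le> 2 * (cmod (s t - a n * c t))\<^sup>2 + (2 * (cmod (m - a n))\<^sup>2) * (cmod (c t))\<^sup>2" for t
      proof -
        have eq: "s t - m * c t = (s t - a n * c t) - (m - a n) * c t" by (simp add: algebra_simps)
        show ?thesis unfolding eq using norm_diff_square_le[of "s t - a n * c t" "(m - a n) * c t"]
          by (simp only: norm_mult power_mult_distrib mult.assoc)
      qed
      have "mass (\<lambda>x. s x - a n * c x) x \<le> mass (\<lambda>x. s x - a n * c x) (Z n)"
        by (rule mass_mono[OF psin x(1) less_imp_le[OF elim] Zb(1)])
      also have "\<dots> \<le> B / y" using aB[of n] y by (simp add: field_simps)
      finally show ?case using mass_diff_le[OF psin c(1) psin bd x] by linarith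
    qed
  qed simp
  have L2: "L2w b w (\<lambda>x. s x - m * c x)"
    unfolding L2w_def
  proof
    show "set_borel_measurable lebesgue (einterval 0 b) (\<lambda>x. s x - m * c x)"
      using psin[of m] primitive_set_borel_measurable[OF b_pos] unfolding eigen_system_def by blast
    show "intE (\<lambda>x. (norm (s x - m * c x))\<^sup>2 * w x)"
    proof (rule set_integrable_einterval_bounded[OF b_pos])
      show "AE x in lebesgue. x \<in> einterval 0 b \<longrightarrow> 0 \<le> (norm (s x - m * c x))\<^sup>2 * w x"
        using w_nonneg by eventually_elim auto
    qed (use primitive_abs_int[OF primitive_mass[OF psin[of m]]] Qle in \<open>auto simp: mass_def\<close>)
  qed
  have lim: "((\<lambda>x. s1 x - m * c1 x) \<longlongrightarrow> 0) (up_to b)" if w: "intE w"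
  proof -
    define I where "I = IE w"
    have Wle: "Wp x \<le> I" if "0 \<le> x" "ereal x < b" for x
      unfolding Wp_def I_def by (rule integral_le_IE[OF w w_nonneg that])
    have Wlim: "(Wp \<longlongrightarrow> I) (up_to b)" unfolding Wp_def[abs_def] I_def by (rule tendsto_integral_up_to[OF b_pos w])
    \<comment> \<open>The truncated quasi-derivative vanishes at \<open>Z n\<close>, so it is an integral of \<open>w |s - a n c|\<close>, split by
      \<open>z \<le> 1 / (2 t) + t z\<^sup>2 / 2\<close>; the free parameter \<open>t\<close> replaces the Cauchy-Schwarz inequality.\<close>
    have bound: "cmod (s1 x - m * c1 x) \<le> y / (2 * t) * (I - Wp x) + t / 2 * B"
      if t: "t > 0" and x: "0 \<le> x" "ereal x < b" for t x
    proof (rule tendsto_upperbound)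
      show "(\<lambda>n. cmod (s1 x - a n * c1 x)) \<longlonglongrightarrow> cmod (s1 x - m * c1 x)" by (intro tendsto_intros a)
      show "\<forall>\<^sub>F n in sequentially. cmod (s1 x - a n * c1 x) \<le> y / (2 * t) * (I - Wp x) + t / 2 * B"
        using Z[OF x(2)]
      proof eventually_elim
        case (elim n)
        have g: "primitive b (\<lambda>x. s1 x - a n * c1 x) (\<lambda>x. w x *\<^sub>R (- (\<i> * y) * (s x - a n * c x)))"
          using psin unfolding eigen_system_def by auto
        have G: "primitive b (\<lambda>x. y / (2 * t) * Wp x + t / 2 * y * mass (\<lambda>x. s x - a n * c x) x)
            (\<lambda>x. y / (2 * t) * w x + t / 2 * y * ((cmod (s x - a n * c x))\<^sup>2 * w x))"
          by (intro primitive_add primitive_cmult primitive_Wp primitive_mass[OF psin])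
        have "norm ((s1 (Z n) - a n * c1 (Z n)) - (s1 x - a n * c1 x)) \<le>
          (y / (2 * t) * Wp (Z n) + t / 2 * y * mass (\<lambda>x. s x - a n * c x) (Z n)) - (y / (2 * t) * Wp x + t / 2 * y * mass (\<lambda>x. s x - a n * c x) x)"
        proof (rule primitive_norm_le[OF g G x(1) less_imp_le[OF elim] Zb(1)])
          show "AE \<tau> in lebesgue. \<tau> \<in> einterval 0 b \<longrightarrow> x \<le> \<tau> \<longrightarrow> \<tau> \<le> Z n \<longrightarrow>
            norm (w \<tau> *\<^sub>R (- (\<i> * y) * (s \<tau> - a n * c \<tau>))) \<le> y / (2 * t) * w \<tau> + t / 2 * y * ((cmod (s \<tau> - a n * c \<tau>))\<^sup>2 * w \<tau>)"
            using w_nonneg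
          proof eventually_elim
            case (elim \<tau>)
            show ?case
            proof (intro impI)
              assume "\<tau> \<in> einterval 0 b"
              then have w: "0 \<le> w \<tau>" using elim by simp
              define z where "z = cmod (s \<tau> - a n * c \<tau>)"
              have "0 \<le> (1 - t * z)\<^sup>2" by simp
              then have "2 * t * z \<le> 1 + t\<^sup>2 * z\<^sup>2" by (simp add: power2_diff power_mult_distrib)
              then have "z \<le> 1 / (2 * t) + t / 2 * z\<^sup>2" using t by (simp add: field_simps power2_eq_square)
              then have "y * w \<tau> * z \<le> y * w \<tau> * (1 / (2 * t) + t / 2 * z\<^sup>2)" using y w by (intro mult_left_mono) auto
              then show "norm (w \<tau> *\<^sub>R (- (\<i> * y) * (s \<tau> - a n * c \<tau>))) \<le> y / (2 * t) * w \<tau> + t / 2 * y * ((cmod (s \<tau> - a n * c \<tau>))\<^sup>2 * w \<tau>)"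
              proof -
                have "norm (w \<tau> *\<^sub>R (- (\<i> * y) * (s \<tau> - a n * c \<tau>))) = y * w \<tau> * z"
                  using y w by (simp add: norm_mult z_def)
                then show ?thesis using \<open>y * w \<tau> * z \<le> _\<close> by (simp add: z_def[symmetric] algebra_simps)
              qed
            qed
          qed
        qed
        also have "\<dots> \<le> y / (2 * t) * (I - Wp x) + t / 2 * B"
        proof -
          have "0 \<le> mass (\<lambda>x. s x - a n * c x) x" by (rule mass_nonneg[OF psin x])
          then have 1: "0 \<le> t / 2 * y * mass (\<lambda>x. s x - a n * c x) x" using t y by simp
          have 2: "t / 2 * y * mass (\<lambda>x. s x - a n * c x) (Z n) \<le> t / 2 * B"
            using mult_left_mono[OF aB[of n], of "t / 2"] t by (simp add: mult.assoc)
          have 3: "y / (2 * t) * Wp (Z n) \<le> y / (2 * t) * I" using Wle[of "Z n"] Zb[of n] t y by (intro mult_left_mono) auto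
          show ?thesis using 1 2 3 unfolding right_diff_distrib by linarith
        qed
        finally show ?case using az[of n] by (simp add: norm_minus_commute)
      qed
    qed simp
    show ?thesis
      unfolding tendsto_iff dist_complex_def
    proof (intro allI impI)
      fix e :: real assume e: "e > 0"
      define t where "t = e / B"
      have t: "t > 0" using e B by (simp add: t_def)
      have "((\<lambda>x. y / (2 * t) * (I - Wp x)) \<longlongrightarrow> y / (2 * t) * (I - I)) (up_to b)" by (intro tendsto_intros Wlim)
      then have "\<forall>\<^sub>F x in up_to b. y / (2 * t) * (I - Wp x) < e / 2" using e by (intro order_tendstoD(2)) auto
      with eventually_up_to_ge[OF b_pos[unfolded zero_ereal_def]]
      show "\<forall>\<^sub>F x in up_to b. cmod (s1 x - m * c1 x - 0) < e"
      proof eventually_elim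
        case (elim x)
        have "t / 2 * B = e / 2" using B(1) by (simp add: t_def)
        moreover have "cmod (s1 x - m * c1 x) \<le> y / (2 * t) * (I - Wp x) + t / 2 * B"
          by (rule bound[OF t]) (use elim in auto)
        ultimately have "cmod (s1 x - m * c1 x) < e" using elim(2) by linarith
        then show ?case by simp
      qed
    qed
  qed
  from L2 lim show ?thesis by blast
qed

text \<open>
  In the limit circle case a solution with bounded quasi-derivative is dominated by \<open>1\<close> and \<open>Rp\<close>, both of
  which are in the weighted space.
\<close>

lemma Weyl_solution_admissible:
  assumes y: "y > 0" and e: "eigen_system y f g"
    and cond: "if limit_point b w r then L2w b w f else (g \<longlongrightarrow> 0) (up_to b)"
  shows "admissible f g (\<lambda>x. - (\<i> * y) * f x)"
proof -
  have f: "primitive b f (\<lambda>x. r x *\<^sub>R g x)" and g: "primitive b g (\<lambda>x. w x *\<^sub>R (- (\<i> * y) * f x))"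
    using e unfolding eigen_system_def by auto
  have "L2w b w f"
  proof (cases "limit_point b w r")
    case True then show ?thesis using cond by simp
  next
    case False
    have lc: "intE w" "L2w b w Rp" using False limit_circle_iff by auto
    have g0: "(g \<longlongrightarrow> 0) (up_to b)" using cond False by simp
    then have "\<forall>\<^sub>F x in up_to b. dist (g x) 0 < 1" unfolding tendsto_iff by auto
    then obtain d where d: "0 \<le> d" "ereal d < b" "\<And>x. d \<le> x \<Longrightarrow> ereal x < b \<Longrightarrow> dist (g x) 0 < 1" by (rule up_toE) blast
    have "bounded (g ` {0..d})"
      by (intro compact_imp_bounded compact_continuous_image primitive_continuous[OF g order_refl d(2)]) simp
    then obtain B0 where B0: "\<And>x. x \<in> {0..d} \<Longrightarrow> cmod (g x) \<le> B0" unfolding bounded_iff by blast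
    define B where "B = max B0 1"
    have B: "cmod (g x) \<le> B" if "0 \<le> x" "ereal x < b" for x
      using B0[of x] d(3)[of x] that by (cases "x \<le> d") (auto simp: B_def le_max_iff_disj)
    have fb: "cmod (f x) \<le> cmod (f 0) + B * Rp x" if x: "0 \<le> x" "ereal x < b" for x
    proof -
      have "norm (f x - f 0) \<le> B * Rp x - B * Rp 0"
      proof (rule primitive_norm_le[OF f primitive_cmult[OF primitive_Rp] order_refl x])
        show "AE t in lebesgue. t \<in> einterval 0 b \<longrightarrow> 0 \<le> t \<longrightarrow> t \<le> x \<longrightarrow> norm (r t *\<^sub>R g t) \<le> B * r t"
          using r_nonneg
        proof eventually_elim
          case (elim t)
          show ?case
          proof (intro impI)
            assume t: "t \<in> einterval 0 b" "0 \<le> t"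
            then have "cmod (g t) * r t \<le> B * r t" using elim B[of t] by (intro mult_right_mono) (auto simp: einterval_def)
            then show "norm (r t *\<^sub>R g t) \<le> B * r t" using elim t by (simp add: mult.commute)
          qed
        qed
      qed
      moreover have "Rp 0 = 0" by (simp add: Rp_def)
      ultimately show ?thesis using norm_triangle_sub[of "f x" "f 0"] by simp
    qed
    show ?thesis
    proof (rule L2w_mono)
      show "set_borel_measurable lebesgue (einterval 0 b) f" by (rule primitive_set_borel_measurable[OF b_pos f])
      show "L2w b w (\<lambda>x. cmod (f 0) * 1 + B * Rp x)"
        by (intro L2w_add L2w_bounded_linear[OF _ bounded_linear_mult_right] L2w_one lc)
      show "norm (f x) \<le> \<bar>cmod (f 0) * 1 + B * Rp x\<bar>" if "x \<in> einterval 0 b" for x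
        using fb[of x] that by (auto simp: einterval_def)
    qed
  qed
  moreover have "L2w b w (\<lambda>x. - (\<i> * y) * f x)"
    by (rule L2w_bounded_linear[OF \<open>L2w b w f\<close> bounded_linear_mult_right])
  moreover have "(g \<longlongrightarrow> 0) (up_to b)" if "limit_circle b w r" using cond that by simp
  ultimately show ?thesis using f g unfolding admissible_def by blast
qed

lemma admissible_eigen_facts:
  assumes a: "admissible f g (\<lambda>x. - (\<i> * complex_of_real y) * f x)"
  shows "intE (\<lambda>x. (cmod (f x))\<^sup>2 * w x)"
    and "IE (\<lambda>x. r x * (cmod (g x))\<^sup>2) = - Re (cnj (f 0) * g 0)"
    and "y * IE (\<lambda>x. (cmod (f x))\<^sup>2 * w x) = Im (cnj (f 0) * g 0)"
proof -
  show "intE (\<lambda>x. (cmod (f x))\<^sup>2 * w x)" using a unfolding admissible_def L2w_def by auto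
  have re: "w x * Re (cnj (f x) * (- (\<i> * y) * f x)) = 0" for x by (simp add: algebra_simps)
  have im: "w x * Im (cnj (f x) * (- (\<i> * y) * f x)) = (- y) * ((cmod (f x))\<^sup>2 * w x)" for x
    unfolding cmod_power2 by (simp add: power2_eq_square algebra_simps)
  show "IE (\<lambda>x. r x * (cmod (g x))\<^sup>2) = - Re (cnj (f 0) * g 0)"
    using green_complex(4)[OF a] unfolding re by (simp add: set_lebesgue_integral_def)
  show "y * IE (\<lambda>x. (cmod (f x))\<^sup>2 * w x) = Im (cnj (f 0) * g 0)"
    using green_complex(5)[OF a] unfolding im set_integral_mult_right by simp
qed

lemma mass_le_IE:
  assumes e: "eigen_system y f g" and i: "intE (\<lambda>x. (cmod (f x))\<^sup>2 * w x)" and x: "0 \<le> x" "ereal x < b"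
  shows "mass f x \<le> IE (\<lambda>x. (cmod (f x))\<^sup>2 * w x)"
  unfolding mass_def
proof (rule integral_le_IE[OF i _ x])
  show "AE x in lebesgue. x \<in> einterval 0 b \<longrightarrow> 0 \<le> (cmod (f x))\<^sup>2 * w x"
    using w_nonneg by eventually_elim auto
qed

text \<open>
  Two different coefficients would make \<open>c\<close> itself satisfy the condition at \<open>b\<close>; but \<open>c\<close> has vanishing
  quasi-derivative at \<open>0\<close>, and Green's identity would force its norm to be \<open>0\<close>.
\<close>

lemma Weyl_solution_unique:
  assumes y: "y > 0" and c: "eigen_system y c c1" "c 0 = 1" "c1 0 = 0"
  shows "\<not> (if limit_point b w r then L2w b w c else (c1 \<longlongrightarrow> 0) (up_to b))"
proof
  assume "if limit_point b w r then L2w b w c else (c1 \<longlongrightarrow> 0) (up_to b)"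
  note a = Weyl_solution_admissible[OF y c(1) this]
  have "IE (\<lambda>x. (cmod (c x))\<^sup>2 * w x) = 0" using admissible_eigen_facts(3)[OF a] c y by simp
  moreover obtain x where x: "0 < x" "ereal x < b" using ereal_dense2[OF b_pos] by (auto simp: zero_ereal_def)
  have "0 < mass c x" by (rule mass_pos[OF c(1) order_refl x]) (simp add: c)
  moreover have "mass c x \<le> IE (\<lambda>x. (cmod (c x))\<^sup>2 * w x)"
    by (rule mass_le_IE[OF c(1) admissible_eigen_facts(1)[OF a]]) (use x in auto)
  ultimately show False by simp
qed

lemma Weyl_norm_pos:
  assumes e: "eigen_system y f g" and i: "intE (\<lambda>x. (cmod (f x))\<^sup>2 * w x)" and g0: "g 0 \<noteq> 0"
  shows "0 < IE (\<lambda>x. (cmod (f x))\<^sup>2 * w x)"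
proof -
  have f: "primitive b f (\<lambda>x. r x *\<^sub>R g x)" and g: "primitive b g (\<lambda>x. w x *\<^sub>R (- (\<i> * y) * f x))"
    using e unfolding eigen_system_def by auto
  have "\<exists>x0\<ge>0. ereal x0 < b \<and> f x0 \<noteq> 0"
  proof (rule ccontr)
    assume "\<not> ?thesis"
    then have z: "f x = 0" if "0 \<le> x" "ereal x < b" for x using that by blast
    have gc: "g x = g 0" if x: "0 \<le> x" "ereal x < b" for x
    proof -
      have "integral {0..x} (\<lambda>x. w x *\<^sub>R (- (\<i> * y) * f x)) = integral {0..x} (\<lambda>x. 0)"
      proof (rule integral_cong)
        fix t assume "t \<in> {0..x}"
        then have "f t = 0" using x(2) by (intro z) (auto intro: le_less_trans[of _ "ereal x"])
        then show "w t *\<^sub>R (- (\<i> * y) * f t) = 0" by simp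
      qed
      then show ?thesis using primitive_diff_eq[OF g order_refl x] by simp
    qed
    obtain x where x: "0 < x" "ereal x < b" using ereal_dense2[OF b_pos] by (auto simp: zero_ereal_def)
    have "integral {0..x} (\<lambda>t. r t *\<^sub>R g t) = integral {0..x} (\<lambda>t. r t *\<^sub>R g 0)"
    proof (rule integral_cong)
      fix t assume "t \<in> {0..x}"
      then have "0 \<le> t" "ereal t < b" using x(2) by (auto intro: le_less_trans[of _ "ereal x"])
      then show "r t *\<^sub>R g t = r t *\<^sub>R g 0" using gc by simp
    qed
    also have "\<dots> = Rp x *\<^sub>R g 0"
      using integral_linear[OF primitive_integrable[OF primitive_Rp order_refl x(2)] bounded_linear_scaleR_left[of "g 0"]]
      by (simp add: o_def Rp_def)
    finally have "f x - f 0 = Rp x *\<^sub>R g 0" using primitive_diff_eq[OF f order_refl _ x(2)] x(1) by simp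
    moreover have "Rp 0 < Rp x" by (rule primitive_strict_mono[OF primitive_Rp r_pos order_refl x])
    moreover have "Rp 0 = 0" by (simp add: Rp_def)
    ultimately show False using z[of x] z[of 0] x g0 b_pos by (simp add: zero_ereal_def)
  qed
  then obtain x0 where x0: "0 \<le> x0" "ereal x0 < b" "f x0 \<noteq> 0" by blast
  obtain x where x: "x0 < x" "ereal x < b" using ereal_dense2[OF x0(2)] by auto
  have "0 < mass f x" by (rule mass_pos[OF e x0(1) x x0(3)])
  also have "mass f x \<le> IE (\<lambda>x. (cmod (f x))\<^sup>2 * w x)" by (rule mass_le_IE[OF e i]) (use x x0 in auto)
  finally show ?thesis .
qed

end

section \<open>Quasi-derivatives and the operator domain\<close>

lemma AC_on_imp_continuous_on:
  assumes AC: "AC_on {a..b} f" shows "continuous_on {a..b} f"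
  unfolding continuous_on_iff
proof (intro ballI allI impI)
  fix x e :: real assume x: "x \<in> {a..b}" and e: "0 < e"
  from AC[unfolded AC_on_def, rule_format, OF e] obtain d where d: "d > 0"
    "\<And>D. D division_of \<Union>D \<and> \<Union>D \<subseteq> {a..b} \<and> (\<Sum>k\<in>D. Sup k - Inf k) < d \<Longrightarrow>
       (\<Sum>k\<in>D. cmod (f (Sup k) - f (Inf k))) < e" by blast
  have D: "cmod (f v - f u) < e" if "u \<in> {a..b}" "v \<in> {a..b}" "u \<le> v" "v - u < d" for u v
  proof -
    have "{cbox u v} division_of cbox u v" by (rule division_of_self) (use that in auto)
    then show ?thesis using d(2)[of "{{u..v}}"] that by auto
  qed
  show "\<exists>d>0. \<forall>x'\<in>{a..b}. dist x' x < d \<longrightarrow> dist (f x') (f x) < e"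
  proof (intro exI[of _ d] conjI d(1) ballI impI)
    fix x' assume x': "x' \<in> {a..b}" "dist x' x < d"
    show "dist (f x') (f x) < e"
    proof (cases "x \<le> x'")
      case True then show ?thesis using D[OF x x'(1)] x'(2) by (simp add: dist_norm)
    next
      case False then show ?thesis using D[OF x'(1) x] x'(2) by (simp add: dist_norm norm_minus_commute)
    qed
  qed
qed

lemma AC_loc_continuous_on:
  assumes "AC_loc b f" "ereal c < b" shows "continuous_on {0..c} f"
proof (cases "0 \<le> c")
  case True
  then have "AC_on {0..c} f" using assms unfolding AC_loc_def by blast
  then show ?thesis by (rule AC_on_imp_continuous_on)
qed simp

lemma continuous_ae_eq_imp_eq:
  fixes f g :: "real \<Rightarrow> 'a::real_normed_vector"
  assumes f: "\<And>c. ereal c < b \<Longrightarrow> continuous_on {0..c} f" and g: "\<And>c. ereal c < b \<Longrightarrow> continuous_on {0..c} g"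
    and ae: "AE t in lebesgue. t \<in> einterval 0 b \<longrightarrow> f t = g t"
    and x: "0 \<le> x" "ereal x < b"
  shows "f x = g x"
proof (rule ccontr)
  assume neq: "f x \<noteq> g x"
  obtain c where c: "x < c" "ereal c < b" using ereal_dense2[OF x(2)] by auto
  have "continuous_on {0..c} (\<lambda>t. f t - g t)" by (intro continuous_on_diff f g c)
  moreover have "x \<in> {0..c}" "0 < norm (f x - g x)" using x c neq by auto
  ultimately obtain d where d: "d > 0" "\<And>t. t \<in> {0..c} \<Longrightarrow> dist t x < d \<Longrightarrow> dist (f t - g t) (f x - g x) < norm (f x - g x)"
    unfolding continuous_on_iff by blast
  obtain N where N: "negligible N" "{t. \<not> (t \<in> einterval 0 b \<longrightarrow> f t = g t)} \<subseteq> N"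
    using ae unfolding eventually_ae_filter_negligible by blast
  have "{x<..<min c (x + d)} \<subseteq> N"
  proof
    fix t assume t: "t \<in> {x<..<min c (x + d)}"
    then have "dist (f t - g t) (f x - g x) < norm (f x - g x)" using x by (intro d(2)) (auto simp: dist_real_def)
    then have "f t \<noteq> g t" by (auto simp: dist_norm norm_minus_commute)
    moreover have "t \<in> einterval 0 b" using t x c by (auto simp: einterval_def intro: less_trans[of "ereal t" "ereal c"])
    ultimately show "t \<in> N" using N(2) by blast
  qed
  with N(1) have "negligible {x<..<min c (x + d)}" by (rule negligible_subset)
  then show False using open_not_negligible[of "{x<..<min c (x + d)}"] c d(1) by auto
qed

lemma primitive_cong:
  assumes F: "primitive b F \<phi>" and eq: "\<And>x. 0 \<le> x \<Longrightarrow> ereal x < b \<Longrightarrow> F x = G x"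
  shows "primitive b G \<phi>"
  unfolding primitive_def
proof (intro allI impI conjI)
  fix x :: real assume x: "0 \<le> x" "ereal x < b"
  then have "ereal 0 < b \<or> ereal 0 = ereal x" by (auto intro: le_less_trans[of _ "ereal x"])
  then have 0: "ereal 0 < b" using x by auto
  show "\<phi> absolutely_integrable_on {0..x}" "G x = G 0 + integral {0..x} \<phi>"
    using F x eq[OF x] eq[OF order_refl 0] unfolding primitive_def by auto
qed

text \<open>
  For positive \<open>N\<close> and \<open>H\<close> the optimal choice is \<open>y = sqrt (H / N)\<close>; if one of them vanishes, suitable
  \<open>y\<close> show that \<open>D = 0\<close>.
\<close>

lemma square_le_of_scaled_bound:
  fixes D N H C :: real
  assumes nn: "0 \<le> D" "0 \<le> N" "0 \<le> H" "0 < C" and le: "\<And>y. 0 < y \<Longrightarrow> D \<le> C * (H / y + y * N)"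
  shows "D\<^sup>2 \<le> (2 * C)\<^sup>2 * N * H"
proof (cases "N = 0 \<or> H = 0")
  case True
  have "D = 0"
  proof (rule ccontr)
    assume "D \<noteq> 0"
    then have D: "D > 0" using nn by simp
    consider "N = 0" "H = 0" | "N = 0" "H > 0" | "H = 0" "N > 0" using True nn by force
    then show False
    proof cases
      case 1 then show ?thesis using le[of 1] D by simp
    next
      case 2
      have "0 < 2 * C * H / D" using 2 nn D by simp
      from le[OF this] show ?thesis using 2 nn D by (simp add: field_simps)
    next
      case 3
      have "0 < D / (2 * C * N)" using 3 nn D by simp
      from le[OF this] show ?thesis using 3 nn D by (simp add: field_simps)
    qed
  qed
  then show ?thesis using True by auto
next
  case False
  then have pos: "N > 0" "H > 0" using nn by auto
  define y where "y = sqrt H / sqrt N"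
  have y: "y > 0" using pos by (simp add: y_def)
  have "H / y = sqrt H * sqrt N" using pos by (simp add: y_def field_simps)
  moreover have "y * N = sqrt H * sqrt N" using pos by (simp add: y_def field_simps)
  ultimately have "D \<le> 2 * C * (sqrt H * sqrt N)" using le[OF y] by simp
  then have "D\<^sup>2 \<le> (2 * C * (sqrt H * sqrt N))\<^sup>2" using nn by (intro power_mono) auto
  then show ?thesis using pos by (simp add: power_mult_distrib mult_ac)
qed

context sturm_liouville
begin

lemma nn_IE:
  assumes i: "intE \<phi>" and nn: "AE x in lebesgue. x \<in> einterval 0 b \<longrightarrow> 0 \<le> \<phi> x"
  shows "(\<integral>\<^sup>+x\<in>einterval 0 b. ennreal (\<phi> x) \<partial>lebesgue) = ennreal (IE \<phi>)" and "0 \<le> IE \<phi>"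
proof -
  have nn': "AE x in lebesgue. 0 \<le> indicator (einterval 0 b) x *\<^sub>R \<phi> x"
    using nn by eventually_elim (auto simp: indicator_def)
  have "(\<integral>\<^sup>+x\<in>einterval 0 b. ennreal (\<phi> x) \<partial>lebesgue) = (\<integral>\<^sup>+x. ennreal (indicator (einterval 0 b) x *\<^sub>R \<phi> x) \<partial>lebesgue)"
    by (rule nn_integral_cong) (auto simp: indicator_def)
  also have "\<dots> = ennreal (IE \<phi>)"
    unfolding set_lebesgue_integral_def using i nn' by (intro nn_integral_eq_integral) (auto simp: set_integrable_def)
  finally show "(\<integral>\<^sup>+x\<in>einterval 0 b. ennreal (\<phi> x) \<partial>lebesgue) = ennreal (IE \<phi>)" .
  show "0 \<le> IE \<phi>" unfolding set_lebesgue_integral_def by (rule integral_nonneg_AE[OF nn'])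
qed

lemma IE_mono:
  fixes \<phi> \<gamma> :: "real \<Rightarrow> real"
  assumes "intE \<phi>" "intE \<gamma>" "AE x in lebesgue. x \<in> einterval 0 b \<longrightarrow> \<phi> x \<le> \<gamma> x"
  shows "IE \<phi> \<le> IE \<gamma>"
  by (rule set_integral_mono_AE) (use assms in auto)

lemma quasi_deriv_is_quasi_deriv:
  "is_quasi_deriv b r f g \<Longrightarrow> is_quasi_deriv b r f (quasi_deriv b r f)"
  unfolding quasi_deriv_def by (rule someI[of "is_quasi_deriv b r f"])

lemma weight_times_continuous:
  fixes g :: "real \<Rightarrow> complex"
  assumes "continuous_on {0..c} g" "v absolutely_integrable_on {0..c}"
  shows "(\<lambda>x. v x *\<^sub>R g x) absolutely_integrable_on {0..c}"
  using absolutely_integrable_mult_continuous[OF assms(1) absolutely_integrable_linear[OF assms(2) bounded_linear_of_real]]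
  by (simp add: o_def scaleR_conv_of_real mult.commute)

lemma is_quasi_deriv_imp_primitive:
  assumes f: "AC_loc b f" and g: "is_quasi_deriv b r f g"
  shows "primitive b f (\<lambda>x. r x *\<^sub>R g x)"
proof (rule primitiveI_AC_loc[OF f])
  show "AE x in lebesgue. x \<in> einterval 0 b \<longrightarrow> (f has_vector_derivative r x *\<^sub>R g x) (at x)"
    using g unfolding is_quasi_deriv_def by (simp add: scaleR_conv_of_real)
  show "(\<lambda>x. r x *\<^sub>R g x) absolutely_integrable_on {0..c}" if "0 \<le> c" "ereal c < b" for c
    using g that unfolding is_quasi_deriv_def by (intro weight_times_continuous AC_loc_continuous_on r_abs) auto
qed

lemma primitive_imp_is_quasi_deriv:
  assumes f: "primitive b f (\<lambda>x. r x *\<^sub>R g x)" and g: "primitive b g \<gamma>"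
  shows "is_quasi_deriv b r f g"
  using primitive_AC_loc[OF g] primitive_has_vector_derivative_ae[OF f]
  unfolding is_quasi_deriv_def by (simp add: scaleR_conv_of_real)

lemma quasi_deriv_eq:
  assumes f: "primitive b f (\<lambda>x. r x *\<^sub>R g x)" and g: "primitive b g \<gamma>" and x: "0 \<le> x" "ereal x < b"
  shows "quasi_deriv b r f x = g x"
proof -
  have q: "is_quasi_deriv b r f g" by (rule primitive_imp_is_quasi_deriv[OF f g])
  have q': "is_quasi_deriv b r f (quasi_deriv b r f)" by (rule quasi_deriv_is_quasi_deriv[OF q])
  show ?thesis
  proof (rule continuous_ae_eq_imp_eq[OF _ _ _ x])
    show "continuous_on {0..c} (quasi_deriv b r f)" "continuous_on {0..c} g" if "ereal c < b" for c
      using q q' that unfolding is_quasi_deriv_def by (auto intro: AC_loc_continuous_on)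
    show "AE t in lebesgue. t \<in> einterval 0 b \<longrightarrow> quasi_deriv b r f t = g t"
      using q[unfolded is_quasi_deriv_def, THEN conjunct2] q'[unfolded is_quasi_deriv_def, THEN conjunct2] r_pos
    proof eventually_elim
      case (elim t)
      show ?case
      proof
        assume t: "t \<in> einterval 0 b"
        then have "of_real (r t) * g t = of_real (r t) * quasi_deriv b r f t"
          using elim vector_derivative_unique_at by blast
        then show "quasi_deriv b r f t = g t" using elim t by auto
      qed
    qed
  qed
qed

lemma primitive_quasi_deriv:
  assumes f: "primitive b f (\<lambda>x. r x *\<^sub>R g x)" and g: "primitive b g \<gamma>"
  shows "primitive b (quasi_deriv b r f) \<gamma>"
  by (rule primitive_cong[OF g]) (rule quasi_deriv_eq[OF f g, symmetric])

lemma neumann_at_b_iff: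
  assumes f: "primitive b f (\<lambda>x. r x *\<^sub>R g x)" and g: "primitive b g \<gamma>"
  shows "neumann_at_b b r f \<longleftrightarrow> (g \<longlongrightarrow> 0) (up_to b)"
  unfolding neumann_at_b_def tendsto_up_to_iff
proof (rule tendsto_cong)
  show "\<forall>\<^sub>F x in up_to b. quasi_deriv b r f x = g x"
    using eventually_up_to_ge[OF b_pos[unfolded zero_ereal_def]]
    by eventually_elim (auto intro: quasi_deriv_eq[OF f g])
qed

lemma L2w_times_weight:
  fixes h :: "real \<Rightarrow> complex"
  assumes h: "L2w b w h" and c: "0 \<le> c" "ereal c < b"
  shows "(\<lambda>x. w x *\<^sub>R h x) absolutely_integrable_on {0..c}"
proof -
  have sub: "{0<..c} \<subseteq> einterval 0 b" using c by (auto simp: einterval_def intro: le_less_trans[of _ "ereal c"])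
  have "(\<lambda>x. w x *\<^sub>R h x) absolutely_integrable_on {0<..c}"
  proof (rule set_integrable_bound)
    have "w absolutely_integrable_on {0<..c}" by (rule set_integrable_subset[OF w_abs[OF c]]) auto
    moreover have "(\<lambda>x. (norm (h x))\<^sup>2 * w x) absolutely_integrable_on {0<..c}"
      by (rule set_integrable_subset[OF _ _ sub]) (use h in \<open>auto simp: L2w_def\<close>)
    ultimately show "(\<lambda>x. w x + (norm (h x))\<^sup>2 * w x) absolutely_integrable_on {0<..c}" by (rule set_integral_add(1))
    have wm: "set_borel_measurable lebesgue {0<..c} w" and hm: "set_borel_measurable lebesgue {0<..c} h"
      using w_meas h sub unfolding L2w_def by (auto intro: set_borel_measurable_subset)
    have "(\<lambda>x. (indicator {0<..c} x *\<^sub>R w x) *\<^sub>R (indicator {0<..c} x *\<^sub>R h x)) \<in> borel_measurable lebesgue"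
      using wm hm unfolding set_borel_measurable_def by (rule borel_measurable_scaleR)
    moreover have "(indicator {0<..c} x *\<^sub>R w x) *\<^sub>R (indicator {0<..c} x *\<^sub>R h x) = indicator {0<..c} x *\<^sub>R (w x *\<^sub>R h x)" for x
      by (auto simp: indicator_def)
    ultimately show "set_borel_measurable lebesgue {0<..c} (\<lambda>x. w x *\<^sub>R h x)"
      unfolding set_borel_measurable_def by (simp only:)
    show "AE x in lebesgue. x \<in> {0<..c} \<longrightarrow> norm (w x *\<^sub>R h x) \<le> norm (w x + (norm (h x))\<^sup>2 * w x)"
      using w_nonneg
    proof eventually_elim
      case (elim x)
      show ?case
      proof
        assume "x \<in> {0<..c}"
        then have w: "0 \<le> w x" using elim sub by blast
        have "0 \<le> (norm (h x) - 1)\<^sup>2" by simp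
        then have "2 * norm (h x) \<le> (norm (h x))\<^sup>2 + 1" by (simp add: power2_diff)
        then have "norm (h x) \<le> 1 + (norm (h x))\<^sup>2" using norm_ge_zero[of "h x"] by linarith
        then have "w x * norm (h x) \<le> w x * (1 + (norm (h x))\<^sup>2)" using w by (rule mult_left_mono)
        then show "norm (w x *\<^sub>R h x) \<le> norm (w x + (norm (h x))\<^sup>2 * w x)" using w by (simp add: algebra_simps)
      qed
    qed
  qed
  then show ?thesis
    by (rule absolutely_integrable_spike_set) (auto intro: negligible_subset[of "{0}"])
qed

lemma dom_A_plus_imp_admissible:
  assumes f: "f \<in> dom_A_plus b w r"
  obtains h where "admissible f (quasi_deriv b r f) h"
proof -
  let ?g = "quasi_deriv b r f"
  have L: "L2w b w f" and AC: "AC_loc b f" and ex: "\<exists>g. is_quasi_deriv b r f g"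
    and nb: "limit_circle b w r \<longrightarrow> neumann_at_b b r f"
    using f unfolding dom_A_plus_def AC_quasi_def by auto
  obtain h where h: "L2w b w h" "AE x in lebesgue. x \<in> einterval 0 b \<longrightarrow> (?g has_vector_derivative of_real (w x) * h x) (at x)"
    using f unfolding dom_A_plus_def by auto
  have q: "is_quasi_deriv b r f ?g" using ex quasi_deriv_is_quasi_deriv by blast
  have pf: "primitive b f (\<lambda>x. r x *\<^sub>R ?g x)" by (rule is_quasi_deriv_imp_primitive[OF AC q])
  have pg: "primitive b ?g (\<lambda>x. w x *\<^sub>R h x)"
  proof (rule primitiveI_AC_loc)
    show "AC_loc b ?g" using q unfolding is_quasi_deriv_def by auto
  qed (use h L2w_times_weight in \<open>auto simp: scaleR_conv_of_real\<close>)
  show thesis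
    by (rule that[of h]) (use pf pg L h(1) nb neumann_at_b_iff[OF pf pg] in \<open>auto simp: admissible_def\<close>)
qed

lemma admissible_imp_dom_A_plus:
  assumes a: "admissible f g h" shows "f \<in> dom_A_plus b w r"
proof -
  have f: "primitive b f (\<lambda>x. r x *\<^sub>R g x)" and g: "primitive b g (\<lambda>x. w x *\<^sub>R h x)"
    and L: "L2w b w f" "L2w b w h" and lim: "limit_circle b w r \<Longrightarrow> (g \<longlongrightarrow> 0) (up_to b)"
    using a unfolding admissible_def by auto
  have "AE x in lebesgue. x \<in> einterval 0 b \<longrightarrow> (quasi_deriv b r f has_vector_derivative of_real (w x) * h x) (at x)"
    using primitive_has_vector_derivative_ae[OF primitive_quasi_deriv[OF f g]] by (simp add: scaleR_conv_of_real)
  then show ?thesis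
    using L lim primitive_AC_loc[OF f] primitive_imp_is_quasi_deriv[OF f g] neumann_at_b_iff[OF f g]
    unfolding dom_A_plus_def AC_quasi_def by blast
qed

lemma eigen_system_imp_is_solution:
  assumes "eigen_system y f g" shows "is_solution b w r (\<i> * of_real y) f"
proof -
  have f: "primitive b f (\<lambda>x. r x *\<^sub>R g x)" and g: "primitive b g (\<lambda>x. w x *\<^sub>R (- (\<i> * y) * f x))"
    using assms unfolding eigen_system_def by auto
  have eq: "w x *\<^sub>R (- (\<i> * y) * f x) = - (\<i> * of_real y * of_real (w x) * f x)" for x
    by (simp add: scaleR_conv_of_real)
  show ?thesis
    using primitive_AC_loc[OF f] primitive_imp_is_quasi_deriv[OF f g]
      primitive_has_vector_derivative_ae[OF primitive_quasi_deriv[OF f g]]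
    unfolding is_solution_def AC_quasi_def eq by blast
qed

lemma is_solution_imp_eigen_system:
  assumes "is_solution b w r (\<i> * of_real y) f" shows "eigen_system y f (quasi_deriv b r f)"
proof -
  let ?g = "quasi_deriv b r f"
  have AC: "AC_loc b f" and ex: "\<exists>g. is_quasi_deriv b r f g"
    and d: "AE x in lebesgue. x \<in> einterval 0 b \<longrightarrow> (?g has_vector_derivative - (\<i> * of_real y * of_real (w x) * f x)) (at x)"
    using assms unfolding is_solution_def AC_quasi_def by auto
  have eq: "w x *\<^sub>R (- (\<i> * y) * f x) = - (\<i> * of_real y * of_real (w x) * f x)" for x
    by (simp add: scaleR_conv_of_real)
  have q: "is_quasi_deriv b r f ?g" using ex quasi_deriv_is_quasi_deriv by blast
  have pf: "primitive b f (\<lambda>x. r x *\<^sub>R ?g x)" by (rule is_quasi_deriv_imp_primitive[OF AC q])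
  have "primitive b ?g (\<lambda>x. w x *\<^sub>R (- (\<i> * y) * f x))"
  proof (rule primitiveI_AC_loc)
    show "AC_loc b ?g" using q unfolding is_quasi_deriv_def by auto
    show "(\<lambda>x. w x *\<^sub>R (- (\<i> * y) * f x)) absolutely_integrable_on {0..c}" if "0 \<le> c" "ereal c < b" for c
      by (intro weight_times_continuous continuous_on_mult_left AC_loc_continuous_on[OF AC] w_abs that)
    show "AE x in lebesgue. x \<in> einterval 0 b \<longrightarrow> (?g has_vector_derivative w x *\<^sub>R (- (\<i> * y) * f x)) (at x)"
      unfolding eq by (rule d)
  qed
  then show ?thesis using pf unfolding eigen_system_def by blast
qed

lemma ivp_solution_eigen_system:
  fixes y :: real and \<alpha> \<beta> :: complex
  defines "f \<equiv> ivp_solution b w r (\<i> * of_real y) \<alpha> \<beta>"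
  shows "eigen_system y f (quasi_deriv b r f)" "f 0 = \<alpha>" "quasi_deriv b r f 0 = \<beta>"
proof -
  have R: "(\<lambda>x. complex_of_real (r x)) absolutely_integrable_on {0..c}" if "0 \<le> c" "ereal c < b" for c
    using absolutely_integrable_linear[OF r_abs[OF that] bounded_linear_of_real] by (simp add: o_def)
  have W: "(\<lambda>x. - (\<i> * y) * complex_of_real (w x)) absolutely_integrable_on {0..c}" if "0 \<le> c" "ereal c < b" for c
    using absolutely_integrable_linear[OF absolutely_integrable_linear[OF w_abs[OF that] bounded_linear_of_real]
        bounded_linear_mult_right[of "- (\<i> * y)"]] by (simp add: o_def)
  obtain u v where uv: "primitive b u (\<lambda>x. of_real (r x) * v x)" "primitive b v (\<lambda>x. - (\<i> * y) * of_real (w x) * u x)"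
    "u 0 = \<alpha>" "v 0 = \<beta>"
    by (rule linear_system_solution_exists[OF R W])
  have eq: "- (\<i> * y) * of_real (w x) * u x = w x *\<^sub>R (- (\<i> * y) * u x)" for x
    by (simp add: scaleR_conv_of_real)
  have e: "eigen_system y u v"
    using uv(1,2) unfolding eigen_system_def eq by (simp add: scaleR_conv_of_real)
  have "quasi_deriv b r u 0 = v 0"
    by (rule quasi_deriv_eq) (use e b_pos in \<open>auto simp: eigen_system_def zero_ereal_def\<close>)
  then have "is_solution b w r (\<i> * of_real y) u \<and> u 0 = \<alpha> \<and> quasi_deriv b r u 0 = \<beta>"
    using eigen_system_imp_is_solution[OF e] uv by simp
  then have "is_solution b w r (\<i> * of_real y) f \<and> f 0 = \<alpha> \<and> quasi_deriv b r f 0 = \<beta>"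
    unfolding f_def ivp_solution_def
    by (rule someI[where P = "\<lambda>f. is_solution b w r (\<i> * of_real y) f \<and> f 0 = \<alpha> \<and> quasi_deriv b r f 0 = \<beta>"])
  then show "eigen_system y f (quasi_deriv b r f)" "f 0 = \<alpha>" "quasi_deriv b r f 0 = \<beta>"
    using is_solution_imp_eigen_system by auto
qed

lemma neumann_m_solution:
  assumes y: "y > 0"
  obtains \<psi> \<psi>1 where "eigen_system y \<psi> \<psi>1" "\<psi> 0 = - neumann_m b w r (\<i> * of_real y)" "\<psi>1 0 = 1"
    "admissible \<psi> \<psi>1 (\<lambda>x. - (\<i> * of_real y) * \<psi> x)"
proof -
  define c where "c = sol_c b w r (\<i> * of_real y)"
  define s where "s = sol_s b w r (\<i> * of_real y)"
  define c1 where "c1 = quasi_deriv b r c"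
  define s1 where "s1 = quasi_deriv b r s"
  have c: "eigen_system y c c1" "c 0 = 1" "c1 0 = 0"
    unfolding c_def c1_def sol_c_def by (rule ivp_solution_eigen_system)+
  have s: "eigen_system y s s1" "s 0 = 0" "s1 0 = 1"
    unfolding s_def s1_def sol_s_def by (rule ivp_solution_eigen_system)+
  note psi = eigen_system_diff_scale[OF s(1) c(1)]
  define P where "P f f1 \<longleftrightarrow> (if limit_point b w r then L2w b w f else (f1 \<longlongrightarrow> 0) (up_to b))" for f f1 :: "real \<Rightarrow> complex"
  have cond: "(let \<psi> = (\<lambda>x. s x - m * c x) in if limit_point b w r then L2w b w \<psi> else neumann_at_b b r \<psi>)
      \<longleftrightarrow> P (\<lambda>x. s x - m * c x) (\<lambda>x. s1 x - m * c1 x)" for m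
    using neumann_at_b_iff[of "\<lambda>x. s x - m * c x" "\<lambda>x. s1 x - m * c1 x"] psi[of m]
    unfolding P_def eigen_system_def Let_def by auto
  obtain m where m: "P (\<lambda>x. s x - m * c x) (\<lambda>x. s1 x - m * c1 x)"
  proof -
    obtain m where "L2w b w (\<lambda>x. s x - m * c x)" "intE w \<longrightarrow> ((\<lambda>x. s1 x - m * c1 x) \<longlongrightarrow> 0) (up_to b)"
      using Weyl_solution_exists[OF y c s] by blast
    then show thesis using that[of m] limit_circle_iff unfolding P_def by simp
  qed
  have uniq: "m' = m" if m': "P (\<lambda>x. s x - m' * c x) (\<lambda>x. s1 x - m' * c1 x)" for m'
  proof (rule ccontr)
    assume neq: "m' \<noteq> m"
    have e: "c x = (1 / (m' - m)) * ((s x - m * c x) + (- 1) * (s x - m' * c x))"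
      "c1 x = (1 / (m' - m)) * ((s1 x - m * c1 x) + (- 1) * (s1 x - m' * c1 x))" for x
      using neq by (simp_all add: field_simps)
    have "P c c1"
    proof (cases "limit_point b w r")
      case True
      have "L2w b w (\<lambda>x. (1 / (m' - m)) * ((s x - m * c x) + (- 1) * (s x - m' * c x)))"
        by (intro L2w_bounded_linear[OF _ bounded_linear_mult_right] L2w_add) (use m m' True in \<open>auto simp: P_def\<close>)
      then show ?thesis using True e(1) unfolding P_def by simp
    next
      case False
      have "((\<lambda>x. (1 / (m' - m)) * ((s1 x - m * c1 x) + (- 1) * (s1 x - m' * c1 x))) \<longlongrightarrow> (1 / (m' - m)) * (0 + (- 1) * 0)) (up_to b)"
        by (intro tendsto_mult tendsto_add tendsto_const) (use m m' False in \<open>auto simp: P_def\<close>)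
      then show ?thesis using False e(2) unfolding P_def by simp
    qed
    then show False using Weyl_solution_unique[OF y c] unfolding P_def by blast
  qed
  have "neumann_m b w r (\<i> * of_real y) = m"
    unfolding neumann_m_def c_def[symmetric] s_def[symmetric] cond
  proof (rule the_equality)
    show "P (\<lambda>x. s x - m * c x) (\<lambda>x. s1 x - m * c1 x)" by (rule m)
  qed (rule uniq)
  then show thesis
    using that[OF psi[of m]] Weyl_solution_admissible[OF y psi[of m] m[unfolded P_def]] c s by simp
qed


section \<open>The inequality and the m-function\<close>

lemma neumann_m_values:
  assumes y: "y > 0" and e: "eigen_system y \<psi> \<psi>1" "\<psi> 0 = - m" "\<psi>1 0 = 1"
    and a: "admissible \<psi> \<psi>1 (\<lambda>x. - (\<i> * of_real y) * \<psi> x)"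
  shows "IE (\<lambda>x. r x * (cmod (\<psi>1 x))\<^sup>2) = Re m" "y * IE (\<lambda>x. (cmod (\<psi> x))\<^sup>2 * w x) = Im m"
    "0 < Im m" "0 \<le> Re m"
proof -
  show D: "IE (\<lambda>x. r x * (cmod (\<psi>1 x))\<^sup>2) = Re m" and N: "y * IE (\<lambda>x. (cmod (\<psi> x))\<^sup>2 * w x) = Im m"
    using admissible_eigen_facts(2,3)[OF a] e by simp_all
  show "0 < Im m" using N Weyl_norm_pos[OF e(1) admissible_eigen_facts(1)[OF a]] e(3) y
    by (metis mult_pos_pos zero_neq_one)
  show "0 \<le> Re m" unfolding D[symmetric]
    by (rule nn_IE(2)[OF green_complex(1)[OF a]]) (use r_nonneg in eventually_elim; simp)
qed

lemma ratio_le_of_inequality: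
  assumes K: "K > 0"
    and ineq: "\<And>f g h :: real \<Rightarrow> complex. admissible f g h \<Longrightarrow>
      (IE (\<lambda>x. r x * (cmod (g x))\<^sup>2))\<^sup>2 \<le> K\<^sup>2 * IE (\<lambda>x. (cmod (f x))\<^sup>2 * w x) * IE (\<lambda>x. (cmod (h x))\<^sup>2 * w x)"
    and y: "y > 0"
  shows "Re (neumann_m b w r (\<i> * of_real y)) / Im (neumann_m b w r (\<i> * of_real y)) \<le> K"
proof -
  define m where "m = neumann_m b w r (\<i> * of_real y)"
  obtain \<psi> \<psi>1 where e: "eigen_system y \<psi> \<psi>1" "\<psi> 0 = - m" "\<psi>1 0 = 1"
    and a: "admissible \<psi> \<psi>1 (\<lambda>x. - (\<i> * of_real y) * \<psi> x)"
    unfolding m_def by (rule neumann_m_solution[OF y])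
  note v = neumann_m_values[OF y e a]
  have eq: "(cmod (- (\<i> * of_real y) * \<psi> x))\<^sup>2 * w x = y\<^sup>2 * ((cmod (\<psi> x))\<^sup>2 * w x)" for x
    by (simp add: norm_mult power_mult_distrib)
  have "(Re m)\<^sup>2 \<le> K\<^sup>2 * IE (\<lambda>x. (cmod (\<psi> x))\<^sup>2 * w x) * (y\<^sup>2 * IE (\<lambda>x. (cmod (\<psi> x))\<^sup>2 * w x))"
    using ineq[OF a] unfolding eq v(1) set_integral_mult_right .
  also have "\<dots> = (K * Im m)\<^sup>2" unfolding v(2)[symmetric] by (simp add: power2_eq_square mult_ac)
  finally have "Re m \<le> K * Im m" by (rule power2_le_imp_le) (use K v(3) in simp)
  then show ?thesis unfolding m_def[symmetric] using v(3) by (simp add: field_simps)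
qed

lemma IE_norm_add_le:
  fixes f g :: "real \<Rightarrow> complex"
  assumes L: "L2w b w f" "L2w b w g"
  shows "IE (\<lambda>x. (cmod (f x + g x))\<^sup>2 * w x) \<le> 2 * IE (\<lambda>x. (cmod (f x))\<^sup>2 * w x) + 2 * IE (\<lambda>x. (cmod (g x))\<^sup>2 * w x)"
proof -
  note i = intE_cmult[OF norm_square_L2w[OF L(1)], of 2] intE_cmult[OF norm_square_L2w[OF L(2)], of 2]
  have "IE (\<lambda>x. (cmod (f x + g x))\<^sup>2 * w x) \<le> IE (\<lambda>x. 2 * ((cmod (f x))\<^sup>2 * w x) + 2 * ((cmod (g x))\<^sup>2 * w x))"
  proof (rule IE_mono[OF norm_square_L2w[OF L2w_add[OF L]] set_integral_add(1)[OF i]])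
    show "AE x in lebesgue. x \<in> einterval 0 b \<longrightarrow> (cmod (f x + g x))\<^sup>2 * w x \<le> 2 * ((cmod (f x))\<^sup>2 * w x) + 2 * ((cmod (g x))\<^sup>2 * w x)"
      using w_nonneg
    proof eventually_elim
      case (elim x)
      show ?case using mult_right_mono[OF norm_diff_square_le[of "f x" "- g x"], of "w x"] elim
        by (auto simp: distrib_right mult.assoc)
    qed
  qed
  then show ?thesis using set_integral_add(2)[OF i] by simp
qed

text \<open>
  For \<open>f\<close> with vanishing quasi-derivative at \<open>0\<close>, Green's identity shows that \<open>\<integral> w cnj f h\<close> is real and
  equals \<open>- D(f)\<close>. The first claim is Pythagoras' theorem for \<open>h\<close> and \<open>\<i> y f\<close>; the second is
  \<open>- 2 y Re (cnj f h) \<le> |h|\<^sup>2 + y\<^sup>2 |f|\<^sup>2\<close>.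
\<close>

lemma admissible_zero_facts:
  fixes f g h :: "real \<Rightarrow> complex"
  assumes a: "admissible f g h" and g0: "g 0 = 0" and y: "0 < y"
  shows "IE (\<lambda>x. (cmod (h x + \<i> * of_real y * f x))\<^sup>2 * w x)
      = IE (\<lambda>x. (cmod (h x))\<^sup>2 * w x) + y\<^sup>2 * IE (\<lambda>x. (cmod (f x))\<^sup>2 * w x)" (is ?eq)
    and "2 * y * IE (\<lambda>x. r x * (cmod (g x))\<^sup>2)
      \<le> IE (\<lambda>x. (cmod (h x))\<^sup>2 * w x) + y\<^sup>2 * IE (\<lambda>x. (cmod (f x))\<^sup>2 * w x)" (is ?le)
proof -
  have L: "L2w b w f" "L2w b w h" using a unfolding admissible_def by auto
  note N = norm_square_L2w[OF L(1)] and H = norm_square_L2w[OF L(2)]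
  note N' = intE_cmult[OF N, of "y\<^sup>2"]
  note G = green_complex[OF a]
  note I' = intE_cmult[OF G(3), of "2 * y"]
  note R' = intE_cmult[OF G(2), of "- 2 * y"]
  have eq: "(cmod (h x + \<i> * of_real y * f x))\<^sup>2 * w x
    = ((cmod (h x))\<^sup>2 * w x + y\<^sup>2 * ((cmod (f x))\<^sup>2 * w x)) + 2 * y * (w x * Im (cnj (f x) * h x))" for x
    unfolding cmod_power2 by (simp add: power2_eq_square algebra_simps)
  have HN: "intE (\<lambda>x. (cmod (h x))\<^sup>2 * w x + y\<^sup>2 * ((cmod (f x))\<^sup>2 * w x))"
    by (rule set_integral_add(1)[OF H N'])
  show ?eq unfolding eq using set_integral_add(2)[OF HN I'] set_integral_add(2)[OF H N'] G(5) g0 by simp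
  have "IE (\<lambda>x. - 2 * y * (w x * Re (cnj (f x) * h x))) \<le> IE (\<lambda>x. (cmod (h x))\<^sup>2 * w x + y\<^sup>2 * ((cmod (f x))\<^sup>2 * w x))"
  proof (rule IE_mono[OF _ HN])
    show "AE x in lebesgue. x \<in> einterval 0 b \<longrightarrow>
      - 2 * y * (w x * Re (cnj (f x) * h x)) \<le> (cmod (h x))\<^sup>2 * w x + y\<^sup>2 * ((cmod (f x))\<^sup>2 * w x)"
      using w_nonneg
    proof eventually_elim
      case (elim x)
      have "(cmod (h x + of_real y * f x))\<^sup>2 = (cmod (h x))\<^sup>2 + y\<^sup>2 * (cmod (f x))\<^sup>2 + 2 * y * Re (cnj (f x) * h x)"
        unfolding cmod_power2 by (simp add: power2_eq_square algebra_simps)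
      moreover have "0 \<le> (cmod (h x + of_real y * f x))\<^sup>2" by simp
      ultimately have "- 2 * y * Re (cnj (f x) * h x) \<le> (cmod (h x))\<^sup>2 + y\<^sup>2 * (cmod (f x))\<^sup>2" by linarith
      then have le: "0 \<le> w x \<Longrightarrow> (- 2 * y * Re (cnj (f x) * h x)) * w x \<le> ((cmod (h x))\<^sup>2 + y\<^sup>2 * (cmod (f x))\<^sup>2) * w x"
        by (rule mult_right_mono)
      have e1: "(- 2 * y * Re (cnj (f x) * h x)) * w x = - 2 * y * (w x * Re (cnj (f x) * h x))"
        by (simp only: mult_ac)
      have e2: "((cmod (h x))\<^sup>2 + y\<^sup>2 * (cmod (f x))\<^sup>2) * w x = (cmod (h x))\<^sup>2 * w x + y\<^sup>2 * ((cmod (f x))\<^sup>2 * w x)"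
        by (simp only: distrib_right mult.assoc)
      show ?case using le elim unfolding e1 e2 by blast
    qed
  qed (rule R')
  then have "- 2 * y * IE (\<lambda>x. w x * Re (cnj (f x) * h x)) \<le> IE (\<lambda>x. (cmod (h x))\<^sup>2 * w x) + y\<^sup>2 * IE (\<lambda>x. (cmod (f x))\<^sup>2 * w x)"
    unfolding set_integral_mult_right set_integral_add(2)[OF H N'] .
  moreover have "IE (\<lambda>x. r x * (cmod (g x))\<^sup>2) = - IE (\<lambda>x. w x * Re (cnj (f x) * h x))" using G(4) g0 by simp
  ultimately show ?le by simp
qed

lemma dirichlet_bound:
  assumes a: "admissible f g h" and y: "0 < y" and M: "0 \<le> M"
    and m: "Re (neumann_m b w r (\<i> * of_real y)) \<le> M * Im (neumann_m b w r (\<i> * of_real y))"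
  shows "IE (\<lambda>x. r x * (cmod (g x))\<^sup>2)
    \<le> (2 + 12 * M) * (IE (\<lambda>x. (cmod (h x))\<^sup>2 * w x) / y + y * IE (\<lambda>x. (cmod (f x))\<^sup>2 * w x))"
proof -
  let ?N = "\<lambda>f. IE (\<lambda>x. (cmod (f x))\<^sup>2 * w x)"
  let ?D = "\<lambda>g. IE (\<lambda>x. r x * (cmod (g x))\<^sup>2)"
  define \<mu> where "\<mu> = neumann_m b w r (\<i> * of_real y)"
  obtain \<psi> \<psi>1 where e: "eigen_system y \<psi> \<psi>1" "\<psi> 0 = - \<mu>" "\<psi>1 0 = 1"
    and p: "admissible \<psi> \<psi>1 (\<lambda>x. - (\<i> * of_real y) * \<psi> x)"
    unfolding \<mu>_def by (rule neumann_m_solution[OF y])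
  note v = neumann_m_values[OF y e p]
  \<comment> \<open>Subtracting \<open>\<alpha> \<psi>\<close> removes the quasi-derivative at \<open>0\<close> without changing \<open>h + \<i> y f\<close>.\<close>
  define \<alpha> where "\<alpha> = g 0"
  define f0 where "f0 x = f x + - \<alpha> * \<psi> x" for x
  define g0 where "g0 x = g x + - \<alpha> * \<psi>1 x" for x
  define h0 where "h0 x = h x + - \<alpha> * (- (\<i> * of_real y) * \<psi> x)" for x
  have a0: "admissible f0 g0 h0"
    unfolding f0_def[abs_def] g0_def[abs_def] h0_def[abs_def]
    by (rule admissible_add[OF a admissible_bounded_linear[OF p bounded_linear_mult_right]])
  have g00: "g0 0 = 0" by (simp add: g0_def \<alpha>_def e)
  define \<Phi> where "\<Phi> = ?N (\<lambda>x. h x + \<i> * of_real y * f x)"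
  have Lf: "L2w b w f" "L2w b w h" "L2w b w \<psi>" "L2w b w f0" using a a0 p unfolding admissible_def by auto
  have nn: "0 \<le> ?N F" if "L2w b w F" for F :: "real \<Rightarrow> complex"
    by (rule nn_IE(2)[OF norm_square_L2w[OF that]]) (use w_nonneg in eventually_elim; simp)
  have phi: "h0 x + \<i> * of_real y * f0 x = h x + \<i> * of_real y * f x" for x
    by (simp add: f0_def h0_def algebra_simps)
  have \<Phi>0: "\<Phi> = ?N h0 + y\<^sup>2 * ?N f0"
    using admissible_zero_facts(1)[OF a0 g00 y] unfolding phi \<Phi>_def .
  have D0: "2 * y * ?D g0 \<le> \<Phi>" using admissible_zero_facts(2)[OF a0 g00 y] unfolding \<Phi>0 .
  have "L2w b w h0" using a0 unfolding admissible_def by auto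
  then have N0: "y\<^sup>2 * ?N f0 \<le> \<Phi>" using nn unfolding \<Phi>0 by simp
  have \<Phi>le: "\<Phi> \<le> 2 * ?N h + 2 * (y\<^sup>2 * ?N f)"
  proof -
    have eq: "(cmod (\<i> * of_real y * f x))\<^sup>2 * w x = y\<^sup>2 * ((cmod (f x))\<^sup>2 * w x)" for x
      by (simp add: norm_mult power_mult_distrib)
    have "\<Phi> \<le> 2 * ?N h + 2 * ?N (\<lambda>x. \<i> * of_real y * f x)"
      unfolding \<Phi>_def by (rule IE_norm_add_le[OF Lf(2) L2w_bounded_linear[OF Lf(1) bounded_linear_mult_right]])
    then show ?thesis unfolding eq set_integral_mult_right .
  qed
  have N\<psi>: "(cmod \<alpha>)\<^sup>2 * ?N \<psi> \<le> 2 * ?N f + 2 * ?N f0"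
  proof -
    have eq: "(cmod (f x + - 1 * f0 x))\<^sup>2 * w x = (cmod \<alpha>)\<^sup>2 * ((cmod (\<psi> x))\<^sup>2 * w x)" for x
      by (simp add: f0_def norm_mult power_mult_distrib)
    have eq': "(cmod (- 1 * f0 x))\<^sup>2 * w x = (cmod (f0 x))\<^sup>2 * w x" for x by simp
    show ?thesis
      using IE_norm_add_le[OF Lf(1) L2w_bounded_linear[OF Lf(4) bounded_linear_mult_right[of "- 1"]]]
      unfolding eq eq' set_integral_mult_right .
  qed
  have Dle: "?D g \<le> 2 * ?D g0 + 2 * ((cmod \<alpha>)\<^sup>2 * Re \<mu>)"
  proof -
    note i = intE_cmult[OF green_complex(1)[OF a0], of 2]
      intE_cmult[OF green_complex(1)[OF p], of "2 * (cmod \<alpha>)\<^sup>2"]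
    have "?D g \<le> IE (\<lambda>x. 2 * (r x * (cmod (g0 x))\<^sup>2) + 2 * (cmod \<alpha>)\<^sup>2 * (r x * (cmod (\<psi>1 x))\<^sup>2))"
    proof (rule IE_mono[OF green_complex(1)[OF a] set_integral_add(1)[OF i]])
      show "AE x in lebesgue. x \<in> einterval 0 b \<longrightarrow> r x * (cmod (g x))\<^sup>2
        \<le> 2 * (r x * (cmod (g0 x))\<^sup>2) + 2 * (cmod \<alpha>)\<^sup>2 * (r x * (cmod (\<psi>1 x))\<^sup>2)"
        using r_nonneg
      proof eventually_elim
        case (elim x)
        have "(cmod (g0 x - - (\<alpha> * \<psi>1 x)))\<^sup>2 \<le> 2 * (cmod (g0 x))\<^sup>2 + 2 * (cmod (- (\<alpha> * \<psi>1 x)))\<^sup>2"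
          by (rule norm_diff_square_le)
        then have "(cmod (g x))\<^sup>2 \<le> 2 * (cmod (g0 x))\<^sup>2 + 2 * (cmod \<alpha>)\<^sup>2 * (cmod (\<psi>1 x))\<^sup>2"
          by (simp add: g0_def norm_mult power_mult_distrib)
        then have "0 \<le> r x \<Longrightarrow> r x * (cmod (g x))\<^sup>2 \<le> r x * (2 * (cmod (g0 x))\<^sup>2 + 2 * (cmod \<alpha>)\<^sup>2 * (cmod (\<psi>1 x))\<^sup>2)"
          by (rule mult_left_mono)
        then show ?case using elim by (simp add: algebra_simps)
      qed
    qed
    then show ?thesis using set_integral_add(2)[OF i] v(1) by simp
  qed
  have m': "Re \<mu> \<le> M * (y * ?N \<psi>)" using m v(2) by (simp add: \<mu>_def)
  have "(cmod \<alpha>)\<^sup>2 * Re \<mu> \<le> (cmod \<alpha>)\<^sup>2 * (M * (y * ?N \<psi>))" by (rule mult_left_mono[OF m']) simp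
  also have "\<dots> = M * y * ((cmod \<alpha>)\<^sup>2 * ?N \<psi>)" by (simp add: mult_ac)
  also have "\<dots> \<le> M * y * (2 * ?N f + 2 * ?N f0)" using M y by (intro mult_left_mono[OF N\<psi>]) simp
  finally have 1: "(cmod \<alpha>)\<^sup>2 * Re \<mu> \<le> M * y * (2 * ?N f + 2 * ?N f0)" .
  define N where "N = ?N f"
  define H where "H = ?N h"
  have NH: "0 \<le> N" "0 \<le> H" unfolding N_def H_def by (intro nn Lf)+
  have 2: "?N f0 \<le> (2 * H + 2 * (y\<^sup>2 * N)) / y\<^sup>2"
    using order_trans[OF N0 \<Phi>le] y by (simp add: N_def H_def pos_le_divide_eq mult.commute)
  have 3: "2 * ?D g0 \<le> (2 * H + 2 * (y\<^sup>2 * N)) / y"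
    using order_trans[OF D0 \<Phi>le] y by (simp add: N_def H_def pos_le_divide_eq mult_ac)
  have "M * y * (2 * N + 2 * ?N f0) \<le> M * y * (2 * N + 2 * ((2 * H + 2 * (y\<^sup>2 * N)) / y\<^sup>2))"
    using M y by (intro mult_left_mono add_left_mono 2) auto
  then have "?D g \<le> (2 * H + 2 * (y\<^sup>2 * N)) / y + 2 * (M * y * (2 * N + 2 * ((2 * H + 2 * (y\<^sup>2 * N)) / y\<^sup>2)))"
    using Dle 1 3 unfolding N_def[symmetric] by linarith
  also have "\<dots> = (2 + 8 * M) * (H / y) + (2 + 12 * M) * (y * N)"
    using y by (simp add: field_simps power2_eq_square)
  also have "\<dots> \<le> (2 + 12 * M) * (H / y) + (2 + 12 * M) * (y * N)"
    using M y NH by (intro add_right_mono mult_right_mono) auto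
  finally show ?thesis unfolding N_def H_def by (simp add: distrib_left)
qed

lemma inequality_of_ratio_le:
  assumes M: "0 \<le> M"
    and ratio: "\<And>y. 0 < y \<Longrightarrow> Re (neumann_m b w r (\<i> * of_real y)) / Im (neumann_m b w r (\<i> * of_real y)) \<le> M"
    and a: "admissible f g h"
  shows "(IE (\<lambda>x. r x * (cmod (g x))\<^sup>2))\<^sup>2
    \<le> (2 * (2 + 12 * M))\<^sup>2 * IE (\<lambda>x. (cmod (f x))\<^sup>2 * w x) * IE (\<lambda>x. (cmod (h x))\<^sup>2 * w x)"
proof (rule square_le_of_scaled_bound)
  have L: "L2w b w f" "L2w b w h" using a unfolding admissible_def by auto
  show "0 \<le> IE (\<lambda>x. r x * (cmod (g x))\<^sup>2)"
    by (rule nn_IE(2)[OF green_complex(1)[OF a]]) (use r_nonneg in eventually_elim; simp)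
  show "0 \<le> IE (\<lambda>x. (cmod (f x))\<^sup>2 * w x)" "0 \<le> IE (\<lambda>x. (cmod (h x))\<^sup>2 * w x)"
    by (rule nn_IE(2)[OF norm_square_L2w]; (rule L | use w_nonneg in eventually_elim; simp))+
  show "0 < 2 + 12 * M" using M by simp
  fix y :: real assume y: "0 < y"
  obtain \<psi> \<psi>1 where "eigen_system y \<psi> \<psi>1" "\<psi> 0 = - neumann_m b w r (\<i> * of_real y)" "\<psi>1 0 = 1"
    "admissible \<psi> \<psi>1 (\<lambda>x. - (\<i> * of_real y) * \<psi> x)"
    by (rule neumann_m_solution[OF y])
  from neumann_m_values(3)[OF y this] ratio[OF y]
  have "Re (neumann_m b w r (\<i> * of_real y)) \<le> M * Im (neumann_m b w r (\<i> * of_real y))"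
    by (simp add: pos_divide_le_eq)
  then show "IE (\<lambda>x. r x * (cmod (g x))\<^sup>2)
    \<le> (2 + 12 * M) * (IE (\<lambda>x. (cmod (h x))\<^sup>2 * w x) / y + y * IE (\<lambda>x. (cmod (f x))\<^sup>2 * w x))"
    by (rule dirichlet_bound[OF a y M])
qed

text \<open>
  The inequality as stated with extended nonnegative integrals and almost everywhere derivatives, in terms
  of the finite integrals of an admissible triple.
\<close>

lemma inequality_iff:
  fixes f g h :: "real \<Rightarrow> complex"
  assumes a: "admissible f g h" and K: "0 < K"
  shows "(\<integral>\<^sup>+x\<in>einterval 0 b. ennreal (1 / r x * (cmod (vector_derivative f (at x)))\<^sup>2) \<partial>lebesgue)\<^sup>2
            \<le> ennreal (K\<^sup>2)
               * (\<integral>\<^sup>+x\<in>einterval 0 b. ennreal ((cmod (f x))\<^sup>2 * w x) \<partial>lebesgue)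
               * (\<integral>\<^sup>+x\<in>einterval 0 b. ennreal (1 / w x
                    * (cmod (vector_derivative (quasi_deriv b r f) (at x)))\<^sup>2) \<partial>lebesgue)
     \<longleftrightarrow> (IE (\<lambda>x. r x * (cmod (g x))\<^sup>2))\<^sup>2
          \<le> K\<^sup>2 * IE (\<lambda>x. (cmod (f x))\<^sup>2 * w x) * IE (\<lambda>x. (cmod (h x))\<^sup>2 * w x)"
proof -
  have f: "primitive b f (\<lambda>x. r x *\<^sub>R g x)" and g: "primitive b g (\<lambda>x. w x *\<^sub>R h x)"
    and L: "L2w b w f" "L2w b w h" using a unfolding admissible_def by auto
  have eD: "(\<integral>\<^sup>+x\<in>einterval 0 b. ennreal (1 / r x * (cmod (vector_derivative f (at x)))\<^sup>2) \<partial>lebesgue)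
      = (\<integral>\<^sup>+x\<in>einterval 0 b. ennreal (r x * (cmod (g x))\<^sup>2) \<partial>lebesgue)"
  proof (rule nn_integral_cong_AE)
    show "AE x in lebesgue. ennreal (1 / r x * (cmod (vector_derivative f (at x)))\<^sup>2) * indicator (einterval 0 b) x
      = ennreal (r x * (cmod (g x))\<^sup>2) * indicator (einterval 0 b) x"
      using primitive_has_vector_derivative_ae[OF f] r_pos
    proof eventually_elim
      case (elim x)
      show ?case
      proof (cases "x \<in> einterval 0 b")
        case True
        then have "vector_derivative f (at x) = r x *\<^sub>R g x" "0 < r x" using elim by (auto intro: vector_derivative_at)
        then show ?thesis by (simp add: power_mult_distrib power2_eq_square mult_ac)
      qed simp
    qed
  qed
  have eH: "(\<integral>\<^sup>+x\<in>einterval 0 b. ennreal (1 / w x * (cmod (vector_derivative (quasi_deriv b r f) (at x)))\<^sup>2) \<partial>lebesgue)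
      = (\<integral>\<^sup>+x\<in>einterval 0 b. ennreal ((cmod (h x))\<^sup>2 * w x) \<partial>lebesgue)"
  proof (rule nn_integral_cong_AE)
    show "AE x in lebesgue. ennreal (1 / w x * (cmod (vector_derivative (quasi_deriv b r f) (at x)))\<^sup>2) * indicator (einterval 0 b) x
      = ennreal ((cmod (h x))\<^sup>2 * w x) * indicator (einterval 0 b) x"
      using primitive_has_vector_derivative_ae[OF primitive_quasi_deriv[OF f g]] w_pos
    proof eventually_elim
      case (elim x)
      show ?case
      proof (cases "x \<in> einterval 0 b")
        case True
        then have "vector_derivative (quasi_deriv b r f) (at x) = w x *\<^sub>R h x" "0 < w x" using elim by (auto intro: vector_derivative_at)
        then show ?thesis by (simp add: power_mult_distrib power2_eq_square mult_ac)
      qed simp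
    qed
  qed
  have wn: "AE x in lebesgue. x \<in> einterval 0 b \<longrightarrow> 0 \<le> (cmod (F x))\<^sup>2 * w x" for F
    using w_nonneg by eventually_elim simp
  have rn: "AE x in lebesgue. x \<in> einterval 0 b \<longrightarrow> 0 \<le> r x * (cmod (g x))\<^sup>2"
    using r_nonneg by eventually_elim simp
  note D = nn_IE[OF green_complex(1)[OF a] rn] and N = nn_IE[OF norm_square_L2w[OF L(1)] wn]
    and H = nn_IE[OF norm_square_L2w[OF L(2)] wn]
  show ?thesis
    unfolding eD eH D(1) N(1) H(1) using D(2) N(2) H(2)
    by (simp add: ennreal_power ennreal_mult[symmetric] ennreal_le_iff)
qed

end

theorem theorem3p4:
  fixes b :: ereal and w r :: "real \<Rightarrow> real"
  assumes "0 < b"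
    and "L1_loc b w" and "L1_loc b r"
    and "AE x in lebesgue. x \<in> einterval 0 b \<longrightarrow> 0 < w x"
    and "AE x in lebesgue. x \<in> einterval 0 b \<longrightarrow> 0 < r x"
  shows "(\<exists>K::real. K > 0 \<and> (\<forall>f \<in> dom_A_plus b w r.
            (\<integral>\<^sup>+x\<in>einterval 0 b. ennreal (1 / r x * (cmod (vector_derivative f (at x)))\<^sup>2) \<partial>lebesgue)\<^sup>2
            \<le> ennreal (K\<^sup>2)
               * (\<integral>\<^sup>+x\<in>einterval 0 b. ennreal ((cmod (f x))\<^sup>2 * w x) \<partial>lebesgue)
               * (\<integral>\<^sup>+x\<in>einterval 0 b. ennreal (1 / w x
                    * (cmod (vector_derivative (quasi_deriv b r f) (at x)))\<^sup>2) \<partial>lebesgue)))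
     \<longleftrightarrow> (SUP y\<in>{0<..}. ereal (Re (neumann_m b w r (\<i> * of_real y))
                               / Im (neumann_m b w r (\<i> * of_real y)))) < \<infinity>"
    (is "?valid \<longleftrightarrow> ?sup < \<infinity>")
proof -
  interpret sturm_liouville b w r using assms by unfold_locales
  show ?thesis
  proof
    assume ?valid
    then obtain K where K: "K > 0" and ineq: "\<And>f. f \<in> dom_A_plus b w r \<Longrightarrow>
        (\<integral>\<^sup>+x\<in>einterval 0 b. ennreal (1 / r x * (cmod (vector_derivative f (at x)))\<^sup>2) \<partial>lebesgue)\<^sup>2
            \<le> ennreal (K\<^sup>2)
               * (\<integral>\<^sup>+x\<in>einterval 0 b. ennreal ((cmod (f x))\<^sup>2 * w x) \<partial>lebesgue)
               * (\<integral>\<^sup>+x\<in>einterval 0 b. ennreal (1 / w x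
                    * (cmod (vector_derivative (quasi_deriv b r f) (at x)))\<^sup>2) \<partial>lebesgue)" by blast
    have "Re (neumann_m b w r (\<i> * of_real y)) / Im (neumann_m b w r (\<i> * of_real y)) \<le> K" if "y > 0" for y
      by (rule ratio_le_of_inequality[OF K _ that]) (use ineq admissible_imp_dom_A_plus inequality_iff[OF _ K] in blast)
    then have "?sup \<le> ereal K" by (intro SUP_least) auto
    then show "?sup < \<infinity>" by (rule le_less_trans) simp
  next
    assume "?sup < \<infinity>"
    then obtain n :: nat where n: "?sup < ereal (real n)" using less_PInf_Ex_of_nat by auto
    have ratio: "Re (neumann_m b w r (\<i> * of_real y)) / Im (neumann_m b w r (\<i> * of_real y)) \<le> real n" if "0 < y" for y
    proof -
      have "ereal (Re (neumann_m b w r (\<i> * of_real y)) / Im (neumann_m b w r (\<i> * of_real y))) \<le> ?sup"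
        by (rule SUP_upper) (use that in simp)
      with n have "ereal (Re (neumann_m b w r (\<i> * of_real y)) / Im (neumann_m b w r (\<i> * of_real y))) < ereal (real n)"
        by (rule le_less_trans[rotated])
      then show ?thesis by simp
    qed
    have K: "0 < 2 * (2 + 12 * real n)" by simp
    show ?valid
    proof (intro exI[of _ "2 * (2 + 12 * real n)"] conjI K ballI)
      fix f assume "f \<in> dom_A_plus b w r"
      then obtain h where a: "admissible f (quasi_deriv b r f) h" by (rule dom_A_plus_imp_admissible)
      show "(\<integral>\<^sup>+x\<in>einterval 0 b. ennreal (1 / r x * (cmod (vector_derivative f (at x)))\<^sup>2) \<partial>lebesgue)\<^sup>2
            \<le> ennreal ((2 * (2 + 12 * real n))\<^sup>2)
               * (\<integral>\<^sup>+x\<in>einterval 0 b. ennreal ((cmod (f x))\<^sup>2 * w x) \<partial>lebesgue)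
               * (\<integral>\<^sup>+x\<in>einterval 0 b. ennreal (1 / w x
                    * (cmod (vector_derivative (quasi_deriv b r f) (at x)))\<^sup>2) \<partial>lebesgue)"
        unfolding inequality_iff[OF a K] by (rule inequality_of_ratio_le[OF _ ratio a]) simp
    qed
  qed
qed

end
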